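(* We are given a multigraph $(V,E)$ with $m$ edges, a teleportation constant $\alpha\in(0,1/3]$, an initial mass distribution $p^\circ$ of total mass $1$, and a listing of the vertices with positive mass in order of non-increasing density. Let $p^*=\mathrm{PR}(\alpha,p^\circ)$. We are also given a parameter $\gamma$ with $0<\gamma<1$. There is a (PageRank) algorithm that, starting from $p^\circ$, will either find a set $T\subseteq V$ with $\mathrm{vol}(T)\le m$ and conductance $$\Phi(T)=O\left(\sqrt{(\alpha\log m)/\gamma}\right),$$ or certify that there is no vertex $u$ with $p^*(u)/d(u)\le(1-\gamma)/(2m)$. The running time of the algorithm is $O(m/(\gamma\alpha))$, and, depending on the input, it will always end in one of the following cases: (i) The set $T$ is found in time $O(\mathrm{vol}(T)(\log m)/(\gamma\alpha))$ and has $\mathrm{excess}(p^*,T)\ge\gamma/(64\lg(8m))$. (ii) The set $T$ is guaranteed to contain all small density vertices $u$ with $p^*(u)/d(u)\le(1-\gamma)/(2m)$. (In this case, even if $T$ is small, there is no better time bound than $O(m/(\gamma\alpha))$.) (iii) A certificate that there is no vertex $u$ with $p^*(u)/d(u)\le(1-\gamma)/(2m)$.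
   Context: Graphs are finite and undirected; multigraphs may have parallel edges. $d(v)$ is the degree of $v$ (counting parallel edges), $\mathrm{vol}(U)=\sum_{v\in U}d(v)$, $\partial U$ is the set of edges between $U$ and $V\setminus U$, and $\Phi(U)=|\partial U|/\min\{\mathrm{vol}(U),\mathrm{vol}(V\setminus U)\}$. $\lg=\log_2$. A mass distribution is a function $p:V\to\mathbb R_{\ge0}$; $p(U)=\sum_{v\in U}p(v)$; the density of $p$ at $v$ is $p(v)/d(v)$. PageRank with teleportation constant $\alpha$: maintain a residual mass $r$, initially $p^\circ$, and a settled mass $p$, initially $0$. A push at $u$ does: $p(u)\leftarrow p(u)+\alpha r(u)$; for each edge $(u,v)\in E$, $r(v)\leftarrow r(v)+(1-\alpha)r(u)/(2d(u))$; and $r(u)\leftarrow(1-\alpha)r(u)/2$ (using the old value of $r(u)$ throughout). For $\varepsilon>0$, the process keeps pushing from vertices $u$ with $r(u)/d(u)\ge\varepsilon$ until there are none. As $\varepsilon\to0$, the settled mass converges to a unique limit, independent of the order of pushes, denoted $\mathrm{PR}(\alpha,p^\circ)$, the limit mass distribution. For a mass distribution $q$ of total mass 1 and $S\subseteq V$, $\mathrm{excess}(q,S)=q(S)-\mathrm{vol}(S)/(2m)$. "Certify" means that the algorithm ends in this outcome only if the asserted property is true. *)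

theory Defs
  imports "HOL-Analysis.Analysis"
begin

section \<open>Multigraphs\<close>

text \<open>Edges are two-element vertex sets; parallel edges are multiple occurrences in the
  multiset, and there are no loops.\<close>

record 'v mgraph =
  verts :: "'v set"
  edges :: "'v set multiset"

definition multigraph :: "'v mgraph \<Rightarrow> bool" where
  "multigraph G \<longleftrightarrow> finite (verts G) \<and> (\<forall>e \<in># edges G. e \<subseteq> verts G \<and> card e = 2)"

definition num_edges :: "'v mgraph \<Rightarrow> nat" where
  "num_edges G = size (edges G)"

definition deg :: "'v mgraph \<Rightarrow> 'v \<Rightarrow> nat" where
  "deg G v = size {#e \<in># edges G. v \<in> e#}"

definition vol :: "'v mgraph \<Rightarrow> 'v set \<Rightarrow> nat" where
  "vol G U = (\<Sum>v\<in>U. deg G v)"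

definition boundary :: "'v mgraph \<Rightarrow> 'v set \<Rightarrow> 'v set multiset" where
  "boundary G U = {#e \<in># edges G. \<exists>u\<in>U. \<exists>v\<in>verts G - U. e = {u, v}#}"

text \<open>The quotient is only meaningful if both sides have positive volume (division by zero
  gives zero here).\<close>

definition conductance :: "'v mgraph \<Rightarrow> 'v set \<Rightarrow> real" where
  "conductance G U =
     real (size (boundary G U)) / real (min (vol G U) (vol G (verts G - U)))"


section \<open>Mass distributions and PageRank\<close>

definition mass_distribution :: "'v mgraph \<Rightarrow> ('v \<Rightarrow> real) \<Rightarrow> bool" where
  "mass_distribution G p \<longleftrightarrow> (\<forall>v\<in>verts G. 0 \<le> p v)"

definition mass :: "('v \<Rightarrow> real) \<Rightarrow> 'v set \<Rightarrow> real" where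
  "mass p U = (\<Sum>v\<in>U. p v)"

definition mass_density :: "'v mgraph \<Rightarrow> ('v \<Rightarrow> real) \<Rightarrow> 'v \<Rightarrow> real" where
  "mass_density G p v = p v / real (deg G v)"

definition excess :: "'v mgraph \<Rightarrow> ('v \<Rightarrow> real) \<Rightarrow> 'v set \<Rightarrow> real" where
  "excess G q S = mass q S - real (vol G S) / (2 * real (num_edges G))"

text \<open>States of the push process are pairs of settled mass and residual mass. A vertex
  receives one share of the pushed mass for every parallel edge.\<close>

definition push ::
  "'v mgraph \<Rightarrow> real \<Rightarrow> 'v \<Rightarrow> ('v \<Rightarrow> real) \<times> ('v \<Rightarrow> real) \<Rightarrow> ('v \<Rightarrow> real) \<times> ('v \<Rightarrow> real)" where
  "push G \<alpha> u = (\<lambda>(p, r).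
     (p(u := p u + \<alpha> * r u),
      \<lambda>v. if v = u then (1 - \<alpha>) * r u / 2
          else r v + real (count (edges G) {u, v}) * ((1 - \<alpha>) * r u / (2 * real (deg G u)))))"

inductive push_reachable ::
  "'v mgraph \<Rightarrow> real \<Rightarrow> real \<Rightarrow> ('v \<Rightarrow> real) \<Rightarrow> ('v \<Rightarrow> real) \<times> ('v \<Rightarrow> real) \<Rightarrow> bool"
  for G \<alpha> \<epsilon> p0 where
  init: "push_reachable G \<alpha> \<epsilon> p0 (\<lambda>_. 0, p0)"
| step: "push_reachable G \<alpha> \<epsilon> p0 (p, r) \<Longrightarrow> u \<in> verts G \<Longrightarrow> mass_density G r u \<ge> \<epsilon>
         \<Longrightarrow> push_reachable G \<alpha> \<epsilon> p0 (push G \<alpha> u (p, r))"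

text \<open>The possible settled masses, over all orders of pushes, when the process stops.\<close>

definition settled :: "'v mgraph \<Rightarrow> real \<Rightarrow> real \<Rightarrow> ('v \<Rightarrow> real) \<Rightarrow> ('v \<Rightarrow> real) set" where
  "settled G \<alpha> \<epsilon> p0 =
     {p. \<exists>r. push_reachable G \<alpha> \<epsilon> p0 (p, r) \<and> (\<forall>u\<in>verts G. mass_density G r u < \<epsilon>)}"

text \<open>The limit of the settled mass for residual thresholds tending to zero from above,
  uniformly over all orders of pushes; it is normalised to zero outside the vertex set.\<close>

definition PR :: "'v mgraph \<Rightarrow> real \<Rightarrow> ('v \<Rightarrow> real) \<Rightarrow> 'v \<Rightarrow> real" where
  "PR G \<alpha> p0 = (THE q.
     (\<forall>v. v \<notin> verts G \<longrightarrow> q v = 0) \<and>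
     (\<forall>v\<in>verts G. \<forall>\<eta>>0. \<forall>\<^sub>F \<epsilon> in at_right 0.
        \<forall>p\<in>settled G \<alpha> \<epsilon> p0. \<bar>p v - q v\<bar> < \<eta>))"


section \<open>A real RAM\<close>

text \<open>
  Algorithms are programs of a small imperative language over variables and arrays that hold
  either natural numbers or real numbers. Every arithmetic operation, comparison, memory access
  and control step costs one time unit. As in the standard real RAM, real numbers are exact and
  cannot be converted to natural numbers (no rounding), and only natural numbers serve as
  addresses. On natural numbers there is only addition and (truncated) subtraction, so that unit
  cost is not abused by multiplying huge integers. Programs contain no real constants.
\<close>

type_synonym ident = string

datatype nexp =
    NConst nat
  | NVar ident
  | NArr ident nexp
  | NAdd nexp nexp
  | NSub nexp nexp

datatype rexp =
    RNat nexp
  | RVar ident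
  | RArr ident nexp
  | RAdd rexp rexp
  | RSub rexp rexp
  | RMul rexp rexp
  | RDiv rexp rexp

datatype bexp =
    NLess nexp nexp
  | RLess rexp rexp
  | BNot bexp
  | BAnd bexp bexp

datatype com =
    Skip
  | NAssign ident nexp
  | NStore ident nexp nexp
  | RAssign ident rexp
  | RStore ident nexp rexp
  | Seq com com
  | Cond bexp com com
  | While bexp com

record state =
  nvar :: "ident \<Rightarrow> nat"
  rvar :: "ident \<Rightarrow> real"
  narr :: "ident \<Rightarrow> nat \<Rightarrow> nat"
  rarr :: "ident \<Rightarrow> nat \<Rightarrow> real"

primrec nval :: "nexp \<Rightarrow> state \<Rightarrow> nat" where
  "nval (NConst k) s = k"
| "nval (NVar x) s = nvar s x"
| "nval (NArr a e) s = narr s a (nval e s)"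
| "nval (NAdd e f) s = nval e s + nval f s"
| "nval (NSub e f) s = nval e s - nval f s"

primrec rval :: "rexp \<Rightarrow> state \<Rightarrow> real" where
  "rval (RNat e) s = real (nval e s)"
| "rval (RVar x) s = rvar s x"
| "rval (RArr a e) s = rarr s a (nval e s)"
| "rval (RAdd e f) s = rval e s + rval f s"
| "rval (RSub e f) s = rval e s - rval f s"
| "rval (RMul e f) s = rval e s * rval f s"
| "rval (RDiv e f) s = rval e s / rval f s"

primrec bval :: "bexp \<Rightarrow> state \<Rightarrow> bool" where
  "bval (NLess e f) s \<longleftrightarrow> nval e s < nval f s"
| "bval (RLess e f) s \<longleftrightarrow> rval e s < rval f s"
| "bval (BNot b) s \<longleftrightarrow> \<not> bval b s"
| "bval (BAnd b c) s \<longleftrightarrow> bval b s \<and> bval c s"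

primrec ncost :: "nexp \<Rightarrow> nat" where
  "ncost (NConst k) = 1"
| "ncost (NVar x) = 1"
| "ncost (NArr a e) = 1 + ncost e"
| "ncost (NAdd e f) = 1 + ncost e + ncost f"
| "ncost (NSub e f) = 1 + ncost e + ncost f"

primrec rcost :: "rexp \<Rightarrow> nat" where
  "rcost (RNat e) = 1 + ncost e"
| "rcost (RVar x) = 1"
| "rcost (RArr a e) = 1 + ncost e"
| "rcost (RAdd e f) = 1 + rcost e + rcost f"
| "rcost (RSub e f) = 1 + rcost e + rcost f"
| "rcost (RMul e f) = 1 + rcost e + rcost f"
| "rcost (RDiv e f) = 1 + rcost e + rcost f"

primrec bcost :: "bexp \<Rightarrow> nat" where
  "bcost (NLess e f) = 1 + ncost e + ncost f"
| "bcost (RLess e f) = 1 + rcost e + rcost f"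
| "bcost (BNot b) = 1 + bcost b"
| "bcost (BAnd b c) = 1 + bcost b + bcost c"

text \<open>\<open>exec c s t s'\<close>: started in \<open>s\<close>, program \<open>c\<close> halts in \<open>s'\<close> after \<open>t\<close> time units.\<close>

inductive exec :: "com \<Rightarrow> state \<Rightarrow> nat \<Rightarrow> state \<Rightarrow> bool" where
  Skip: "exec Skip s 1 s"
| NAssign: "exec (NAssign x e) s (1 + ncost e) (s\<lparr>nvar := (nvar s)(x := nval e s)\<rparr>)"
| NStore: "exec (NStore a i e) s (1 + ncost i + ncost e)
    (s\<lparr>narr := (narr s)(a := (narr s a)(nval i s := nval e s))\<rparr>)"
| RAssign: "exec (RAssign x e) s (1 + rcost e) (s\<lparr>rvar := (rvar s)(x := rval e s)\<rparr>)"
| RStore: "exec (RStore a i e) s (1 + ncost i + rcost e)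
    (s\<lparr>rarr := (rarr s)(a := (rarr s a)(nval i s := rval e s))\<rparr>)"
| Seq: "exec c s t s' \<Longrightarrow> exec d s' t' s'' \<Longrightarrow> exec (Seq c d) s (t + t') s''"
| CondTrue: "bval b s \<Longrightarrow> exec c s t s' \<Longrightarrow> exec (Cond b c d) s (1 + bcost b + t) s'"
| CondFalse: "\<not> bval b s \<Longrightarrow> exec d s t s' \<Longrightarrow> exec (Cond b c d) s (1 + bcost b + t) s'"
| WhileFalse: "\<not> bval b s \<Longrightarrow> exec (While b c) s (1 + bcost b) s"
| WhileTrue: "bval b s \<Longrightarrow> exec c s t s' \<Longrightarrow> exec (While b c) s' t' s''
    \<Longrightarrow> exec (While b c) s (1 + bcost b + t + t') s''"

lemma exec_deterministic:
  "exec c s t s' \<Longrightarrow> exec c s u s'' \<Longrightarrow> u = t \<and> s'' = s'"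
proof (induction arbitrary: u s'' rule: exec.induct)
  case (Seq c s t s' d t' s2)
  from Seq.prems show ?case by cases (auto dest!: Seq.IH)
next
  case (CondTrue b s c t s' d)
  from CondTrue.prems show ?case by cases (auto simp: CondTrue.hyps dest!: CondTrue.IH)
next
  case (CondFalse b s d t s' c)
  from CondFalse.prems show ?case by cases (auto simp: CondFalse.hyps dest!: CondFalse.IH)
next
  case (WhileFalse b s c)
  from WhileFalse.prems show ?case by cases (auto simp: WhileFalse.hyps)
next
  case (WhileTrue b s c t s' t' s2)
  from WhileTrue.prems show ?case by cases (auto simp: WhileTrue.hyps dest!: WhileTrue.IH)
qed (erule exec.cases; simp)+


section \<open>Input and output\<close>

text \<open>A multigraph with vertex set \<open>{..<n}\<close> is presented by adjacency lists in arbitrary order: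
  the list of \<open>v\<close> contains every neighbour of \<open>v\<close> once for each parallel edge.\<close>

definition adjacency_lists :: "nat mgraph \<Rightarrow> nat list list \<Rightarrow> bool" where
  "adjacency_lists G A \<longleftrightarrow> verts G = {..<length A} \<and>
     (\<forall>v<length A. \<forall>w. count (mset (A ! v)) w = count (edges G) {v, w})"

definition array_of :: "'a::zero list \<Rightarrow> nat \<Rightarrow> 'a" where
  "array_of xs i = (if i < length xs then xs ! i else 0)"

text \<open>The adjacency lists are stored consecutively in the array \<open>adj\<close>, the one of \<open>v\<close> at
  positions \<open>off[v], \<dots>, off[v+1] - 1\<close>. The list \<open>L\<close> is the given listing of the vertices with
  positive mass. All memory not occupied by the input is zero.\<close>

definition initial_state ::
  "nat \<Rightarrow> nat list list \<Rightarrow> real \<Rightarrow> real \<Rightarrow> (nat \<Rightarrow> real) \<Rightarrow> nat list \<Rightarrow> state" where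
  "initial_state m A \<alpha> \<gamma> p0 L =
     \<lparr>nvar = (\<lambda>_. 0)(''n'' := length A, ''m'' := m, ''k'' := length L),
      rvar = (\<lambda>_. 0)(''alpha'' := \<alpha>, ''gamma'' := \<gamma>),
      narr = (\<lambda>_ _. 0)
        (''off'' := array_of (map (\<lambda>v. length (concat (take v A))) [0..<Suc (length A)]),
         ''adj'' := array_of (concat A),
         ''list'' := array_of L),
      rarr = (\<lambda>_ _. 0)(''p0'' := array_of (map p0 [0..<length A]))\<rparr>"

definition density_listing :: "'v mgraph \<Rightarrow> ('v \<Rightarrow> real) \<Rightarrow> 'v list \<Rightarrow> bool" where
  "density_listing G p L \<longleftrightarrow> distinct L \<and> set L = {v \<in> verts G. p v > 0} \<and>
     sorted_wrt (\<lambda>u v. mass_density G p u \<ge> mass_density G p v) L"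

text \<open>On halting, the program announces in the variable \<open>case\<close> in which case it has ended; the
  vertices of the set found are the first \<open>size\<close> entries of the array \<open>T\<close>.\<close>

definition output_case :: "state \<Rightarrow> nat" where
  "output_case s = nvar s ''case''"

definition output_set :: "state \<Rightarrow> nat set" where
  "output_set s = narr s ''T'' ` {..<nvar s ''size''}"

end

theory Submission
  imports Defs
begin

text \<open>
  Write \<open>c(u, v)\<close> for edge multiplicities and \<open>f(v) = p(v) / d(v)\<close>. Settled mass \<open>p\<close> and residual mass
  \<open>r\<close> always satisfy the linear equation \<open>p = \<alpha> (p\<^sub>0 - r) + (1 - \<alpha>) W p\<close> with the lazy walk \<open>W\<close>. Its
  maximum principle gives \<open>p \<le> PR \<le> p + \<epsilon> d\<close> as soon as \<open>0 \<le> r \<le> \<epsilon> d\<close>, and summing it over a set \<open>S\<close>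
  bounds the flow \<open>(1 - \<alpha>) / 2 \<cdot> \<Sum> c(u, v) (f(u) - f(v))\<close> out of \<open>S\<close> by \<open>\<alpha>\<close>.

  Let \<open>S\<close> be the set of vertices of density at least \<open>\<tau>\<close>. If the cut of \<open>S\<close> is larger than
  \<open>\<phi> vol S\<close>, then by the flow bound at most half of that many edges leave the set of density at least
  \<open>\<tau> - 6 \<alpha> / (\<phi> vol S)\<close>, so lowering the threshold by this amount multiplies the volume by at least
  \<open>1 + \<phi> / 2\<close>. The total decrease of the threshold is a geometric sum, \<open>O(\<alpha> / (\<phi>\<^sup>2 vol S))\<close>, and with
  \<open>\<phi>\<^sup>2 \<approx> 576 \<alpha> l / \<gamma>\<close>, \<open>l = \<lfloor>lg m\<rfloor> + 1\<close>, the excess survives it. No sorting is needed: every threshold is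
  tested by a scan, and the number of thresholds is at most \<open>1 / \<alpha>\<close>.

  The algorithm does such sweeps for the scales \<open>K = 1, 2, 4, \<dots>\<close> up to \<open>K l \<ge> m\<close>, with residual
  threshold \<open>\<gamma> / (64 l K)\<close>, in time \<open>O(l K / (\<gamma> \<alpha>))\<close> for scale \<open>K\<close>. If all of them fail, it sweeps from the vertices
  of density at most \<open>(1 - \<gamma>) / (2 m)\<close> upwards, with steps \<open>6 \<alpha> / (\<phi> m)\<close>, since only \<open>\<alpha> vol S / m\<close> can flow
  into a set of small density. Were this sweep to pass volume \<open>m\<close> without success, then half of the
  volume would lack mass \<open>\<gamma> / 4\<close>, and the excess of the other half would have shown up at one of the scales.
\<close>

section \<open>Multigraphs\<close>

abbreviation adjacency :: "'v mgraph \<Rightarrow> 'v \<Rightarrow> 'v \<Rightarrow> nat" where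
  "adjacency G u v \<equiv> count (edges G) {u, v}"

text \<open>Edges are unordered, while the sums below run over ordered pairs. Disjointness of
  \<open>A\<close> and \<open>B\<close> lets at most one of the two orientations of an edge
  count.\<close>

lemma sum_doubleton_indicator:
  fixes a b :: 'v
  assumes "finite A" "finite B" "A \<inter> B = {}" "a \<noteq> b"
  shows "(\<Sum>u\<in>A. \<Sum>w\<in>B. if {a, b} = {u, w} then 1 else 0 :: nat) =
    (if a \<in> A \<and> b \<in> B \<or> b \<in> A \<and> a \<in> B then 1 else 0)"
proof -
  have "(\<Sum>u\<in>A. \<Sum>w\<in>B. if {a, b} = {u, w} then 1 else 0 :: nat) =
      card {z \<in> A \<times> B. {a, b} = {fst z, snd z}}"
    using assms(1,2) unfolding sum.cartesian_product
    by (simp add: sum.If_cases case_prod_beta Int_def mem_Times_iff)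
  also have "{z \<in> A \<times> B. {a, b} = {fst z, snd z}} =
      (if a \<in> A \<and> b \<in> B then {(a, b)} else {}) \<union> (if b \<in> A \<and> a \<in> B then {(b, a)} else {})"
    by (auto simp: doubleton_eq_iff)
  also have "card \<dots> = (if a \<in> A \<and> b \<in> B \<or> b \<in> A \<and> a \<in> B then 1 else 0)"
    using assms(3,4) by auto
  finally show ?thesis .
qed

lemma size_edges_containing:
  assumes "finite V" "v \<in> V" "\<forall>e\<in>#M. e \<subseteq> V \<and> card e = 2"
  shows "size {#e \<in># M. v \<in> e#} = (\<Sum>w\<in>V. count M {v, w})"
  using assms(3)
proof (induction M)
  case (add e M)
  then obtain a b where ab: "e = {a, b}" "a \<noteq> b" "a \<in> V" "b \<in> V"
    by (auto simp: card_2_iff)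
  have "(\<Sum>w\<in>V. count (add_mset e M) {v, w}) =
      (\<Sum>w\<in>V. count M {v, w}) + (\<Sum>w\<in>V. if e = {v, w} then 1 else 0)"
    unfolding sum.distrib[symmetric] by (rule sum.cong) auto
  moreover have "(\<Sum>w\<in>V. if e = {v, w} then 1 else 0 :: nat) = card {w \<in> V. e = {v, w}}"
    using assms(1) by (simp add: sum.If_cases Int_def)
  moreover have "{w \<in> V. e = {v, w}} = (if v = a then {b} else if v = b then {a} else {})"
    using ab by (auto simp: doubleton_eq_iff)
  ultimately show ?case using add ab by auto
qed simp

lemma size_edges_between:
  assumes "finite V" "U \<subseteq> V" "\<forall>e\<in>#M. e \<subseteq> V \<and> card e = 2"
  shows "size {#e \<in># M. \<exists>u\<in>U. \<exists>v\<in>V - U. e = {u, v}#} =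
    (\<Sum>u\<in>U. \<Sum>w\<in>V - U. count M {u, w})"
  using assms(3)
proof (induction M)
  case (add e M)
  then obtain a b where ab: "e = {a, b}" "a \<noteq> b" "a \<in> V" "b \<in> V"
    by (auto simp: card_2_iff)
  have "(\<Sum>u\<in>U. \<Sum>w\<in>V - U. count (add_mset e M) {u, w}) =
      (\<Sum>u\<in>U. \<Sum>w\<in>V - U. count M {u, w}) + (\<Sum>u\<in>U. \<Sum>w\<in>V - U. if e = {u, w} then 1 else 0)"
    unfolding sum.distrib[symmetric] by (intro sum.cong) auto
  also have "(\<Sum>u\<in>U. \<Sum>w\<in>V - U. if e = {u, w} then 1 else 0 :: nat) =
      (if a \<in> U \<and> b \<in> V - U \<or> b \<in> U \<and> a \<in> V - U then 1 else 0)"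
    unfolding ab(1) using assms(1,2) ab(2)
    by (intro sum_doubleton_indicator) (auto intro: finite_subset)
  also have "\<dots> = (if \<exists>u\<in>U. \<exists>v\<in>V - U. e = {u, v} then 1 else 0)"
    using ab by (auto simp: doubleton_eq_iff)
  finally show ?case using add by auto
qed simp

text \<open>Handshake lemma: every edge added to the multiset raises the sum by its two
  ends.\<close>

lemma sum_size_containing:
  assumes "finite V" "\<forall>e\<in>#M. e \<subseteq> V \<and> card e = 2"
  shows "(\<Sum>v\<in>V. size {#e \<in># M. v \<in> e#}) = 2 * size M"
  using assms(2)
proof (induction M)
  case (add e M)
  have "(\<Sum>v\<in>V. size {#e \<in># add_mset e M. v \<in> e#}) =
      (\<Sum>v\<in>V. size {#e \<in># M. v \<in> e#}) + (\<Sum>v\<in>V. if v \<in> e then 1 else 0)"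
    unfolding sum.distrib[symmetric] by (rule sum.cong) auto
  also have "(\<Sum>v\<in>V. if v \<in> e then 1 else 0 :: nat) = card e"
    using assms(1) add.prems by (simp add: sum.If_cases Int_absorb1)
  finally show ?case using add by auto
qed simp

lemma deg_eq_sum:
  assumes "multigraph G" "v \<in> verts G"
  shows "deg G v = (\<Sum>w\<in>verts G. adjacency G v w)"
  unfolding deg_def using assms by (intro size_edges_containing) (auto simp: multigraph_def)

lemma size_boundary_eq_sum:
  assumes "multigraph G" "U \<subseteq> verts G"
  shows "size (boundary G U) = (\<Sum>u\<in>U. \<Sum>w\<in>verts G - U. adjacency G u w)"
  unfolding boundary_def using assms by (intro size_edges_between) (auto simp: multigraph_def)

lemma vol_verts:
  assumes "multigraph G"
  shows "vol G (verts G) = 2 * num_edges G"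
  unfolding vol_def deg_def num_edges_def
  using assms by (intro sum_size_containing) (auto simp: multigraph_def)

lemma adjacency_self:
  assumes "multigraph G"
  shows "adjacency G v v = 0"
  using assms by (auto simp: multigraph_def count_eq_zero_iff)

lemma vol_Un_disjoint:
  assumes "finite (A \<union> B)" "A \<inter> B = {}"
  shows "vol G (A \<union> B) = vol G A + vol G B"
  unfolding vol_def using assms by (simp add: sum.union_disjoint)

lemma vol_mono:
  assumes "finite B" "A \<subseteq> B"
  shows "vol G A \<le> vol G B"
  unfolding vol_def using assms by (rule sum_mono2) auto

section \<open>The limit mass distribution\<close>

locale pagerank =
  fixes G :: "'v mgraph" and \<alpha> :: real and p0 :: "'v \<Rightarrow> real"
  assumes multigraph: "multigraph G"
    and deg_pos: "\<And>v. v \<in> verts G \<Longrightarrow> 0 < deg G v"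
    and alpha: "0 < \<alpha>" "\<alpha> \<le> 1 / 3"
    and p0_nonneg: "\<And>v. v \<in> verts G \<Longrightarrow> 0 \<le> p0 v"
    and p0_mass: "(\<Sum>v\<in>verts G. p0 v) = 1"
begin

abbreviation "V \<equiv> verts G"
abbreviation "m \<equiv> num_edges G"
abbreviation d :: "'v \<Rightarrow> real" where "d v \<equiv> real (deg G v)"
abbreviation c :: "'v \<Rightarrow> 'v \<Rightarrow> real" where "c u v \<equiv> real (adjacency G u v)"

lemma finite_V: "finite V"
  using multigraph by (simp add: multigraph_def)

lemma c_sym: "c u v = c v u"
  by (metis insert_commute)

lemma d_pos: "v \<in> V \<Longrightarrow> 0 < d v"
  using deg_pos by simp

lemma d_eq: "v \<in> V \<Longrightarrow> d v = (\<Sum>w\<in>V. c v w)"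
  using deg_eq_sum[OF multigraph] by simp

lemma sum_d: "(\<Sum>v\<in>V. d v) = 2 * real m"
  using vol_verts[OF multigraph] unfolding vol_def by (simp flip: of_nat_sum)

lemma V_nonempty: "V \<noteq> {}"
  using p0_mass by auto

lemma m_pos: "0 < m"
proof -
  have "0 < (\<Sum>v\<in>V. d v)"
    using V_nonempty d_pos by (intro sum_pos finite_V) auto
  then show ?thesis by (simp add: sum_d)
qed

section \<open>The linear equation of the push process\<close>

definition walk :: "('v \<Rightarrow> real) \<Rightarrow> 'v \<Rightarrow> real" where
  "walk p v = p v / 2 + (\<Sum>u\<in>V. c u v * p u / (2 * d u))"

text \<open>The invariant of the push process: \<open>p\<close> is the limit distribution that starts from
  \<open>p0 - r\<close>.\<close>

definition consistent :: "('v \<Rightarrow> real) \<Rightarrow> ('v \<Rightarrow> real) \<Rightarrow> bool" where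
  "consistent p r \<longleftrightarrow> (\<forall>v\<in>V. p v = \<alpha> * (p0 v - r v) + (1 - \<alpha>) * walk p v)"

lemma consistent_init: "consistent (\<lambda>_. 0) p0"
  by (simp add: consistent_def walk_def)

text \<open>The push adds \<open>\<alpha> * r u\<close> to \<open>p\<close> at \<open>u\<close>. The
  resulting change of \<open>(1 - \<alpha>) * walk p\<close> is \<open>\<alpha>\<close> times the
  mass that the push returns to the residual, so the two changes cancel.\<close>

lemma consistent_push:
  assumes "consistent p r" "u \<in> V" "push G \<alpha> u (p, r) = (p', r')"
  shows "consistent p' r'"
proof -
  let ?x = "r u"
  have p': "p' = p(u := p u + \<alpha> * ?x)" and
    r': "r' = (\<lambda>v. if v = u then (1 - \<alpha>) * ?x / 2 else r v + c u v * ((1 - \<alpha>) * ?x / (2 * d u)))"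
    using assms(3) by (auto simp: push_def)
  have walk': "walk p' v = walk p v + (if v = u then \<alpha> * ?x / 2 else 0) + c u v * (\<alpha> * ?x) / (2 * d u)" for v
  proof -
    have "(\<Sum>w\<in>V. c w v * p' w / (2 * d w)) =
        (\<Sum>w\<in>V. c w v * p w / (2 * d w) + (if w = u then c u v * (\<alpha> * ?x) / (2 * d u) else 0))"
      by (rule sum.cong) (auto simp: p' field_simps add_divide_distrib)
    also have "\<dots> = (\<Sum>w\<in>V. c w v * p w / (2 * d w)) + c u v * (\<alpha> * ?x) / (2 * d u)"
      using assms(2) finite_V by (simp add: sum.distrib)
    finally show ?thesis by (simp add: walk_def p' add_divide_distrib)
  qed
  have "p' v = \<alpha> * (p0 v - r' v) + (1 - \<alpha>) * walk p' v" if "v \<in> V" for v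
  proof -
    have "p v = \<alpha> * (p0 v - r v) + (1 - \<alpha>) * walk p v"
      using assms(1) that by (simp add: consistent_def)
    then show ?thesis
      \<comment> \<open>Without loops the diagonal term \<open>c u u\<close> vanishes, which matches
        the separate treatment of \<open>v = u\<close> in \<open>push\<close>.\<close>
      unfolding walk' using adjacency_self[OF multigraph, of u]
      by (cases "v = u") (auto simp: p' r' field_simps)
  qed
  then show ?thesis by (simp add: consistent_def)
qed

lemma sum_walk: "(\<Sum>v\<in>S. walk p v) = (\<Sum>v\<in>S. p v) / 2 + (\<Sum>v\<in>S. \<Sum>u\<in>V. c u v * (p u / d u)) / 2"
  by (simp add: walk_def sum.distrib sum_divide_distrib mult.commute)

lemma sum_as_edges:
  assumes "S \<subseteq> V"
  shows "(\<Sum>v\<in>S. p v) = (\<Sum>v\<in>S. \<Sum>u\<in>V. c v u * (p v / d v))"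
proof (rule sum.cong)
  fix v assume "v \<in> S"
  then have "v \<in> V" using assms by auto
  then show "p v = (\<Sum>u\<in>V. c v u * (p v / d v))"
    using d_pos[of v] by (simp add: d_eq flip: sum_distrib_right sum_divide_distrib)
qed simp

text \<open>Sum the linear equation over \<open>S\<close>. Edges inside \<open>S\<close> cancel
  because \<open>c\<close> is symmetric, and only density differences across the cut remain.\<close>

lemma flow:
  assumes "consistent p r" "S \<subseteq> V"
  shows "(1 - \<alpha>) / 2 * (\<Sum>u\<in>S. \<Sum>v\<in>V - S. c u v * (p u / d u - p v / d v)) =
    \<alpha> * ((\<Sum>v\<in>S. p0 v) - (\<Sum>v\<in>S. r v) - (\<Sum>v\<in>S. p v))"
proof -
  let ?f = "\<lambda>v. p v / d v"
  have split: "(\<Sum>u\<in>V. g u) = (\<Sum>u\<in>S. g u) + (\<Sum>u\<in>V - S. g u)" for g :: "'v \<Rightarrow> real"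
    by (metis add.commute assms(2) finite_V sum.subset_diff)
  have sym: "(\<Sum>v\<in>S. \<Sum>u\<in>S. c u v * ?f u) = (\<Sum>v\<in>S. \<Sum>u\<in>S. c v u * ?f v)"
    by (rule sum.swap)
  have "(\<Sum>v\<in>S. p v) - (\<Sum>v\<in>S. walk p v) =
      ((\<Sum>v\<in>S. \<Sum>u\<in>V. c v u * ?f v) - (\<Sum>v\<in>S. \<Sum>u\<in>V. c u v * ?f u)) / 2"
    using sum_as_edges[OF assms(2), of p] unfolding sum_walk by (simp add: field_simps)
  also have "\<dots> = (\<Sum>u\<in>S. \<Sum>v\<in>V - S. c u v * (?f u - ?f v)) / 2"
    unfolding split sum.distrib using sym
    by (simp add: right_diff_distrib sum_subtractf c_sym)
  finally have 1: "(\<Sum>v\<in>S. p v) - (\<Sum>v\<in>S. walk p v) =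
    (\<Sum>u\<in>S. \<Sum>v\<in>V - S. c u v * (?f u - ?f v)) / 2" .
  have "(\<Sum>v\<in>S. p v) = (\<Sum>v\<in>S. \<alpha> * (p0 v - r v) + (1 - \<alpha>) * walk p v)"
    using assms by (intro sum.cong) (auto simp: consistent_def)
  also have "\<dots> = \<alpha> * ((\<Sum>v\<in>S. p0 v) - (\<Sum>v\<in>S. r v)) + (1 - \<alpha>) * (\<Sum>v\<in>S. walk p v)"
    by (simp add: sum.distrib sum_subtractf flip: sum_distrib_left)
  finally have 2: "(\<Sum>v\<in>S. walk p v) * (1 - \<alpha>) =
    (\<Sum>v\<in>S. p v) - \<alpha> * ((\<Sum>v\<in>S. p0 v) - (\<Sum>v\<in>S. r v))" by (simp add: algebra_simps)
  have "(1 - \<alpha>) / 2 * (\<Sum>u\<in>S. \<Sum>v\<in>V - S. c u v * (?f u - ?f v)) =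
    (1 - \<alpha>) * ((\<Sum>v\<in>S. p v) - (\<Sum>v\<in>S. walk p v))"
    unfolding 1 by simp
  with 2 show ?thesis by (simp add: algebra_simps)
qed

lemma consistent_mass:
  assumes "consistent p r"
  shows "(\<Sum>v\<in>V. p v) + (\<Sum>v\<in>V. r v) = 1"
  using flow[OF assms subset_refl] p0_mass alpha by simp

text \<open>Maximum principle: apply the linear equation at a vertex where the density of the
  difference is smallest.\<close>

lemma consistent_le:
  assumes "consistent p r" "consistent p' r'"
    and le: "\<And>v. v \<in> V \<Longrightarrow> r' v \<le> r v + \<epsilon> * d v"
    and "v \<in> V"
  shows "p v \<le> p' v + \<epsilon> * d v"
proof -
  let ?g = "\<lambda>v. (p' v - p v) / d v"
  define M where "M = Min (?g ` V)"
  have "M \<in> ?g ` V" unfolding M_def using V_nonempty finite_V by (intro Min_in) auto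
  then obtain u where u: "u \<in> V" "M = ?g u" by auto
  have M_le: "M * d w \<le> p' w - p w" if "w \<in> V" for w
  proof -
    have "M \<le> ?g w" unfolding M_def using finite_V that by (intro Min_le) auto
    then show ?thesis using d_pos[OF that] by (simp add: pos_le_divide_eq)
  qed
  have "p' u - p u = \<alpha> * (r u - r' u) + (1 - \<alpha>) * (walk p' u - walk p u)"
  proof -
    have "p' u = \<alpha> * (p0 u - r' u) + (1 - \<alpha>) * walk p' u"
      "p u = \<alpha> * (p0 u - r u) + (1 - \<alpha>) * walk p u"
      using assms(1,2) u(1) by (auto simp: consistent_def)
    then show ?thesis by (simp only:) (simp add: algebra_simps)
  qed
  also have "walk p' u - walk p u = (p' u - p u) / 2 + (\<Sum>w\<in>V. c w u * (p' w - p w) / (2 * d w))"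
    by (simp add: walk_def right_diff_distrib diff_divide_distrib sum_subtractf)
  finally have step: "p' u - p u = \<alpha> * (r u - r' u) + (1 - \<alpha>) *
    ((p' u - p u) / 2 + (\<Sum>w\<in>V. c w u * (p' w - p w) / (2 * d w)))" .
  have "(\<Sum>w\<in>V. c w u * (p' w - p w) / (2 * d w)) \<ge> (\<Sum>w\<in>V. c w u * M / 2)"
  proof (rule sum_mono)
    fix w assume w: "w \<in> V"
    have "c w u * (M * d w) \<le> c w u * (p' w - p w)"
      using M_le[OF w] by (intro mult_left_mono) auto
    then show "c w u * M / 2 \<le> c w u * (p' w - p w) / (2 * d w)"
      using d_pos[OF w] by (simp add: field_simps)
  qed
  also have "(\<Sum>w\<in>V. c w u * M / 2) = d u * M / 2"
    unfolding d_eq[OF u(1)] sum_distrib_right sum_divide_distrib by (simp add: c_sym)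
  finally have "(1 - \<alpha>) * ((p' u - p u) / 2 + d u * M / 2) \<le> (1 - \<alpha>) *
      ((p' u - p u) / 2 + (\<Sum>w\<in>V. c w u * (p' w - p w) / (2 * d w)))"
    using alpha by (intro mult_left_mono) auto
  with step have 1: "\<alpha> * (r u - r' u) + (1 - \<alpha>) * ((p' u - p u) / 2 + d u * M / 2) \<le> p' u - p u"
    by linarith
  \<comment> \<open>At the minimiser, the lazy half and the bound for the neighbours are both
    \<open>M * d u / 2\<close>. Cancelling them leaves the residual term with factor
    \<open>\<alpha>\<close>.\<close>
  have "p' u - p u = M * d u" using u d_pos[of u] by simp
  with 1 have "\<alpha> * (r u - r' u) + (1 - \<alpha>) * (M * d u) \<le> M * d u"
    by (simp add: algebra_simps)
  then have "\<alpha> * (r u - r' u) \<le> \<alpha> * (M * d u)" by (simp add: algebra_simps)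
  then have "r u - r' u \<le> M * d u" using alpha by simp
  then have "- \<epsilon> * d u \<le> M * d u" using le[OF u(1)] by simp
  then have "- \<epsilon> \<le> M" using d_pos[OF u(1)] mult_right_le_imp_le[of "- \<epsilon>" "d u" M] by simp
  then have "- \<epsilon> * d v \<le> M * d v" by (intro mult_right_mono) auto
  then show ?thesis using M_le[OF assms(4)] by simp
qed

lemma push_nonneg:
  assumes "push G \<alpha> u (p, r) = (p', r')" "u \<in> V" "\<forall>v\<in>V. 0 \<le> p v \<and> 0 \<le> r v"
  shows "\<forall>v\<in>V. 0 \<le> p' v \<and> 0 \<le> r' v"
  using assms alpha by (auto simp: push_def intro!: add_nonneg_nonneg mult_nonneg_nonneg)

lemma push_reachable_invariant:
  assumes "push_reachable G \<alpha> \<epsilon> p0 s"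
  shows "consistent (fst s) (snd s) \<and> (\<forall>v\<in>V. 0 \<le> fst s v \<and> 0 \<le> snd s v)"
  using assms
proof induction
  case init
  then show ?case using consistent_init p0_nonneg by simp
next
  case (step p r u)
  obtain p' r' where "push G \<alpha> u (p, r) = (p', r')" by fastforce
  then show ?case
    using step consistent_push[of p r u p' r'] push_nonneg[of u p r p' r'] by simp
qed

text \<open>A push above the threshold settles at least \<open>\<alpha> * \<epsilon>\<close>, as
  degrees are at least 1, and the settled mass never exceeds 1. Hence the process stops;
  \<open>k\<close> bounds the number of pushes still possible.\<close>

lemma settled_nonempty:
  assumes "0 < \<epsilon>"
  shows "settled G \<alpha> \<epsilon> p0 \<noteq> {}"
proof -
  have "\<exists>p. p \<in> settled G \<alpha> \<epsilon> p0"
    if "push_reachable G \<alpha> \<epsilon> p0 (p, r)" "1 - (\<Sum>v\<in>V. p v) \<le> real k * (\<alpha> * \<epsilon>)" for p r k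
    using that
  proof (induction k arbitrary: p r)
    have progress: "\<exists>p' r'. push_reachable G \<alpha> \<epsilon> p0 (p', r') \<and> (\<Sum>v\<in>V. p v) + \<alpha> * \<epsilon> \<le> (\<Sum>v\<in>V. p' v)"
      if reach: "push_reachable G \<alpha> \<epsilon> p0 (p, r)" and unsettled: "p \<notin> settled G \<alpha> \<epsilon> p0" for p r
    proof -
      obtain u where u: "u \<in> V" "\<epsilon> \<le> mass_density G r u"
        using reach unsettled by (force simp: settled_def)
      obtain p' r' where push: "push G \<alpha> u (p, r) = (p', r')" by fastforce
      have "(\<Sum>v\<in>V. p' v) = (\<Sum>v\<in>V. p v + (if v = u then \<alpha> * r u else 0))"
        using push by (intro sum.cong) (auto simp: push_def)
      also have "\<dots> = (\<Sum>v\<in>V. p v) + \<alpha> * r u"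
        using u(1) finite_V by (simp add: sum.distrib)
      finally have sum: "(\<Sum>v\<in>V. p' v) = (\<Sum>v\<in>V. p v) + \<alpha> * r u" .
      have "\<epsilon> * 1 \<le> \<epsilon> * d u" using assms deg_pos[OF u(1)] by (intro mult_left_mono) auto
      also have "\<dots> \<le> r u"
        using u d_pos[OF u(1)] by (simp add: mass_density_def pos_le_divide_eq)
      finally have "\<alpha> * \<epsilon> \<le> \<alpha> * r u" using alpha by (intro mult_left_mono) auto
      moreover have "push_reachable G \<alpha> \<epsilon> p0 (p', r')"
        using push_reachable.step[OF reach u] push by simp
      ultimately show ?thesis using sum by force
    qed
    {
      case 0
      show ?case
      proof (rule ccontr)
        assume "\<not> ?thesis"
        then obtain p' r' where *: "push_reachable G \<alpha> \<epsilon> p0 (p', r')"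
          "(\<Sum>v\<in>V. p v) + \<alpha> * \<epsilon> \<le> (\<Sum>v\<in>V. p' v)"
          using progress[OF 0(1)] by blast
        have inv: "consistent p' r'" "\<And>v. v \<in> V \<Longrightarrow> 0 \<le> r' v"
          using push_reachable_invariant[OF *(1)] by auto
        have "(\<Sum>v\<in>V. p' v) \<le> 1"
          using consistent_mass[OF inv(1)] sum_nonneg[of V r'] inv(2) by simp
        moreover have "0 < \<alpha> * \<epsilon>" using alpha assms by simp
        ultimately show False using *(2) 0(2) by simp
      qed
    next
      case (Suc k)
      show ?case
      proof (rule ccontr)
        assume neg: "\<not> ?thesis"
        then obtain p' r' where *: "push_reachable G \<alpha> \<epsilon> p0 (p', r')"
          "(\<Sum>v\<in>V. p v) + \<alpha> * \<epsilon> \<le> (\<Sum>v\<in>V. p' v)"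
          using progress[OF Suc.prems(1)] by blast
        have "1 - (\<Sum>v\<in>V. p' v) \<le> real k * (\<alpha> * \<epsilon>)"
          using *(2) Suc.prems(2) by (simp add: algebra_simps)
        from Suc.IH[OF *(1) this] neg show False by blast
      qed
    }
  qed
  moreover obtain k where "1 / (\<alpha> * \<epsilon>) \<le> real k" using real_arch_simple by blast
  then have "1 \<le> real k * (\<alpha> * \<epsilon>)" using alpha assms by (simp add: field_simps)
  ultimately show ?thesis using push_reachable.init[of G \<alpha> \<epsilon> p0] by fastforce
qed

section \<open>Convergence of the settled mass\<close>

lemma settledD:
  assumes "p \<in> settled G \<alpha> \<epsilon> p0"
  obtains r where "consistent p r" "\<And>v. v \<in> V \<Longrightarrow> 0 \<le> p v"
    "\<And>v. v \<in> V \<Longrightarrow> 0 \<le> r v" "\<And>v. v \<in> V \<Longrightarrow> r v \<le> \<epsilon> * d v"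
proof -
  obtain r where r: "push_reachable G \<alpha> \<epsilon> p0 (p, r)" "\<forall>u\<in>V. mass_density G r u < \<epsilon>"
    using assms by (auto simp: settled_def)
  have "r v \<le> \<epsilon> * d v" if "v \<in> V" for v
    using r(2) that d_pos[OF that] by (force simp: mass_density_def pos_divide_less_eq)
  with push_reachable_invariant[OF r(1)] that[of r] show thesis by simp
qed

text \<open>One arbitrarily chosen terminated run for each threshold \<open>1 / (k + 1)\<close>. The
  choice does not affect the limit, since runs bracket each other by the maximum principle.\<close>

definition settled_seq :: "nat \<Rightarrow> 'v \<Rightarrow> real" where
  "settled_seq k = (SOME p. p \<in> settled G \<alpha> (1 / real (Suc k)) p0)"

definition limit_mass :: "'v \<Rightarrow> real" where
  "limit_mass v = (if v \<in> V then lim (\<lambda>k. settled_seq k v) else 0)"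

lemma settled_seq: "settled_seq k \<in> settled G \<alpha> (1 / real (Suc k)) p0"
  unfolding settled_seq_def using settled_nonempty[of "1 / real (Suc k)"] by (simp add: some_in_eq)

text \<open>The maximum principle in both directions: each residual is nonnegative and at most its
  own threshold times the degree.\<close>

lemma settled_seq_close:
  assumes "consistent p r" "\<And>v. v \<in> V \<Longrightarrow> 0 \<le> r v" "\<And>v. v \<in> V \<Longrightarrow> r v \<le> \<epsilon> * d v" "v \<in> V"
  shows "p v \<le> settled_seq k v + 1 / real (Suc k) * d v" "settled_seq k v \<le> p v + \<epsilon> * d v"
proof -
  obtain r' where r': "consistent (settled_seq k) r'" "\<And>v. v \<in> V \<Longrightarrow> 0 \<le> r' v"
    "\<And>v. v \<in> V \<Longrightarrow> r' v \<le> 1 / real (Suc k) * d v"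
    using settledD[OF settled_seq] by metis
  show "p v \<le> settled_seq k v + 1 / real (Suc k) * d v"
    using r'(3) assms(2) by (intro consistent_le[OF assms(1) r'(1) _ assms(4)]) (simp add: add_increasing)
  show "settled_seq k v \<le> p v + \<epsilon> * d v"
    using assms(3) r'(2) by (intro consistent_le[OF r'(1) assms(1) _ assms(4)]) (simp add: add_increasing)
qed

text \<open>Two members of the sequence differ at \<open>v\<close> by at most \<open>d v\<close>
  times the larger of their thresholds, so the sequence is Cauchy.\<close>

lemma settled_seq_LIMSEQ:
  assumes "v \<in> V"
  shows "(\<lambda>k. settled_seq k v) \<longlonglongrightarrow> limit_mass v"
proof -
  have close: "\<bar>settled_seq j v - settled_seq k v\<bar> \<le> d v / real (Suc (min j k))" for j k
  proof -
    have *: "settled_seq j v \<le> settled_seq k v + 1 / real (Suc k) * d v" for j k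
      using settledD[OF settled_seq[of j]] settled_seq_close(1)[OF _ _ _ assms] by metis
    have "1 / real (Suc i) * d v \<le> d v / real (Suc (min j k))" if "i \<in> {j, k}" for i
      using that by (auto intro!: divide_left_mono)
    from this[of j] this[of k] *[of j k] *[of k j] show ?thesis by (auto simp: abs_le_iff)
  qed
  have "Cauchy (\<lambda>k. settled_seq k v)"
  proof (rule metric_CauchyI)
    fix e :: real assume e: "0 < e"
    obtain N :: nat where N: "d v / e < real N" using reals_Archimedean2 by blast
    have "dist (settled_seq j v) (settled_seq k v) < e" if "N \<le> j" "N \<le> k" for j k
    proof -
      have "d v < e * real N" using N e by (simp add: field_simps)
      also have "\<dots> \<le> e * real (Suc (min j k))" using e that by (intro mult_left_mono) auto
      finally have "d v / real (Suc (min j k)) < e" by (simp add: field_simps)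
      then show ?thesis using close[of j k] by (simp add: dist_real_def)
    qed
    then show "\<exists>N. \<forall>j\<ge>N. \<forall>k\<ge>N. dist (settled_seq j v) (settled_seq k v) < e" by blast
  qed
  then show ?thesis
    using assms by (simp add: limit_mass_def Cauchy_convergent_iff convergent_LIMSEQ_iff)
qed

text \<open>The interface between the limit and the program: any consistent state with small
  nonnegative residual will do, whatever the order of pushes and the thresholds that led to
  it.\<close>

lemma limit_mass_bounds:
  assumes "consistent p r" "\<And>v. v \<in> V \<Longrightarrow> 0 \<le> r v" "\<And>v. v \<in> V \<Longrightarrow> r v \<le> \<epsilon> * d v" "v \<in> V"
  shows "p v \<le> limit_mass v" "limit_mass v \<le> p v + \<epsilon> * d v"
proof -
  note lim = settled_seq_LIMSEQ[OF assms(4)]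
  have "(\<lambda>k. settled_seq k v + 1 / real (Suc k) * d v) \<longlonglongrightarrow> limit_mass v + 0 * d v"
    using LIMSEQ_inverse_real_of_nat
    by (intro tendsto_intros lim) (simp add: inverse_eq_divide del: of_nat_Suc)
  from LIMSEQ_le_const[OF this, of "p v"] settled_seq_close(1)[OF assms]
  show "p v \<le> limit_mass v" by auto
  from LIMSEQ_le_const2[OF lim] settled_seq_close(2)[OF assms]
  show "limit_mass v \<le> p v + \<epsilon> * d v" by auto
qed

text \<open>The residual mass of the \<open>k\<close>-th run is at most
  \<open>2 * m / (k + 1)\<close> and vanishes in the limit.\<close>

lemma limit_mass_sum: "(\<Sum>v\<in>V. limit_mass v) = 1"
proof -
  have bound: "\<bar>(\<Sum>v\<in>V. settled_seq k v) - 1\<bar> \<le> 1 / real (Suc k) * (2 * real m)" for k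
  proof -
    obtain r where r: "consistent (settled_seq k) r" "\<And>v. v \<in> V \<Longrightarrow> 0 \<le> r v"
      "\<And>v. v \<in> V \<Longrightarrow> r v \<le> 1 / real (Suc k) * d v"
      using settledD[OF settled_seq] by metis
    have "0 \<le> (\<Sum>v\<in>V. r v)" using r(2) by (rule sum_nonneg)
    moreover have "(\<Sum>v\<in>V. r v) \<le> (\<Sum>v\<in>V. 1 / real (Suc k) * d v)" using r(3) by (rule sum_mono)
    ultimately show ?thesis
      using consistent_mass[OF r(1)] unfolding sum_distrib_left[symmetric] sum_d by simp
  qed
  have "(\<lambda>k. 1 / real (Suc k) * (2 * real m)) \<longlonglongrightarrow> 0"
    using tendsto_mult_left_zero[OF LIMSEQ_inverse_real_of_nat, of "2 * real m"]
    by (simp only: inverse_eq_divide)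
  then have "(\<lambda>k. (\<Sum>v\<in>V. settled_seq k v) - 1) \<longlonglongrightarrow> 0"
    by (rule Lim_null_comparison[rotated]) (use bound in \<open>simp add: always_eventually del: of_nat_Suc\<close>)
  then have "(\<lambda>k. \<Sum>v\<in>V. settled_seq k v) \<longlonglongrightarrow> 1" by (simp add: LIM_zero_iff)
  moreover have "(\<lambda>k. \<Sum>v\<in>V. settled_seq k v) \<longlonglongrightarrow> (\<Sum>v\<in>V. limit_mass v)"
    by (intro tendsto_sum settled_seq_LIMSEQ)
  ultimately show ?thesis using LIMSEQ_unique by blast
qed

text \<open>Existence: for \<open>\<epsilon> * d v < \<eta>\<close> the two-sided bound applies to
  all runs at once. Uniqueness: every candidate must be the limit of \<open>settled_seq\<close>,
  whose thresholds tend to 0.\<close>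

lemma PR_eq: "PR G \<alpha> p0 = limit_mass"
  unfolding PR_def
proof (rule the_equality, intro conjI allI ballI impI)
  fix v assume "v \<notin> V" then show "limit_mass v = 0" by (simp add: limit_mass_def)
next
  fix v \<eta> assume v: "v \<in> V" and \<eta>: "(0::real) < \<eta>"
  have "\<bar>p v - limit_mass v\<bar> < \<eta>"
    if \<epsilon>: "0 < \<epsilon>" "\<epsilon> < \<eta> / d v" and p: "p \<in> settled G \<alpha> \<epsilon> p0" for \<epsilon> p
  proof -
    obtain r where r: "consistent p r" "\<And>v. v \<in> V \<Longrightarrow> 0 \<le> r v" "\<And>v. v \<in> V \<Longrightarrow> r v \<le> \<epsilon> * d v"
      using settledD[OF p] by metis
    have "\<epsilon> * d v < \<eta>" using \<epsilon> d_pos[OF v] by (simp add: pos_less_divide_eq)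
    then show ?thesis using limit_mass_bounds[OF r v] by simp
  qed
  moreover have "0 < \<eta> / d v" using \<eta> d_pos[OF v] by simp
  ultimately show "\<forall>\<^sub>F \<epsilon> in at_right 0. \<forall>p\<in>settled G \<alpha> \<epsilon> p0. \<bar>p v - limit_mass v\<bar> < \<eta>"
    unfolding eventually_at_right_field by blast
next
  fix q
  assume "(\<forall>v. v \<notin> V \<longrightarrow> q v = 0) \<and> (\<forall>v\<in>V. \<forall>\<eta>>0. \<forall>\<^sub>F \<epsilon> in at_right 0. \<forall>p\<in>settled G \<alpha> \<epsilon> p0. \<bar>p v - q v\<bar> < \<eta>)"
  then have q0: "\<forall>v. v \<notin> V \<longrightarrow> q v = 0"
    and q: "\<forall>v\<in>V. \<forall>\<eta>>0. \<forall>\<^sub>F \<epsilon> in at_right 0. \<forall>p\<in>settled G \<alpha> \<epsilon> p0. \<bar>p v - q v\<bar> < \<eta>"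
    by blast+
  have "q v = limit_mass v" if v: "v \<in> V" for v
  proof (rule LIMSEQ_unique[OF _ settled_seq_LIMSEQ[OF v]], rule LIMSEQ_I)
    fix \<eta> :: real assume "0 < \<eta>"
    then obtain b where b: "0 < b" "\<And>\<epsilon>. 0 < \<epsilon> \<Longrightarrow> \<epsilon> < b \<Longrightarrow> \<forall>p\<in>settled G \<alpha> \<epsilon> p0. \<bar>p v - q v\<bar> < \<eta>"
      using q v unfolding eventually_at_right_field by blast
    obtain N :: nat where N: "1 / b < real N" using reals_Archimedean2 by blast
    have "norm (settled_seq k v - q v) < \<eta>" if "N \<le> k" for k
    proof -
      have "1 / b < real (Suc k)" using N that by simp
      then have "1 / real (Suc k) < b" using b(1) by (simp add: field_simps)
      then show ?thesis using b(2)[of "1 / real (Suc k)"] settled_seq[of k] by simp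
    qed
    then show "\<exists>N. \<forall>k\<ge>N. norm (settled_seq k v - q v) < \<eta>" by blast
  qed
  then show "q = limit_mass" using q0 by (auto simp: limit_mass_def)
qed

lemmas PR_bounds = limit_mass_bounds[folded PR_eq]
lemmas PR_sum = limit_mass_sum[folded PR_eq]

section \<open>Sweeps\<close>

text \<open>Stated without division. The function \<open>g\<close> may be negative: the bottom sweep
  uses \<open>- p\<close>, for which these are the sets of small density.\<close>

definition superlevel :: "('v \<Rightarrow> real) \<Rightarrow> real \<Rightarrow> 'v set" where
  "superlevel g \<tau> = {v \<in> V. \<tau> * d v \<le> g v}"

definition superlevel_vol :: "('v \<Rightarrow> real) \<Rightarrow> real \<Rightarrow> real" where
  "superlevel_vol g \<tau> = real (vol G (superlevel g \<tau>))"

definition superlevel_cut :: "('v \<Rightarrow> real) \<Rightarrow> real \<Rightarrow> real" where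
  "superlevel_cut g \<tau> = real (size (boundary G (superlevel g \<tau>)))"

lemma superlevel_subset: "superlevel g \<tau> \<subseteq> V"
  by (auto simp: superlevel_def)

lemma finite_superlevel: "finite (superlevel g \<tau>)"
  using finite_subset[OF superlevel_subset finite_V] .

lemma vol_eq: "real (vol G S) = (\<Sum>v\<in>S. d v)"
  by (simp add: vol_def)

lemma superlevel_antimono: "\<tau> \<le> \<tau>' \<Longrightarrow> superlevel g \<tau>' \<subseteq> superlevel g \<tau>"
  unfolding superlevel_def by (auto intro: order_trans[OF mult_right_mono])

lemma vol_pos_iff:
  assumes "S \<subseteq> V"
  shows "0 < vol G S \<longleftrightarrow> S \<noteq> {}"
proof -
  have "finite S" "\<And>v. v \<in> S \<Longrightarrow> deg G v \<noteq> 0"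
    using assms deg_pos finite_subset[OF assms finite_V] by force+
  then show ?thesis by (auto simp: vol_def)
qed

text \<open>An edge from the set at level \<open>\<tau>\<close> to the outside of the set at level
  \<open>\<tau> - \<delta>\<close> carries a density difference above \<open>\<delta>\<close>, so
  there are at most \<open>F / \<delta>\<close> of them. All other cut edges end in the newly added
  vertices and are bounded by their volume.\<close>

lemma superlevel_growth:
  assumes flow: "(\<Sum>u\<in>superlevel g \<tau>. \<Sum>v\<in>V - superlevel g \<tau>. c u v * (g u / d u - g v / d v)) \<le> F"
    and \<delta>: "0 < \<delta>"
  shows "superlevel_vol g \<tau> + superlevel_cut g \<tau> - F / \<delta> \<le> superlevel_vol g (\<tau> - \<delta>)"
proof -
  define S S' where "S = superlevel g \<tau>" and "S' = superlevel g (\<tau> - \<delta>)"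
  have sub: "S \<subseteq> S'" "S' \<subseteq> V"
    unfolding S_def S'_def using \<delta> by (auto intro!: superlevel_antimono simp: superlevel_subset)
  have fin: "finite S" "finite S'" "finite V"
    by (simp_all add: S_def S'_def finite_superlevel finite_V)
  have "(\<Sum>u\<in>S. \<Sum>v\<in>V - S'. c u v * \<delta>) \<le> (\<Sum>u\<in>S. \<Sum>v\<in>V - S'. c u v * (g u / d u - g v / d v))"
  proof (intro sum_mono mult_left_mono)
    fix u v assume "u \<in> S" "v \<in> V - S'"
    then have *: "u \<in> V" "v \<in> V" "\<tau> * d u \<le> g u" "g v < (\<tau> - \<delta>) * d v"
      by (auto simp: S_def S'_def superlevel_def)
    then have "\<tau> \<le> g u / d u" "g v / d v < \<tau> - \<delta>"
      using d_pos by (simp_all add: pos_le_divide_eq pos_divide_less_eq)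
    then show "\<delta> \<le> g u / d u - g v / d v" by simp
  qed simp
  \<comment> \<open>The added terms have \<open>v\<close> in \<open>S' - S\<close>. They are
    nonnegative, because \<open>u\<close> is above level \<open>\<tau>\<close> and \<open>v\<close>
    below it.\<close>
  also have "\<dots> \<le> (\<Sum>u\<in>S. \<Sum>v\<in>V - S. c u v * (g u / d u - g v / d v))"
  proof (intro sum_mono sum_mono2)
    fix u v assume "u \<in> S" "v \<in> V - S - (V - S')"
    then have *: "u \<in> V" "v \<in> V" "\<tau> * d u \<le> g u" "g v < \<tau> * d v"
      by (auto simp: S_def superlevel_def)
    then have "\<tau> \<le> g u / d u" "g v / d v < \<tau>"
      using d_pos by (simp_all add: pos_le_divide_eq pos_divide_less_eq)
    then show "0 \<le> c u v * (g u / d u - g v / d v)" by simp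
  qed (use sub fin in auto)
  also have "\<dots> \<le> F" using flow by (simp add: S_def)
  finally have far: "(\<Sum>u\<in>S. \<Sum>v\<in>V - S'. c u v) \<le> F / \<delta>"
    using \<delta> by (simp add: pos_le_divide_eq flip: sum_distrib_right)
  have "superlevel_cut g \<tau> = (\<Sum>u\<in>S. \<Sum>v\<in>V - S. c u v)"
    unfolding superlevel_cut_def S_def
    by (simp add: size_boundary_eq_sum[OF multigraph superlevel_subset])
  also have "\<dots> = (\<Sum>u\<in>S. (\<Sum>v\<in>V - S'. c u v) + (\<Sum>v\<in>S' - S. c u v))"
  proof (rule sum.cong)
    fix u
    have "V - S = (V - S') \<union> (S' - S)" using sub by auto
    then show "(\<Sum>v\<in>V - S. c u v) = (\<Sum>v\<in>V - S'. c u v) + (\<Sum>v\<in>S' - S. c u v)"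
      using fin sum.union_disjoint[of "V - S'" "S' - S" "c u"] by auto
  qed simp
  also have "\<dots> = (\<Sum>u\<in>S. \<Sum>v\<in>V - S'. c u v) + (\<Sum>v\<in>S' - S. \<Sum>u\<in>S. c v u)"
    by (subst (2) sum.swap) (simp add: sum.distrib c_sym)
  \<comment> \<open>These edges are charged to the degrees of their ends in
    \<open>S' - S\<close>.\<close>
  also have "(\<Sum>v\<in>S' - S. \<Sum>u\<in>S. c v u) \<le> (\<Sum>v\<in>S' - S. d v)"
  proof (rule sum_mono)
    fix v assume "v \<in> S' - S"
    then have "v \<in> V" using sub by auto
    then show "(\<Sum>u\<in>S. c v u) \<le> d v"
      unfolding d_eq[OF \<open>v \<in> V\<close>] using sub fin by (intro sum_mono2) auto
  qed
  also have "(\<Sum>v\<in>S' - S. d v) = superlevel_vol g (\<tau> - \<delta>) - superlevel_vol g \<tau>"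
    using sub fin by (simp add: superlevel_vol_def vol_eq sum_diff flip: S_def S'_def)
  finally show ?thesis using far by simp
qed

text \<open>The step is chosen so that \<open>F / \<delta>\<close> is half of \<open>\<phi>\<close>
  times the volume, that is, less than half of the cut is lost. The factor \<open>\<beta>\<close>
  scales the flow: it is 1 for the top sweep and \<open>vol S / m\<close> for the bottom
  sweep.\<close>

lemma superlevel_growth_cut:
  assumes "(\<Sum>u\<in>superlevel g \<tau>. \<Sum>v\<in>V - superlevel g \<tau>. c u v * (g u / d u - g v / d v)) \<le> 3 * \<alpha> * \<beta>"
    and pos: "0 < \<phi>" "0 < \<beta>" "0 < superlevel_vol g \<tau>"
    and cut: "\<phi> * superlevel_vol g \<tau> < superlevel_cut g \<tau>"
  shows "(1 + \<phi> / 2) * superlevel_vol g \<tau> \<le>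
    superlevel_vol g (\<tau> - 6 * \<alpha> * \<beta> / (\<phi> * superlevel_vol g \<tau>))"
proof -
  let ?v = "superlevel_vol g \<tau>"
  let ?\<delta> = "6 * \<alpha> * \<beta> / (\<phi> * ?v)"
  have "0 < ?\<delta>" using pos alpha by simp
  moreover have "3 * \<alpha> * \<beta> / ?\<delta> = \<phi> * ?v / 2" using pos alpha by (simp add: field_simps)
  ultimately have "?v + superlevel_cut g \<tau> - \<phi> * ?v / 2 \<le> superlevel_vol g (\<tau> - ?\<delta>)"
    using superlevel_growth[OF assms(1), of ?\<delta>] by simp
  then show ?thesis using cut by (simp add: algebra_simps)
qed

text \<open>Since \<open>\<alpha> \<le> 1 / 3\<close>, the factor \<open>(1 - \<alpha>) / 2\<close>
  is at least \<open>1 / 3\<close>.\<close>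

lemma flow_bound:
  assumes "(1 - \<alpha>) / 2 * X \<le> \<alpha> * \<beta>" "0 \<le> \<beta>"
  shows "X \<le> 3 * \<alpha> * \<beta>"
proof (cases "X \<le> 0")
  case True
  then show ?thesis using assms(2) alpha by (simp add: order_trans)
next
  case False
  have "1 / 3 * X \<le> (1 - \<alpha>) / 2 * X" using False alpha by (intro mult_right_mono) auto
  with assms(1) show ?thesis by simp
qed

text \<open>The net outflow from any set is at most \<open>\<alpha>\<close>, because at most the
  initial mass 1 starts there.\<close>

lemma top_sweep_step:
  assumes p: "consistent p r" "\<forall>v\<in>V. 0 \<le> p v \<and> 0 \<le> r v"
    and pos: "0 < \<phi>" "0 < superlevel_vol p \<tau>"
    and cut: "\<phi> * superlevel_vol p \<tau> < superlevel_cut p \<tau>"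
  shows "(1 + \<phi> / 2) * superlevel_vol p \<tau> \<le>
    superlevel_vol p (\<tau> - 6 * \<alpha> / (\<phi> * superlevel_vol p \<tau>))"
proof -
  let ?S = "superlevel p \<tau>"
  have "(\<Sum>v\<in>?S. p0 v) \<le> 1"
    unfolding p0_mass[symmetric] using p0_nonneg superlevel_subset finite_V by (intro sum_mono2) auto
  moreover have "0 \<le> (\<Sum>v\<in>?S. p v)" "0 \<le> (\<Sum>v\<in>?S. r v)"
    using p(2) superlevel_subset by (auto intro!: sum_nonneg)
  ultimately have "\<alpha> * ((\<Sum>v\<in>?S. p0 v) - (\<Sum>v\<in>?S. r v) - (\<Sum>v\<in>?S. p v)) \<le> \<alpha> * 1"
    using alpha by (intro mult_left_mono) auto
  then have "(\<Sum>u\<in>?S. \<Sum>v\<in>V - ?S. c u v * (p u / d u - p v / d v)) \<le> 3 * \<alpha> * 1"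
    using flow[OF p(1) superlevel_subset] by (intro flow_bound) auto
  from superlevel_growth_cut[OF this pos(1) _ pos(2) cut] show ?thesis by simp
qed

text \<open>In the low set, \<open>p + r\<close> has density at most
  \<open>\<epsilon> - \<tau> \<le> 1 / m\<close>, so the net inflow is at most
  \<open>\<alpha> * vol S / m\<close>. The volume cancels in the step length, which is therefore the
  same in all rounds.\<close>

lemma bottom_sweep_step:
  assumes p: "consistent p r" "\<forall>v\<in>V. r v \<le> \<epsilon> * d v"
    and pos: "0 < \<phi>" "0 < superlevel_vol (\<lambda>v. - p v) \<tau>"
    and \<tau>: "\<epsilon> - \<tau> \<le> 1 / real m"
    and cut: "\<phi> * superlevel_vol (\<lambda>v. - p v) \<tau> < superlevel_cut (\<lambda>v. - p v) \<tau>"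
  shows "(1 + \<phi> / 2) * superlevel_vol (\<lambda>v. - p v) \<tau> \<le>
    superlevel_vol (\<lambda>v. - p v) (\<tau> - 6 * \<alpha> / (\<phi> * real m))"
proof -
  let ?g = "\<lambda>v. - p v"
  let ?S = "superlevel ?g \<tau>"
  let ?\<beta> = "superlevel_vol ?g \<tau> / real m"
  have "(\<Sum>v\<in>?S. p v) + (\<Sum>v\<in>?S. r v) \<le> (\<Sum>v\<in>?S. d v / real m)"
    unfolding sum.distrib[symmetric]
  proof (rule sum_mono)
    fix v assume v: "v \<in> ?S"
    then have "p v + r v \<le> (\<epsilon> - \<tau>) * d v" using p(2) by (auto simp: superlevel_def algebra_simps)
    also have "\<dots> \<le> 1 / real m * d v" using \<tau> by (intro mult_right_mono) auto
    finally show "p v + r v \<le> d v / real m" by simp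
  qed
  also have "\<dots> = ?\<beta>" by (simp add: superlevel_vol_def vol_eq sum_divide_distrib)
  finally have "(\<Sum>v\<in>?S. p v) + (\<Sum>v\<in>?S. r v) - (\<Sum>v\<in>?S. p0 v) \<le> ?\<beta>"
    using sum_nonneg[of ?S p0] p0_nonneg superlevel_subset[of ?g \<tau>] by force
  then have "- (\<alpha> * ((\<Sum>v\<in>?S. p0 v) - (\<Sum>v\<in>?S. r v) - (\<Sum>v\<in>?S. p v))) \<le> \<alpha> * ?\<beta>"
    using mult_left_mono[of "(\<Sum>v\<in>?S. p v) + (\<Sum>v\<in>?S. r v) - (\<Sum>v\<in>?S. p0 v)" ?\<beta> \<alpha>] alpha
    by (simp add: algebra_simps)
  \<comment> \<open>Negating the densities turns the inflow of \<open>p\<close> into an outflow of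
    \<open>- p\<close>.\<close>
  moreover have "(1 - \<alpha>) / 2 * (\<Sum>u\<in>?S. \<Sum>v\<in>V - ?S. c u v * (?g u / d u - ?g v / d v)) =
      - ((1 - \<alpha>) / 2 * (\<Sum>u\<in>?S. \<Sum>v\<in>V - ?S. c u v * (p u / d u - p v / d v)))"
    by (simp add: sum_distrib_left sum_negf[symmetric] algebra_simps)
  ultimately have "(\<Sum>u\<in>?S. \<Sum>v\<in>V - ?S. c u v * (?g u / d u - ?g v / d v)) \<le> 3 * \<alpha> * ?\<beta>"
    using flow[OF p(1) superlevel_subset, of ?g \<tau>] pos by (intro flow_bound) auto
  moreover have "0 < ?\<beta>" using pos m_pos by simp
  moreover have "6 * \<alpha> * ?\<beta> / (\<phi> * superlevel_vol ?g \<tau>) = 6 * \<alpha> / (\<phi> * real m)"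
    using pos m_pos by (simp add: field_simps)
  ultimately show ?thesis
    using superlevel_growth_cut[of ?g \<tau> ?\<beta> \<phi>] pos cut by (simp only:)
qed

lemma superlevel_vol_mono:
  assumes "\<And>v. v \<in> V \<Longrightarrow> \<tau> * d v \<le> g v \<Longrightarrow> \<tau>' * d v \<le> g' v"
  shows "superlevel_vol g \<tau> \<le> superlevel_vol g' \<tau>'"
  unfolding superlevel_vol_def of_nat_le_iff
  using assms by (intro vol_mono finite_superlevel) (auto simp: superlevel_def)

text \<open>If half of the volume has density below average, the rest has large excess, and one of
  the dyadic scales must carry a proportional share of it.\<close>

lemma dyadic_scales:
  assumes q: "(\<Sum>v\<in>V. q v) = 1"
    and U: "U \<subseteq> V" "m < vol G U" "\<And>v. v \<in> U \<Longrightarrow> q v \<le> (1 - \<gamma> / 2) / (2 * real m) * d v"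
    and \<gamma>: "0 < \<gamma>" and l: "J \<le> l" "0 < l" "real m \<le> 2 ^ J * real l"
    and fails: "\<And>j. j \<le> J \<Longrightarrow>
      superlevel_vol q (1 / (2 * real m) + \<gamma> / (16 * real l * 2 ^ j)) < 2 ^ j \<or>
      real m < superlevel_vol q (1 / (2 * real m))"
  shows False
proof -
  \<comment> \<open>The pointwise excess; it sums to 0 over \<open>V\<close>. \<open>S j\<close>
    collects the vertices that are dense enough for scale \<open>2 ^ j\<close>, and \<open>H\<close>
    those of at least average density.\<close>
  define e where "e = (\<lambda>v. q v - d v / (2 * real m))"
  define S where "S = (\<lambda>j. superlevel q (1 / (2 * real m) + \<gamma> / (16 * real l * 2 ^ j)))"
  define H where "H = superlevel q (1 / (2 * real m))"
  have fin: "finite (S j)" "finite H" for j by (simp_all add: S_def H_def finite_superlevel)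
  have lpos: "0 < real l" and mpos: "0 < real m" using l m_pos by simp_all
  have outside: "(\<Sum>v\<in>A - S j. e v) \<le> \<gamma> / (16 * real l * 2 ^ j) * real (vol G A)"
    if A: "A \<subseteq> V" for A j
  proof -
    have "(\<Sum>v\<in>A - S j. e v) \<le> (\<Sum>v\<in>A - S j. \<gamma> / (16 * real l * 2 ^ j) * d v)"
    proof (rule sum_mono)
      fix v assume "v \<in> A - S j"
      then have "q v < (1 / (2 * real m) + \<gamma> / (16 * real l * 2 ^ j)) * d v"
        using A by (auto simp: S_def superlevel_def)
      then show "e v \<le> \<gamma> / (16 * real l * 2 ^ j) * d v"
        by (simp add: e_def algebra_simps)
    qed
    also have "\<dots> \<le> (\<Sum>v\<in>A. \<gamma> / (16 * real l * 2 ^ j) * d v)"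
      using \<gamma> finite_subset[OF A finite_V] by (intro sum_mono2) auto
    finally show ?thesis by (simp add: vol_eq sum_distrib_left)
  qed
  have H_U: "H \<subseteq> V - U"
  proof -
    have "v \<notin> U" if "v \<in> H" for v
    proof
      assume "v \<in> U"
      then have "1 / (2 * real m) * d v \<le> (1 - \<gamma> / 2) / (2 * real m) * d v"
        using U(3)[of v] that by (auto simp: H_def superlevel_def)
      moreover have "0 < d v" using that d_pos by (auto simp: H_def superlevel_def)
      moreover have "0 < \<gamma> * d v" using \<gamma> \<open>0 < d v\<close> by (rule mult_pos_pos)
      ultimately show False using mpos by (simp add: field_simps)
    qed
    then show ?thesis by (auto simp: H_def superlevel_def)
  qed
  have vol_H: "real (vol G H) \<le> real m"
  proof -
    have "H \<inter> U = {}" "H \<union> U \<subseteq> V" using H_U U(1) by auto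
    then have "vol G H + vol G U \<le> vol G V"
      using vol_mono[OF finite_V, of "H \<union> U"] vol_Un_disjoint[of H U G]
      by (metis finite_V finite_subset)
    then show ?thesis using U(2) vol_verts[OF multigraph] by simp
  qed
  \<comment> \<open>The second alternative of \<open>fails\<close> is excluded: \<open>H\<close>
    avoids \<open>U\<close>, which takes more than half of the total volume
    \<open>2 * m\<close>.\<close>
  have scales: "superlevel_vol q (1 / (2 * real m) + \<gamma> / (16 * real l * 2 ^ j)) < 2 ^ j" if "j \<le> J" for j
    using fails[OF that] vol_H by (simp add: superlevel_vol_def flip: H_def)
  have scale_sum: "(\<Sum>v\<in>S j. e v) \<le> real j * (\<gamma> / (8 * real l))" if "j \<le> J" for j
    using that
  proof (induction j)
    case 0
    \<comment> \<open>A natural number below \<open>2 ^ 0\<close> is 0, so the induction starts with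
      an empty set.\<close>
    then have "vol G (S 0) = 0"
      using scales[of 0] by (simp add: S_def superlevel_vol_def)
    then have "S 0 = {}" using vol_pos_iff[of "S 0"] by (auto simp: S_def superlevel_subset)
    then show ?case by simp
  next
    case (Suc j)
    have "S j \<subseteq> S (Suc j)"
      unfolding S_def using \<gamma> lpos by (intro superlevel_antimono) (auto intro!: divide_left_mono)
    then have "(\<Sum>v\<in>S (Suc j). e v) = (\<Sum>v\<in>S (Suc j) - S j. e v) + (\<Sum>v\<in>S j. e v)"
      by (rule sum.subset_diff[OF _ fin(1)])
    \<comment> \<open>Vertices outside \<open>S j\<close> have excess density at most
      \<open>\<gamma> / (16 * l * 2 ^ j)\<close>, and the volume of \<open>S (Suc j)\<close> is
      below \<open>2 ^ Suc j\<close>. Every scale thus adds at most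
      \<open>\<gamma> / (8 * l)\<close>.\<close>
    also have "(\<Sum>v\<in>S (Suc j) - S j. e v) \<le> \<gamma> / (16 * real l * 2 ^ j) * real (vol G (S (Suc j)))"
      by (rule outside) (simp add: S_def superlevel_subset)
    also have "\<dots> \<le> \<gamma> / (16 * real l * 2 ^ j) * 2 ^ Suc j"
      using scales[OF Suc.prems] \<gamma> lpos
      by (intro mult_left_mono) (simp_all add: S_def superlevel_vol_def)
    also have "\<dots> = \<gamma> / (8 * real l)" using lpos by (simp add: field_simps)
    finally show ?case using Suc by (simp add: distrib_right add_divide_distrib)
  qed
  have "(\<Sum>v\<in>V. e v) = 0"
    by (simp add: e_def sum_subtractf q sum_d m_pos flip: sum_divide_distrib)
  then have "(\<Sum>v\<in>V - U. e v) + (\<Sum>v\<in>U. e v) = 0"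
    using sum.subset_diff[OF U(1) finite_V, of e] by simp
  moreover have "(\<Sum>v\<in>U. e v) \<le> (\<Sum>v\<in>U. - (\<gamma> / (4 * real m)) * d v)"
  proof (rule sum_mono)
    fix v assume "v \<in> U"
    from U(3)[OF this] show "e v \<le> - (\<gamma> / (4 * real m)) * d v"
      by (simp add: e_def algebra_simps diff_divide_distrib)
  qed
  moreover have "(\<Sum>v\<in>U. - (\<gamma> / (4 * real m)) * d v) = - (\<gamma> / (4 * real m)) * real (vol G U)"
    by (simp only: vol_eq sum_distrib_left)
  moreover have "\<gamma> / (4 * real m) * real m < \<gamma> / (4 * real m) * real (vol G U)"
    using U(2) \<gamma> mpos by (intro mult_strict_left_mono) auto
  \<comment> \<open>\<open>U\<close> lacks at least \<open>\<gamma> / (4 * m)\<close> per unit of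
    its volume, which exceeds \<open>m\<close>.\<close>
  ultimately have big: "\<gamma> / 4 < (\<Sum>v\<in>V - U. e v)" using mpos by simp
  have "(\<Sum>v\<in>V - U. e v) \<le> (\<Sum>v\<in>H. e v)"
  proof -
    have "(\<Sum>v\<in>V - U. e v) = (\<Sum>v\<in>V - U - H. e v) + (\<Sum>v\<in>H. e v)"
      using finite_V by (intro sum.subset_diff[OF H_U]) auto
    moreover have "(\<Sum>v\<in>V - U - H. e v) \<le> 0"
      by (intro sum_nonpos) (auto simp: H_def superlevel_def e_def)
    ultimately show ?thesis by simp
  qed
  \<comment> \<open>Outside \<open>S J\<close> the excess is at most \<open>\<gamma> / 16\<close>,
    as the volume of \<open>H\<close> is at most \<open>m \<le> 2 ^ J * l\<close>. Inside,
    \<open>J \<le> l\<close> scales give at most \<open>\<gamma> / 8\<close>. Together this is less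
    than \<open>\<gamma> / 4\<close>.\<close>
  also have "(\<Sum>v\<in>H. e v) = (\<Sum>v\<in>H - S J. e v) + (\<Sum>v\<in>S J. e v)"
  proof (rule sum.subset_diff[OF _ fin(2)])
    show "S J \<subseteq> H" unfolding S_def H_def using \<gamma> lpos by (intro superlevel_antimono) simp
  qed
  also have "(\<Sum>v\<in>H - S J. e v) \<le> \<gamma> / (16 * real l * 2 ^ J) * real (vol G H)"
    by (rule outside) (simp add: H_def superlevel_subset)
  also have "\<dots> \<le> \<gamma> / (16 * real l * 2 ^ J) * (2 ^ J * real l)"
    using vol_H l(3) \<gamma> lpos by (intro mult_left_mono) auto
  also have "\<dots> = \<gamma> / 16" using lpos by simp
  also have "(\<Sum>v\<in>S J. e v) \<le> real J * (\<gamma> / (8 * real l))" by (rule scale_sum) simp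
  also have "\<dots> \<le> real l * (\<gamma> / (8 * real l))" using l(1) \<gamma> lpos by (intro mult_right_mono) auto
  also have "\<dots> = \<gamma> / 8" using lpos by simp
  finally show False using big \<gamma> by simp
qed

end

text \<open>With the potential \<open>18 * \<alpha> / \<phi>\<^sup>2 / vol\<close>, one lowering of
  the threshold is paid by the drop of the potential. The total lowering telescopes and is at most
  the initial potential. The bound \<open>2 + \<phi> \<le> 3\<close> turns 18 into 6.\<close>

lemma sweep_potential:
  fixes \<alpha> \<phi> x y :: real
  assumes "0 < \<alpha>" "0 < \<phi>" "\<phi> \<le> 1" "0 < x" "(1 + \<phi> / 2) * x \<le> y"
  shows "6 * \<alpha> / (\<phi> * x) \<le> 18 * \<alpha> / \<phi>\<^sup>2 * (1 / x - 1 / y)"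
proof -
  have "0 < (1 + \<phi> / 2) * x" using assms by (intro mult_pos_pos) auto
  then have "1 / y \<le> 1 / ((1 + \<phi> / 2) * x)" using assms(5) by (intro divide_left_mono) auto
  then have "1 / x - 1 / y \<ge> 1 / x - 1 / ((1 + \<phi> / 2) * x)" by simp
  also have "1 / x - 1 / ((1 + \<phi> / 2) * x) = \<phi> / ((2 + \<phi>) * x)"
  proof -
    have "2 + \<phi> \<noteq> 0" "x \<noteq> 0" "1 + \<phi> / 2 = (2 + \<phi>) / 2" using assms by auto
    then show ?thesis by (simp add: divide_simps)
  qed
  also have "\<dots> \<ge> \<phi> / (3 * x)" using assms by (intro divide_left_mono mult_right_mono) auto
  finally have "18 * \<alpha> / \<phi>\<^sup>2 * (\<phi> / (3 * x)) \<le> 18 * \<alpha> / \<phi>\<^sup>2 * (1 / x - 1 / y)"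
    using assms by (intro mult_left_mono) auto
  moreover have "18 * \<alpha> / \<phi>\<^sup>2 * (\<phi> / (3 * x)) = 6 * \<alpha> / (\<phi> * x)"
    using assms by (simp add: field_simps power2_eq_square)
  ultimately show ?thesis by simp
qed

text \<open>This bounds the number of rounds: each one raises the logarithm of the volume by
  \<open>\<phi> / 4\<close>. It uses \<open>ln (1 + x) \<ge> x - x^2\<close> and
  \<open>ln 2 < 1\<close>.\<close>

lemma log2_growth:
  fixes \<phi> x y :: real
  assumes "0 < \<phi>" "\<phi> \<le> 1" "0 < x" "(1 + \<phi> / 2) * x \<le> y"
  shows "log 2 x + \<phi> / 4 \<le> log 2 y"
proof -
  have "\<phi> / 4 \<le> \<phi> / 2 - (\<phi> / 2)\<^sup>2" using assms by (simp add: power2_eq_square field_simps)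
  also have "\<dots> \<le> ln (1 + \<phi> / 2)" using assms by (intro ln_one_plus_pos_lower_bound) auto
  also have "\<dots> \<le> ln (1 + \<phi> / 2) / ln 2"
    using assms ln_2_less_1 by (simp add: pos_le_divide_eq mult_left_le)
  also have "\<dots> = log 2 (1 + \<phi> / 2)" by (simp add: log_def)
  finally have "log 2 x + \<phi> / 4 \<le> log 2 x + log 2 (1 + \<phi> / 2)" by simp
  also have "\<dots> = log 2 ((1 + \<phi> / 2) * x)" using assms by (simp add: log_mult)
  also have "\<dots> \<le> log 2 y" using assms by (intro log_mono) auto
  finally show ?thesis .
qed

section \<open>Total correctness with running time\<close>

text \<open>Total correctness, with the elapsed time passed to the postcondition. Execution is
  deterministic, so some halting run being good means that the only one is.\<close>

definition wp :: "com \<Rightarrow> (nat \<Rightarrow> state \<Rightarrow> bool) \<Rightarrow> state \<Rightarrow> bool" where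
  "wp c Q s \<longleftrightarrow> (\<exists>t s'. exec c s t s' \<and> Q t s')"

lemma wpI: "exec c s t s' \<Longrightarrow> Q t s' \<Longrightarrow> wp c Q s"
  by (auto simp: wp_def)

lemma wp_exec: "exec c s t s' \<Longrightarrow> wp c Q s \<longleftrightarrow> Q t s'"
  unfolding wp_def using exec_deterministic by blast

lemma wp_mono: "wp c Q s \<Longrightarrow> (\<And>t s'. Q t s' \<Longrightarrow> R t s') \<Longrightarrow> wp c R s"
  by (auto simp: wp_def)

lemma wp_Skip: "wp Skip Q s \<longleftrightarrow> Q 1 s"
  and wp_NAssign: "wp (NAssign x e) Q s \<longleftrightarrow>
    Q (1 + ncost e) (s\<lparr>nvar := (nvar s)(x := nval e s)\<rparr>)"
  and wp_NStore: "wp (NStore a i e) Q s \<longleftrightarrow>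
    Q (1 + ncost i + ncost e) (s\<lparr>narr := (narr s)(a := (narr s a)(nval i s := nval e s))\<rparr>)"
  and wp_RAssign: "wp (RAssign y f) Q s \<longleftrightarrow>
    Q (1 + rcost f) (s\<lparr>rvar := (rvar s)(y := rval f s)\<rparr>)"
  and wp_RStore: "wp (RStore a i f) Q s \<longleftrightarrow>
    Q (1 + ncost i + rcost f) (s\<lparr>rarr := (rarr s)(a := (rarr s a)(nval i s := rval f s))\<rparr>)"
  by (rule wp_exec, rule exec.intros)+

lemma wp_Seq: "wp (Seq c d) Q s \<longleftrightarrow> wp c (\<lambda>t s'. wp d (\<lambda>u. Q (t + u)) s') s"
proof
  assume "wp (Seq c d) Q s"
  then obtain t s' where "exec (Seq c d) s t s'" "Q t s'" by (auto simp: wp_def)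
  then show "wp c (\<lambda>t s'. wp d (\<lambda>u. Q (t + u)) s') s"
    by (cases rule: exec.cases) (auto simp: wp_def)
next
  assume "wp c (\<lambda>t s'. wp d (\<lambda>u. Q (t + u)) s') s"
  then show "wp (Seq c d) Q s" by (auto simp: wp_def intro: exec.Seq)
qed

lemma wp_Cond: "wp (Cond b c d) Q s \<longleftrightarrow>
    (if bval b s then wp c (\<lambda>t. Q (1 + bcost b + t)) s else wp d (\<lambda>t. Q (1 + bcost b + t)) s)"
proof
  assume "wp (Cond b c d) Q s"
  then obtain t s' where "exec (Cond b c d) s t s'" "Q t s'" by (auto simp: wp_def)
  then show "if bval b s then wp c (\<lambda>t. Q (1 + bcost b + t)) s else wp d (\<lambda>t. Q (1 + bcost b + t)) s"
    by (cases rule: exec.cases) (auto simp: wp_def)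
next
  assume "if bval b s then wp c (\<lambda>t. Q (1 + bcost b + t)) s else wp d (\<lambda>t. Q (1 + bcost b + t)) s"
  then show "wp (Cond b c d) Q s"
    unfolding wp_def by (metis exec.CondTrue exec.CondFalse)
qed

lemmas wp_simps = wp_Skip wp_NAssign wp_NStore wp_RAssign wp_RStore wp_Seq wp_Cond

text \<open>The invariant also speaks about the time elapsed since the loop was entered. The variant
  \<open>\<mu>\<close> gives termination; the time bound has to follow from the invariant.\<close>

lemma wp_While:
  fixes \<mu> :: "state \<Rightarrow> nat"
  assumes init: "I 0 s"
    and step: "\<And>t s. I t s \<Longrightarrow> bval b s \<Longrightarrow>
      wp c (\<lambda>u s'. I (t + (1 + bcost b + u)) s' \<and> \<mu> s' < \<mu> s) s"
    and exit: "\<And>t s. I t s \<Longrightarrow> \<not> bval b s \<Longrightarrow> Q (t + (1 + bcost b)) s"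
  shows "wp (While b c) Q s"
proof -
  have "wp (While b c) (\<lambda>u. Q (t + u)) s" if "I t s" for t s
    using that
  proof (induction "\<mu> s" arbitrary: t s rule: less_induct)
    case less
    show ?case
    proof (cases "bval b s")
      case True
      then obtain u s' where body: "exec c s u s'" "I (t + (1 + bcost b + u)) s'" "\<mu> s' < \<mu> s"
        using step[OF less.prems] by (auto simp: wp_def)
      obtain u' s'' where "exec (While b c) s' u' s''" "Q (t + (1 + bcost b + u) + u') s''"
        using less.hyps[OF body(3,2)] by (auto simp: wp_def)
      then show ?thesis
        using exec.WhileTrue[OF True body(1)] by (auto simp: add.assoc intro!: wpI)
    next
      case False
      then show ?thesis using exit[OF less.prems] by (auto intro!: wpI exec.WhileFalse)
    qed
  qed
  from this[OF init] show ?thesis by simp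
qed

section \<open>Frame conditions\<close>

primrec written_nvars :: "com \<Rightarrow> ident set" where
  "written_nvars Skip = {}"
| "written_nvars (NAssign x e) = {x}"
| "written_nvars (NStore a i e) = {}"
| "written_nvars (RAssign x e) = {}"
| "written_nvars (RStore a i e) = {}"
| "written_nvars (Seq c d) = written_nvars c \<union> written_nvars d"
| "written_nvars (Cond b c d) = written_nvars c \<union> written_nvars d"
| "written_nvars (While b c) = written_nvars c"

primrec written_rvars :: "com \<Rightarrow> ident set" where
  "written_rvars Skip = {}"
| "written_rvars (NAssign x e) = {}"
| "written_rvars (NStore a i e) = {}"
| "written_rvars (RAssign x e) = {x}"
| "written_rvars (RStore a i e) = {}"
| "written_rvars (Seq c d) = written_rvars c \<union> written_rvars d"
| "written_rvars (Cond b c d) = written_rvars c \<union> written_rvars d"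
| "written_rvars (While b c) = written_rvars c"

primrec written_narrs :: "com \<Rightarrow> ident set" where
  "written_narrs Skip = {}"
| "written_narrs (NAssign x e) = {}"
| "written_narrs (NStore a i e) = {a}"
| "written_narrs (RAssign x e) = {}"
| "written_narrs (RStore a i e) = {}"
| "written_narrs (Seq c d) = written_narrs c \<union> written_narrs d"
| "written_narrs (Cond b c d) = written_narrs c \<union> written_narrs d"
| "written_narrs (While b c) = written_narrs c"

primrec written_rarrs :: "com \<Rightarrow> ident set" where
  "written_rarrs Skip = {}"
| "written_rarrs (NAssign x e) = {}"
| "written_rarrs (NStore a i e) = {}"
| "written_rarrs (RAssign x e) = {}"
| "written_rarrs (RStore a i e) = {a}"
| "written_rarrs (Seq c d) = written_rarrs c \<union> written_rarrs d"
| "written_rarrs (Cond b c d) = written_rarrs c \<union> written_rarrs d"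
| "written_rarrs (While b c) = written_rarrs c"

definition frame :: "com \<Rightarrow> state \<Rightarrow> state \<Rightarrow> bool" where
  "frame c s s' \<longleftrightarrow>
    (\<forall>x. x \<notin> written_nvars c \<longrightarrow> nvar s' x = nvar s x) \<and>
    (\<forall>x. x \<notin> written_rvars c \<longrightarrow> rvar s' x = rvar s x) \<and>
    (\<forall>x. x \<notin> written_narrs c \<longrightarrow> narr s' x = narr s x) \<and>
    (\<forall>x. x \<notin> written_rarrs c \<longrightarrow> rarr s' x = rarr s x)"

lemma exec_frame: "exec c s t s' \<Longrightarrow> frame c s s'"
  by (induction rule: exec.induct) (auto simp: frame_def)

text \<open>Specifications of subprograms only need to describe what is computed; everything that a
  program never writes is recovered from its syntax.\<close>

lemma wp_frame:
  assumes "wp c Q s" "\<And>t s'. Q t s' \<Longrightarrow> frame c s s' \<Longrightarrow> R t s'"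
  shows "wp c R s"
  using assms exec_frame unfolding wp_def by metis

lemmas written_simps = written_nvars.simps written_rvars.simps written_narrs.simps written_rarrs.simps

section \<open>Pushing\<close>

abbreviation sequence (infixr ";;" 60) where "c ;; d \<equiv> Seq c d"
abbreviation incr :: "ident \<Rightarrow> com" where "incr x \<equiv> NAssign x (NAdd (NVar x) (NConst 1))"
abbreviation offset :: "nexp \<Rightarrow> nexp" where "offset e \<equiv> NArr ''off'' e"
abbreviation degree_exp :: "nexp \<Rightarrow> nexp" where
  "degree_exp e \<equiv> NSub (offset (NAdd e (NConst 1))) (offset e)"
abbreviation rconst :: "nat \<Rightarrow> rexp" where "rconst k \<equiv> RNat (NConst k)"

text \<open>The array \<open>x\<close> holds the residual mass minus the initial mass, which has to stay available
  because the input list is ordered by it. The array \<open>Q\<close> logs every vertex that has received mass;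
  it serves as work list (with repetitions) and is rescanned from its start at each scale.\<close>

definition edge_loop :: com where
  "edge_loop =
    While (NLess (NVar ''a'') (NVar ''b''))
     (NAssign ''w'' (NArr ''adj'' (NVar ''a'')) ;;
      RStore ''x'' (NVar ''w'') (RAdd (RArr ''x'' (NVar ''w'')) (RVar ''share'')) ;;
      NStore ''Q'' (NVar ''qt'') (NVar ''w'') ;;
      incr ''qt'' ;;
      incr ''a'')"

text \<open>A push makes the settled mass positive, so testing \<open>p\<close> before it is updated
  detects the first push at \<open>u\<close> and keeps the array \<open>P\<close> free of
  repetitions.\<close>

definition register_vertex :: com where
  "register_vertex =
    Cond (RLess (rconst 0) (RArr ''p'' (NVar ''u''))) Skip
      (NStore ''P'' (NVar ''np'') (NVar ''u'') ;; incr ''np'')"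

text \<open>Besides the neighbours, \<open>u\<close> itself is logged again: the part
  \<open>(1 - \<alpha>) / 2\<close> of the residual that stays may still be above the
  threshold.\<close>

definition push_vertex :: com where
  "push_vertex =
    NAssign ''a'' (offset (NVar ''u'')) ;;
    NAssign ''b'' (offset (NAdd (NVar ''u'') (NConst 1))) ;;
    RAssign ''res'' (RAdd (RArr ''p0'' (NVar ''u'')) (RArr ''x'' (NVar ''u''))) ;;
    Cond (RLess (RVar ''res'') (RMul (RVar ''eps'') (RNat (NSub (NVar ''b'') (NVar ''a''))))) Skip
     (register_vertex ;;
      RStore ''p'' (NVar ''u'') (RAdd (RArr ''p'' (NVar ''u'')) (RMul (RVar ''alpha'') (RVar ''res''))) ;;
      RAssign ''share'' (RDiv (RMul (RSub (rconst 1) (RVar ''alpha'')) (RVar ''res''))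
        (RMul (rconst 2) (RNat (NSub (NVar ''b'') (NVar ''a''))))) ;;
      RStore ''x'' (NVar ''u'') (RAdd (RArr ''x'' (NVar ''u''))
        (RSub (RDiv (RMul (RSub (rconst 1) (RVar ''alpha'')) (RVar ''res'')) (rconst 2)) (RVar ''res''))) ;;
      NStore ''Q'' (NVar ''qt'') (NVar ''u'') ;;
      incr ''qt'' ;;
      edge_loop)"

text \<open>As the listing is sorted by density, reading stops at the first vertex below the
  threshold. The position \<open>lp\<close> is kept from scale to scale, so no vertex is read from
  the listing twice.\<close>

definition list_loop :: com where
  "list_loop =
    While (BAnd (NLess (NVar ''lp'') (NVar ''k''))
      (BNot (RLess (RArr ''p0'' (NArr ''list'' (NVar ''lp'')))
        (RMul (RVar ''eps'') (RNat (degree_exp (NArr ''list'' (NVar ''lp''))))))))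
     (NStore ''Q'' (NVar ''qt'') (NArr ''list'' (NVar ''lp'')) ;;
      incr ''qt'' ;;
      incr ''lp'')"

definition push_loop :: com where
  "push_loop =
    While (NLess (NVar ''h'') (NVar ''qt''))
     (NAssign ''u'' (NArr ''Q'' (NVar ''h'')) ;; incr ''h'' ;; push_vertex)"

definition push_phase :: com where
  "push_phase = list_loop ;; NAssign ''h'' (NConst 0) ;; push_loop"

section \<open>The input and its arrays\<close>

locale pagerank_input =
  fixes G :: "nat mgraph" and A :: "nat list list" and \<alpha> \<gamma> :: real
    and p0 :: "nat \<Rightarrow> real" and L :: "nat list"
  assumes multigraph_G: "multigraph G"
    and deg_pos_G: "\<forall>v\<in>verts G. deg G v > 0"
    and adjacency: "adjacency_lists G A"
    and alpha_G: "0 < \<alpha>" "\<alpha> \<le> 1 / 3"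
    and gamma: "0 < \<gamma>" "\<gamma> < 1"
    and p0: "mass_distribution G p0" "mass p0 (verts G) = 1"
    and listing: "density_listing G p0 L"

sublocale pagerank_input \<subseteq> pagerank G \<alpha> p0
  using multigraph_G deg_pos_G alpha_G p0
  by unfold_locales (auto simp: mass_distribution_def mass_def)

context pagerank_input
begin

abbreviation "n \<equiv> length A"

lemma V_eq: "V = {..<n}"
  using adjacency by (simp add: adjacency_lists_def)

lemma count_A: "v < n \<Longrightarrow> count (mset (A ! v)) w = adjacency G v w"
  using adjacency by (simp add: adjacency_lists_def)

lemma set_A: "v < n \<Longrightarrow> set (A ! v) \<subseteq> V"
proof
  fix w assume v: "v < n" and "w \<in> set (A ! v)"
  then have "{v, w} \<in># edges G"
    using count_A[OF v, of w] by (metis count_greater_zero_iff set_mset_mset)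
  then show "w \<in> V" using multigraph_G by (auto simp: multigraph_def)
qed

lemma length_A:
  assumes "v < n" shows "length (A ! v) = deg G v"
proof -
  have "length (A ! v) = size (mset (A ! v))" by simp
  also have "\<dots> = (\<Sum>w\<in>set (A ! v). count (mset (A ! v)) w)"
    by (simp only: size_multiset_overloaded_eq set_mset_mset)
  also have "\<dots> = (\<Sum>w\<in>V. count (mset (A ! v)) w)"
    using set_A[OF assms] finite_V by (intro sum.mono_neutral_left) (auto simp: count_eq_zero_iff)
  also have "\<dots> = deg G v"
    using assms by (simp add: deg_eq_sum[OF multigraph_G] V_eq count_A)
  finally show ?thesis .
qed

text \<open>With parallel edges repeated in the lists, counting list entries outside
  \<open>S\<close> counts cut edges at \<open>v\<close>.\<close>

lemma length_filter_A:
  assumes "v < n"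
  shows "length (filter (\<lambda>w. w \<notin> S) (A ! v)) = (\<Sum>w\<in>V - S. adjacency G v w)"
proof -
  let ?xs = "filter (\<lambda>w. w \<notin> S) (A ! v)"
  have "length ?xs = size (mset ?xs)" by (simp only: size_mset)
  also have "\<dots> = (\<Sum>w\<in>set ?xs. count (mset ?xs) w)"
    by (simp only: size_multiset_overloaded_eq set_mset_mset)
  also have "\<dots> = (\<Sum>w\<in>V - S. count (mset ?xs) w)"
    using set_A[OF assms] finite_V by (intro sum.mono_neutral_left) (auto simp: count_eq_zero_iff)
  also have "\<dots> = (\<Sum>w\<in>V - S. count (mset (A ! v)) w)"
    by (intro sum.cong) (auto simp: mset_filter)
  finally show ?thesis using assms by (simp add: count_A)
qed

definition off_array :: "nat \<Rightarrow> nat" where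
  "off_array = array_of (map (\<lambda>v. length (concat (take v A))) [0..<Suc n])"

definition input :: "state \<Rightarrow> bool" where
  "input s \<longleftrightarrow> nvar s ''n'' = n \<and> nvar s ''m'' = m \<and> nvar s ''k'' = length L \<and>
    rvar s ''alpha'' = \<alpha> \<and> rvar s ''gamma'' = \<gamma> \<and>
    narr s ''off'' = off_array \<and>
    narr s ''adj'' = array_of (concat A) \<and> narr s ''list'' = array_of L \<and>
    rarr s ''p0'' = array_of (map p0 [0..<n])"

lemma inputD:
  assumes "input s"
  shows "nvar s ''n'' = n" "nvar s ''m'' = m" "nvar s ''k'' = length L"
    "rvar s ''alpha'' = \<alpha>" "rvar s ''gamma'' = \<gamma>"
  using assms by (simp_all add: input_def)

lemma input_p0: "input s \<Longrightarrow> v < n \<Longrightarrow> rarr s ''p0'' v = p0 v"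
  by (simp add: input_def array_of_def)

lemma input_list: "input s \<Longrightarrow> i < length L \<Longrightarrow> narr s ''list'' i = L ! i"
  by (simp add: input_def array_of_def)

lemma input_off_Suc: "input s \<Longrightarrow> v < n \<Longrightarrow> narr s ''off'' (Suc v) = narr s ''off'' v + deg G v"
  by (simp add: input_def off_array_def array_of_def take_Suc_conv_app_nth length_A del: upt_Suc)

lemma input_adj:
  assumes "input s" "v < n" "i < deg G v"
  shows "narr s ''adj'' (narr s ''off'' v + i) = A ! v ! i"
proof -
  let ?o = "length (concat (take v A))"
  have split: "concat A = concat (take v A) @ A ! v @ concat (drop (Suc v) A)"
    using assms(2) by (metis concat.simps(2) concat_append id_take_nth_drop)
  have "?o + i < length (concat A)"
    unfolding split using assms length_A by simp
  moreover have "concat A ! (?o + i) = A ! v ! i"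
    unfolding split using assms length_A by (simp add: nth_append)
  ultimately show ?thesis
    using assms by (simp add: input_def off_array_def array_of_def del: upt_Suc)
qed

section \<open>Verification of the push phase\<close>

definition array_list :: "(nat \<Rightarrow> 'a) \<Rightarrow> nat \<Rightarrow> 'a list" where
  "array_list f k = map f [0..<k]"

lemma array_list_0 [simp]: "array_list f 0 = []"
  by (simp add: array_list_def)

lemma length_array_list [simp]: "length (array_list f k) = k"
  by (simp add: array_list_def)

lemma nth_array_list [simp]: "i < k \<Longrightarrow> array_list f k ! i = f i"
  by (simp add: array_list_def)

lemma array_list_snoc [simp]: "array_list (f(k := x)) (Suc k) = array_list f k @ [x]"
  by (simp add: array_list_def)

lemma edge_loop:
  assumes inp: "input s" and u: "u < n"
    and ab: "nvar s ''a'' = narr s ''off'' u" "nvar s ''b'' = narr s ''off'' u + deg G u"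
  shows "wp edge_loop (\<lambda>t s'.
    rarr s' ''x'' = (\<lambda>w. rarr s ''x'' w + real (count (mset (A ! u)) w) * rvar s ''share'') \<and>
    array_list (narr s' ''Q'') (nvar s' ''qt'') =
      array_list (narr s ''Q'') (nvar s ''qt'') @ A ! u \<and>
    t \<le> 30 * deg G u + 4) s"
  unfolding edge_loop_def
proof (rule wp_While[where \<mu> = "\<lambda>s. nvar s ''b'' - nvar s ''a''" and I = "\<lambda>t s'. \<exists>j \<le> deg G u.
    nvar s' ''a'' = narr s ''off'' u + j \<and> nvar s' ''b'' = nvar s ''b'' \<and>
    narr s' ''adj'' = narr s ''adj'' \<and> rvar s' ''share'' = rvar s ''share'' \<and>
    rarr s' ''x'' = (\<lambda>w. rarr s ''x'' w + real (count (mset (take j (A ! u))) w) * rvar s ''share'') \<and>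
    array_list (narr s' ''Q'') (nvar s' ''qt'') =
      array_list (narr s ''Q'') (nvar s ''qt'') @ take j (A ! u) \<and> t \<le> 30 * j"],
    goal_cases)
  case 1
  then show ?case using ab by (intro exI[of _ 0]) simp
next
  case (2 t s')
  then obtain j where j: "j \<le> deg G u" "nvar s' ''a'' = narr s ''off'' u + j"
    "nvar s' ''b'' = nvar s ''b''" "narr s' ''adj'' = narr s ''adj''"
    "rvar s' ''share'' = rvar s ''share''"
    "rarr s' ''x'' = (\<lambda>w. rarr s ''x'' w + real (count (mset (take j (A ! u))) w) * rvar s ''share'')"
    "array_list (narr s' ''Q'') (nvar s' ''qt'') =
      array_list (narr s ''Q'') (nvar s ''qt'') @ take j (A ! u)" "t \<le> 30 * j"
    by auto
  have j_less: "j < deg G u" using 2(2) j ab by simp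
  have w: "narr s ''adj'' (narr s ''off'' u + j) = A ! u ! j"
    using input_adj[OF inp u j_less] .
  have take: "take (Suc j) (A ! u) = take j (A ! u) @ [A ! u ! j]"
    using j_less length_A[OF u] by (simp add: take_Suc_conv_app_nth)
  show ?case
    using j_less j(8) by (auto simp: wp_simps j(1-7) w take ab fun_eq_iff distrib_right)
next
  case (3 t s')
  then show ?case using ab length_A[OF u] by auto
qed


definition residual :: "state \<Rightarrow> nat \<Rightarrow> real" where
  "residual s = (\<lambda>v. p0 v + rarr s ''x'' v)"

abbreviation queue :: "state \<Rightarrow> nat list" where
  "queue s \<equiv> array_list (narr s ''Q'') (nvar s ''qt'')"

abbreviation pushed :: "state \<Rightarrow> nat list" where
  "pushed s \<equiv> array_list (narr s ''P'') (nvar s ''np'')"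

text \<open>The log contains every vertex whose residual or settled mass may have been changed. The
  last two clauses are the amortisation: a listed vertex owns initial mass at least
  \<open>e\<close>, and a push at \<open>u\<close> adds \<open>1 + d u \<le> 2 * d u\<close> log
  entries while settling at least \<open>\<alpha> * e * d u\<close>.\<close>

definition push_inv :: "real \<Rightarrow> state \<Rightarrow> bool" where
  "push_inv e s \<longleftrightarrow> input s \<and> consistent (rarr s ''p'') (residual s) \<and>
    (\<forall>v\<in>V. 0 \<le> rarr s ''p'' v \<and> 0 \<le> residual s v) \<and>
    (\<forall>v\<in>V. v \<notin> set (queue s) \<longrightarrow> rarr s ''x'' v = 0 \<and> rarr s ''p'' v = 0) \<and> set (queue s) \<subseteq> V \<and>
    distinct (pushed s) \<and> set (pushed s) = {v \<in> V. 0 < rarr s ''p'' v} \<and>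
    nvar s ''lp'' \<le> length L \<and> set (take (nvar s ''lp'') L) \<subseteq> set (queue s) \<and>
    (\<forall>i<nvar s ''lp''. e \<le> p0 (L ! i)) \<and>
    \<alpha> * e * (real (nvar s ''qt'') - real (nvar s ''lp'')) \<le> 2 * (\<Sum>v\<in>V. rarr s ''p'' v)"

lemma register_vertex:
  assumes "nvar s ''u'' \<in> V" "distinct (pushed s)" "set (pushed s) = {v \<in> V. 0 < rarr s ''p'' v}"
  shows "wp register_vertex (\<lambda>t s'. distinct (pushed s') \<and>
    set (pushed s') = insert (nvar s ''u'') {v \<in> V. 0 < rarr s ''p'' v} \<and> t \<le> 20) s"
  using assms by (auto simp: register_vertex_def wp_simps)

lemma push_inv_push:
  assumes inv: "push_inv e s" and e: "0 < e" and u: "u < n" and res: "e * d u \<le> residual s u"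
    and s': "input s'" "rarr s' ''p'' = (rarr s ''p'')(u := rarr s ''p'' u + \<alpha> * residual s u)"
      "rarr s' ''x'' = (\<lambda>w. (if w = u then (1 - \<alpha>) * residual s u / 2 - p0 u else rarr s ''x'' w) +
        real (count (mset (A ! u)) w) * ((1 - \<alpha>) * residual s u) / (2 * d u))"
      "queue s' = queue s @ u # A ! u" "distinct (pushed s')"
      "set (pushed s') = insert u {v \<in> V. 0 < rarr s ''p'' v}" "nvar s' ''lp'' = nvar s ''lp''"
  shows "push_inv e s'"
proof -
  let ?p = "rarr s ''p''" and ?p' = "rarr s' ''p''"
  have uV: "u \<in> V" using u by (simp add: V_eq)
  have "0 < d u" by (rule d_pos[OF uV])
  with e have "0 < e * d u" by simp
  with res have pos: "0 < residual s u" by simp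
  have push: "push G \<alpha> u (?p, residual s) = (?p', residual s')"
    using adjacency_self[OF multigraph_G, of u]
    by (auto simp: push_def s' residual_def count_A[OF u] fun_eq_iff)
  have nn: "\<forall>v\<in>V. 0 \<le> ?p v \<and> 0 \<le> residual s v" using inv by (simp add: push_inv_def)
  have qt: "nvar s' ''qt'' = nvar s ''qt'' + Suc (deg G u)"
    using arg_cong[OF s'(4), of length] length_A[OF u] by simp
  have sum: "(\<Sum>v\<in>V. ?p' v) = (\<Sum>v\<in>V. ?p v) + \<alpha> * residual s u"
  proof -
    have "(\<Sum>v\<in>V. ?p' v) = (\<Sum>v\<in>V. ?p v + (if v = u then \<alpha> * residual s u else 0))"
      by (rule sum.cong) (auto simp: s')
    then show ?thesis using uV finite_V by (simp add: sum.distrib)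
  qed
  have "\<alpha> * e * (1 + d u) \<le> \<alpha> * e * (2 * d u)"
    using deg_pos[OF uV] alpha e by (intro mult_left_mono) auto
  also have "\<dots> \<le> 2 * (\<alpha> * residual s u)"
    using res alpha by (simp add: algebra_simps)
  finally have "\<alpha> * e * (real (nvar s' ''qt'') - real (nvar s' ''lp'')) \<le> 2 * (\<Sum>v\<in>V. ?p' v)"
    using inv unfolding qt sum s'(7) push_inv_def by (simp add: algebra_simps)
  moreover have "consistent ?p' (residual s')"
    using inv consistent_push[OF _ uV push] by (simp add: push_inv_def)
  moreover have "\<forall>v\<in>V. 0 \<le> ?p' v \<and> 0 \<le> residual s' v"
    using push_nonneg[OF push uV nn] .
  moreover have "set (pushed s') = {v \<in> V. 0 < ?p' v}"
  proof -
    have "0 < ?p u + \<alpha> * residual s u"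
      using nn uV pos alpha by (intro add_nonneg_pos mult_pos_pos) auto
    then show ?thesis using uV by (auto simp: s')
  qed
  moreover have "\<forall>v\<in>V. v \<notin> set (queue s') \<longrightarrow> rarr s' ''x'' v = 0 \<and> ?p' v = 0"
    using inv by (auto simp: s' push_inv_def count_eq_zero_iff)
  ultimately show ?thesis
    using inv uV set_A[OF u] unfolding push_inv_def s'(4) s'(7) by (auto simp: s'(1,5))
qed

text \<open>The cost is charged to the new log entries \<open>ys\<close>. They contain every vertex
  whose residual has changed; if \<open>u\<close> is not among them, no push was needed.\<close>

lemma push_vertex:
  assumes inv: "push_inv e s" and e: "0 < e" "rvar s ''eps'' = e" and u: "nvar s ''u'' = u" "u < n"
  shows "wp push_vertex (\<lambda>t s'. push_inv e s' \<and> (\<exists>ys. queue s' = queue s @ ys \<and>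
    t \<le> 100 * length ys + 100 \<and>
    (\<forall>v\<in>V. v \<notin> set ys \<longrightarrow> residual s' v = residual s v \<and> (v = u \<longrightarrow> residual s v < e * d v)))) s"
proof (cases "residual s u < e * d u")
  case True
  have inp: "input s" using inv by (simp add: push_inv_def)
  from True show ?thesis
    using inv e u input_off_Suc[OF inp u(2)] input_p0[OF inp u(2)]
    by (simp add: push_vertex_def wp_simps residual_def push_inv_def input_def)
next
  case False
  have inp: "input s" using inv by (simp add: push_inv_def)
  from False show ?thesis
    using inv e u input_off_Suc[OF inp u(2)] input_p0[OF inp u(2)]
    apply (simp add: push_vertex_def wp_simps residual_def)
    apply (rule wp_frame[OF register_vertex])
    apply (simp add: V_eq)
    apply (simp add: push_inv_def)
    apply (simp add: push_inv_def)
    apply (elim conjE)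
    apply (simp add: frame_def register_vertex_def written_simps)
    apply (rule wp_frame[OF edge_loop[where u = u]])
    apply (simp add: push_inv_def input_def)
    apply simp
    apply simp
    apply simp
    apply (elim conjE)
    apply (simp add: frame_def edge_loop_def written_simps)
    apply (rule conjI)
     apply (rule push_inv_push[of e s u])
    apply (simp_all add: push_inv_def input_def residual_def length_A cong: if_cong)
    done
qed


text \<open>Listed vertices are distinct and own mass at least \<open>e\<close> each, out of a total
  of 1. For the log, the settled mass contributes 2 and the listing at most
  \<open>\<alpha> \<le> 1\<close> to \<open>\<alpha> * e * qt\<close>.\<close>

lemma push_inv_bounds:
  assumes inv: "push_inv e s" and e: "0 < e"
  shows "real (nvar s ''lp'') \<le> 1 / e" "real (nvar s ''qt'') \<le> 3 / (\<alpha> * e)"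
    "(\<Sum>v\<in>V. rarr s ''p'' v) \<le> 1"
proof -
  let ?l = "nvar s ''lp''"
  have L: "distinct L" "set L \<subseteq> V" using listing by (auto simp: density_listing_def)
  have l: "?l \<le> length L" "\<forall>i<?l. e \<le> p0 (L ! i)" using inv by (auto simp: push_inv_def)
  have "real ?l * e = (\<Sum>v\<in>set (take ?l L). e)"
    using L(1) l(1) by (simp add: distinct_card)
  also have "\<dots> \<le> (\<Sum>v\<in>set (take ?l L). p0 v)"
    using l by (intro sum_mono) (auto simp: in_set_conv_nth)
  also have "\<dots> \<le> (\<Sum>v\<in>V. p0 v)"
    using L(2) finite_V p0_nonneg set_take_subset[of ?l L] by (intro sum_mono2) auto
  finally have le: "real ?l * e \<le> 1" using p0_mass by simp
  then show "real ?l \<le> 1 / e" using e by (simp add: field_simps)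
  have "consistent (rarr s ''p'') (residual s)" "\<forall>v\<in>V. 0 \<le> residual s v"
    using inv by (auto simp: push_inv_def)
  then show p: "(\<Sum>v\<in>V. rarr s ''p'' v) \<le> 1"
    using consistent_mass[of "rarr s ''p''" "residual s"] sum_nonneg[of V "residual s"] by simp
  have "\<alpha> * e * (real (nvar s ''qt'') - real ?l) \<le> 2 * (\<Sum>v\<in>V. rarr s ''p'' v)"
    using inv by (simp add: push_inv_def)
  moreover have "\<alpha> * (real ?l * e) \<le> \<alpha> * 1" using le alpha by (intro mult_left_mono) auto
  ultimately have "\<alpha> * e * real (nvar s ''qt'') \<le> 3"
    using p alpha unfolding right_diff_distrib by (simp only: mult_ac mult_1_right)
  then show "real (nvar s ''qt'') \<le> 3 / (\<alpha> * e)"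
    using alpha e by (simp add: field_simps)
qed

text \<open>The residual of a vertex that is not logged is its initial mass. By the order of the
  listing, its density is at most that of the vertex at position \<open>lp\<close>, which is below
  the threshold.\<close>

lemma listing_exhausted:
  assumes inv: "push_inv e s" and e: "0 < e"
    and stop: "nvar s ''lp'' < length L \<Longrightarrow>
      p0 (L ! nvar s ''lp'') < e * d (L ! nvar s ''lp'')"
    and v: "v \<in> V" "v \<notin> set (queue s)"
  shows "residual s v < e * d v"
proof (rule ccontr)
  assume "\<not> ?thesis"
  then have ge: "e * d v \<le> p0 v" using inv v by (auto simp: push_inv_def residual_def)
  let ?l = "nvar s ''lp''"
  have "0 < e * d v" using e d_pos[OF v(1)] by simp
  then have "v \<in> set L" using listing v(1) ge by (simp add: density_listing_def)
  then obtain i where i: "i < length L" "v = L ! i" by (auto simp: in_set_conv_nth)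
  have "\<not> i < ?l"
  proof
    assume "i < ?l"
    then have "v \<in> set (take ?l L)" using i by (auto simp: in_set_conv_nth)
    then show False using inv v(2) by (auto simp: push_inv_def)
  qed
  then have l: "?l \<le> i" "?l < length L" using i by auto
  then have "L ! ?l \<in> V" using listing nth_mem by (fastforce simp: density_listing_def)
  then have "mass_density G p0 (L ! ?l) < e"
    using stop[OF l(2)] d_pos[of "L ! ?l"] by (simp add: mass_density_def pos_divide_less_eq)
  moreover have "mass_density G p0 v \<le> mass_density G p0 (L ! ?l)"
  proof (cases "?l = i")
    case False
    then show ?thesis using l i listing sorted_wrt_nth_less[of _ L ?l i] by (auto simp: density_listing_def)
  qed (simp add: i)
  moreover have "e \<le> mass_density G p0 v"
    using ge d_pos[OF v(1)] by (simp add: mass_density_def pos_le_divide_eq)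
  ultimately show False by simp
qed

lemma push_inv_list:
  assumes inv: "push_inv e s" and e: "0 < e" and l: "nvar s ''lp'' = l" "l < length L"
    and ge: "e * d (L ! l) \<le> p0 (L ! l)"
    and s': "input s'" "rarr s' ''p'' = rarr s ''p''" "rarr s' ''x'' = rarr s ''x''"
      "queue s' = queue s @ [L ! l]" "pushed s' = pushed s" "nvar s' ''lp'' = Suc l"
  shows "push_inv e s'"
proof -
  have V: "L ! l \<in> V" using listing l nth_mem by (fastforce simp: density_listing_def)
  have "nvar s' ''qt'' = Suc (nvar s ''qt'')" using arg_cong[OF s'(4), of length] by simp
  moreover have "e * 1 \<le> e * d (L ! l)" using e deg_pos[OF V] by (intro mult_left_mono) auto
  then have "e \<le> p0 (L ! l)" using ge by simp
  ultimately show ?thesis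
    using inv V l unfolding push_inv_def s'(4-6)
    by (auto simp: s' residual_def take_Suc_conv_app_nth less_Suc_eq)
qed

text \<open>The time is measured by the absolute position \<open>lp\<close>. This overcounts when
  the loop resumes at a later scale, but \<open>lp \<le> 1 / e\<close> always holds.\<close>

lemma list_loop:
  assumes inv: "push_inv e s" and e: "0 < e" "rvar s ''eps'' = e"
  shows "wp list_loop (\<lambda>t s'. push_inv e s' \<and>
    (\<forall>v\<in>V. v \<notin> set (queue s') \<longrightarrow> residual s' v < e * d v) \<and> t \<le> 60 * nvar s' ''lp'' + 60) s"
  unfolding list_loop_def
proof (rule wp_While[where \<mu> = "\<lambda>s. length L - nvar s ''lp''" and
    I = "\<lambda>t s'. push_inv e s' \<and> rvar s' ''eps'' = e \<and> t \<le> 60 * nvar s' ''lp''"], goal_cases)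
  case 1
  show ?case using inv e by simp
next
  case (2 t s)
  then have inp: "input s" by (simp add: push_inv_def)
  let ?l = "nvar s ''lp''"
  have l: "?l < length L" "narr s ''list'' ?l = L ! ?l"
    using 2 input_list[OF inp] by (auto simp: inputD[OF inp])
  have V: "L ! ?l < n"
    using listing l(1) nth_mem by (fastforce simp: density_listing_def V_eq)
  have ge: "e * d (L ! ?l) \<le> p0 (L ! ?l)"
    using 2 l input_off_Suc[OF inp V] input_p0[OF inp V] by simp
  show ?case
  proof -
    have "push_inv e (s\<lparr>narr := (narr s)(''Q'' := (narr s ''Q'')(nvar s ''qt'' := L ! ?l)),
        nvar := (nvar s)(''qt'' := Suc (nvar s ''qt''), ''lp'' := Suc ?l)\<rparr>)"
      by (rule push_inv_list[OF _ e(1) refl l(1) ge]) (use 2(1) inp in \<open>simp_all add: input_def\<close>)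
    then show ?thesis using 2(1) l by (simp add: wp_simps diff_less_mono2)
  qed
next
  case (3 t s)
  then have inp: "input s" by (simp add: push_inv_def)
  let ?l = "nvar s ''lp''"
  have stop: "p0 (L ! ?l) < e * d (L ! ?l)" if "?l < length L"
  proof -
    have l: "narr s ''list'' ?l = L ! ?l" using that input_list[OF inp] by auto
    have V: "L ! ?l < n"
      using listing that nth_mem by (fastforce simp: density_listing_def V_eq)
    show ?thesis using 3 l that input_off_Suc[OF inp V] input_p0[OF inp V] by (simp add: inputD[OF inp])
  qed
  then show ?case using 3 listing_exhausted[OF _ e(1) stop] by simp
qed

text \<open>Every vertex with large residual occurs in the unread part of the log. The log can still
  grow while it is read, so termination comes from its absolute length bound
  \<open>3 / (\<alpha> * e)\<close>.\<close>

lemma push_loop: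
  assumes inv: "push_inv e s" and e: "0 < e" "rvar s ''eps'' = e" and h: "nvar s ''h'' = 0"
    and active: "\<forall>v\<in>V. v \<notin> set (queue s) \<longrightarrow> residual s v < e * d v"
  shows "wp push_loop (\<lambda>t s'. push_inv e s' \<and> (\<forall>v\<in>V. residual s' v < e * d v) \<and>
    t \<le> 300 * nvar s' ''qt'' + 10) s"
  unfolding push_loop_def
proof (rule wp_While[where \<mu> = "\<lambda>s. nat \<lfloor>3 / (\<alpha> * e)\<rfloor> - nvar s ''h''" and
    I = "\<lambda>t s'. push_inv e s' \<and> rvar s' ''eps'' = e \<and> nvar s' ''h'' \<le> nvar s' ''qt'' \<and>
      (\<forall>v\<in>V. v \<notin> set (drop (nvar s' ''h'') (queue s')) \<longrightarrow> residual s' v < e * d v) \<and>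
      t \<le> 150 * nvar s' ''h'' + 100 * nvar s' ''qt''"], goal_cases)
  case 1
  show ?case using inv e h active by simp
next
  case (2 t s)
  let ?h = "nvar s ''h''"
  define u where "u = narr s ''Q'' ?h"
  have h: "?h < nvar s ''qt''" using 2 by simp
  have drop: "drop ?h (queue s) = u # drop (Suc ?h) (queue s)"
    using h by (simp add: Cons_nth_drop_Suc[symmetric] u_def)
  have "u \<in> set (queue s)" using drop in_set_dropD[of u ?h] by simp
  then have u: "u < n" using 2(1) V_eq by (auto simp: push_inv_def)
  have "real (nvar s ''qt'') \<le> 3 / (\<alpha> * e)" using 2(1) push_inv_bounds(2) e(1) by blast
  then have bound: "?h < nat \<lfloor>3 / (\<alpha> * e)\<rfloor>" using h by linarith
  let ?s = "s\<lparr>nvar := (nvar s)(''u'' := u, ''h'' := Suc ?h)\<rparr>"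
  have "wp push_vertex (\<lambda>t' s'. push_inv e s' \<and> rvar s' ''eps'' = e \<and> nvar s' ''h'' \<le> nvar s' ''qt'' \<and>
      (\<forall>v\<in>V. v \<notin> set (drop (nvar s' ''h'') (queue s')) \<longrightarrow> residual s' v < e * d v) \<and>
      t + 150 + t' \<le> 150 * nvar s' ''h'' + 100 * nvar s' ''qt'' + 100 \<and> nvar s' ''h'' = Suc ?h) ?s"
  proof (rule wp_frame[OF push_vertex[where e = e and u = u]], goal_cases)
    case 1
    then show ?case using 2(1) by (simp add: push_inv_def input_def residual_def)
  next
    case (6 t' s')
    then obtain ys where ys: "queue s' = queue s @ ys" "t' \<le> 100 * length ys + 100"
      "\<forall>v\<in>V. v \<notin> set ys \<longrightarrow> residual s' v = residual s v \<and> (v = u \<longrightarrow> residual s v < e * d v)"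
      by (auto simp: residual_def)
    have fr: "nvar s' ''h'' = Suc ?h" "rvar s' ''eps'' = e"
      using 6(2) 2(1) by (auto simp: frame_def push_vertex_def register_vertex_def edge_loop_def)
    have qt: "nvar s' ''qt'' = nvar s ''qt'' + length ys" using arg_cong[OF ys(1), of length] by simp
    have "set (drop (Suc ?h) (queue s')) = set (drop (Suc ?h) (queue s)) \<union> set ys"
      unfolding ys(1) using h by simp
    then have "\<forall>v\<in>V. v \<notin> set (drop (Suc ?h) (queue s')) \<longrightarrow> residual s' v < e * d v"
      using ys(3) 2(1) drop by (metis UnI1 UnI2 set_ConsD)
    then show ?case using 6(1) fr qt h 2(1) ys(2) by simp
  qed (use e 2(1) u in auto)
  then show ?case
    apply (simp add: wp_simps u_def[symmetric])
    apply (erule wp_mono)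
    using bound by auto
next
  case (3 t s)
  then show ?case by auto
qed

lemma push_phase:
  assumes inv: "push_inv e s" and e: "0 < e" "e \<le> 1" "rvar s ''eps'' = e"
  shows "wp push_phase (\<lambda>t s'. push_inv e s' \<and> (\<forall>v\<in>V. residual s' v < e * d v) \<and>
    real t \<le> 2000 / (\<alpha> * e)) s"
proof -
  have time: "real t \<le> 2000 / (\<alpha> * e)"
    if "push_inv e s'" "t \<le> 60 * nvar s' ''lp'' + 62 + (300 * nvar s' ''qt'' + 10)" for t s'
  proof -
    have "\<alpha> * e \<le> 1 * e" "\<alpha> * e \<le> 1 * 1" using alpha e by (intro mult_mono; simp)+
    then have "1 / e \<le> 1 / (\<alpha> * e)" "1 \<le> 1 / (\<alpha> * e)"
      using alpha e by (auto intro!: divide_left_mono simp: pos_le_divide_eq)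
    moreover have "real t \<le> 60 * real (nvar s' ''lp'') + 72 + 300 * real (nvar s' ''qt'')"
      using that(2) by linarith
    ultimately have "real t \<le> 1032 * (1 / (\<alpha> * e))"
      using push_inv_bounds(1,2)[OF that(1) e(1)] by linarith
    then show ?thesis using alpha e by (simp add: field_simps)
  qed
  show ?thesis
    unfolding push_phase_def wp_Seq wp_NAssign
  proof (rule wp_frame[OF list_loop[OF inv e(1,3)]], goal_cases)
    case (1 t s1)
    have "rvar s1 ''eps'' = e" using 1(2) e(3) by (simp add: frame_def list_loop_def)
    then show ?case
    proof (intro wp_frame[OF push_loop[where e = e]], goal_cases)
      case 1
      show ?case using \<open>push_inv e s1 \<and> _\<close> by (simp add: push_inv_def input_def residual_def)
    next
      case (6 t' s2)
      have "nvar s2 ''lp'' = nvar s1 ''lp''"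
        using 6(3) by (simp add: frame_def push_loop_def push_vertex_def register_vertex_def edge_loop_def)
      then have "Suc (1 + t + t') \<le> 60 * nvar s2 ''lp'' + 62 + (300 * nvar s2 ''qt'' + 10)"
        using 6(2) 1(1) by simp
      from time[OF _ this] show ?case using 6(2) by (simp add: add_ac)
    qed (use e 1(1) in \<open>auto simp: residual_def\<close>)
  qed
qed

end

section \<open>Sweep programs\<close>

definition cut_loop :: com where
  "cut_loop =
    While (NLess (NVar ''a'') (NVar ''b''))
     (NAssign ''w'' (NArr ''adj'' (NVar ''a'')) ;;
      Cond (RLess (RArr ''p'' (NVar ''w'')) (RMul (RVar ''tau'') (RNat (degree_exp (NVar ''w'')))))
        (incr ''cut'') Skip ;;
      incr ''a'')"

definition scan_vertex :: com where
  "scan_vertex =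
    NAssign ''a'' (offset (NVar ''v'')) ;;
    NAssign ''b'' (offset (NAdd (NVar ''v'') (NConst 1))) ;;
    Cond (RLess (RArr ''p'' (NVar ''v'')) (RMul (RVar ''tau'') (RNat (NSub (NVar ''b'') (NVar ''a''))))) Skip
     (NStore ''T'' (NVar ''size'') (NVar ''v'') ;;
      incr ''size'' ;;
      NAssign ''vol'' (NAdd (NVar ''vol'') (NSub (NVar ''b'') (NVar ''a''))) ;;
      cut_loop)"

definition scan_loop :: com where
  "scan_loop =
    While (NLess (NVar ''i'') (NVar ''dn''))
     (NAssign ''v'' (NArr ''D'' (NVar ''i'')) ;; incr ''i'' ;; scan_vertex)"

definition scan :: com where
  "scan =
    NAssign ''size'' (NConst 0) ;; NAssign ''vol'' (NConst 0) ;; NAssign ''cut'' (NConst 0) ;;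
    NAssign ''i'' (NConst 0) ;; scan_loop"

text \<open>The expression \<open>f\<close> is the current volume in the top sweep and
  \<open>m\<close> in the bottom sweep, according to the step lengths in
  \<open>top_sweep_step\<close> and \<open>bottom_sweep_step\<close>.\<close>

definition sweep_loop :: "rexp \<Rightarrow> com" where
  "sweep_loop f =
    While (BAnd (BNot (NLess (NVar ''m'') (NVar ''vol'')))
        (RLess (RMul (RVar ''phi'') (RNat (NVar ''vol''))) (RNat (NVar ''cut''))))
     (RAssign ''tau'' (RSub (RVar ''tau'')
        (RDiv (RMul (rconst 6) (RVar ''alpha'')) (RMul (RVar ''phi'') f))) ;;
      scan)"

text \<open>The thresholds of the top sweep never fall below average plus \<open>eps\<close>.
  Restricting the scans to vertices of this density loses nothing and bounds the scanned volume by
  \<open>1 / eps\<close>.\<close>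

definition select_pushed :: com where
  "select_pushed =
    NAssign ''i'' (NConst 0) ;; NAssign ''dn'' (NConst 0) ;;
    While (NLess (NVar ''i'') (NVar ''np''))
     (NAssign ''v'' (NArr ''P'' (NVar ''i'')) ;; incr ''i'' ;;
      Cond (RLess (RArr ''p'' (NVar ''v''))
          (RMul (RAdd (RDiv (rconst 1) (RMul (rconst 2) (RNat (NVar ''m'')))) (RVar ''eps''))
            (RNat (degree_exp (NVar ''v'')))))
        Skip
        (NStore ''D'' (NVar ''dn'') (NVar ''v'') ;; incr ''dn''))"

text \<open>The sweep starts at average plus three \<open>eps\<close>: two of them may be used up by
  the lowering of the threshold, and the last one provides the excess.\<close>

definition top_sweep :: com where
  "top_sweep =
    select_pushed ;;
    RAssign ''tau'' (RAdd (RDiv (rconst 1) (RMul (rconst 2) (RNat (NVar ''m''))))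
      (RMul (rconst 3) (RVar ''eps''))) ;;
    scan ;;
    Cond (NLess (NVar ''vol'') (NVar ''K'')) Skip
     (sweep_loop (RNat (NVar ''vol'')) ;;
      Cond (NLess (NVar ''m'') (NVar ''vol'')) Skip (NAssign ''case'' (NConst 1)))"

text \<open>For the bottom sweep the settled mass is negated, which makes it a sweep from the top.\<close>

definition select_all :: com where
  "select_all =
    NAssign ''i'' (NConst 0) ;;
    While (NLess (NVar ''i'') (NVar ''n''))
     (NStore ''D'' (NVar ''i'') (NVar ''i'') ;;
      RStore ''p'' (NVar ''i'') (RSub (rconst 0) (RArr ''p'' (NVar ''i''))) ;;
      incr ''i'') ;;
    NAssign ''dn'' (NVar ''n'')"

text \<open>Settled mass underestimates the limit, so an empty set at the starting level already
  certifies that no vertex has small density.\<close>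

definition bottom_sweep :: com where
  "bottom_sweep =
    select_all ;;
    RAssign ''tau'' (RDiv (RSub (RVar ''gamma'') (rconst 1)) (RMul (rconst 2) (RNat (NVar ''m'')))) ;;
    scan ;;
    Cond (NLess (NConst 0) (NVar ''vol''))
     (sweep_loop (RNat (NVar ''m'')) ;;
      Cond (NLess (NVar ''m'') (NVar ''vol'')) Skip (NAssign ''case'' (NConst 2)))
     (NAssign ''case'' (NConst 3))"

lemmas loop_defs = list_loop_def push_loop_def push_vertex_def register_vertex_def edge_loop_def
  scan_def scan_loop_def scan_vertex_def cut_loop_def sweep_loop_def select_pushed_def select_all_def

section \<open>Verification of scans and of the sweep loop\<close>

context pagerank_input
begin

lemma cut_loop:
  assumes inp: "input s" and u: "u < n"
    and ab: "nvar s ''a'' = narr s ''off'' u" "nvar s ''b'' = narr s ''off'' u + deg G u"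
    and S: "S = superlevel (rarr s ''p'') (rvar s ''tau'')"
  shows "wp cut_loop (\<lambda>t s'. nvar s' ''cut'' = nvar s ''cut'' + length (filter (\<lambda>w. w \<notin> S) (A ! u)) \<and>
    t \<le> 60 * deg G u + 4) s"
  unfolding cut_loop_def
proof (rule wp_While[where \<mu> = "\<lambda>s. nvar s ''b'' - nvar s ''a''" and I = "\<lambda>t s'. \<exists>j \<le> deg G u.
    nvar s' ''a'' = narr s ''off'' u + j \<and> nvar s' ''b'' = nvar s ''b'' \<and> input s' \<and>
    rarr s' ''p'' = rarr s ''p'' \<and> rvar s' ''tau'' = rvar s ''tau'' \<and>
    nvar s' ''cut'' = nvar s ''cut'' + length (filter (\<lambda>w. w \<notin> S) (take j (A ! u))) \<and> t \<le> 60 * j"],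
    goal_cases)
  case 1
  then show ?case using ab inp by (intro exI[of _ 0]) simp
next
  case (2 t s')
  then obtain j where j: "j \<le> deg G u" "nvar s' ''a'' = narr s ''off'' u + j"
    "nvar s' ''b'' = nvar s ''b''" "rarr s' ''p'' = rarr s ''p''" "rvar s' ''tau'' = rvar s ''tau''"
    "nvar s' ''cut'' = nvar s ''cut'' + length (filter (\<lambda>w. w \<notin> S) (take j (A ! u)))"
    and t: "t \<le> 60 * j" and inp': "input s'"
    by auto
  have off: "narr s' ''off'' = narr s ''off''" using inp inp' by (simp add: input_def)
  have j_less: "j < deg G u" using 2(2) j ab by simp
  have w: "narr s' ''adj'' (narr s ''off'' u + j) = A ! u ! j"
    using input_adj[OF inp' u j_less] off by simp
  have take: "take (Suc j) (A ! u) = take j (A ! u) @ [A ! u ! j]"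
    using j_less length_A[OF u] by (simp add: take_Suc_conv_app_nth)
  have wV: "A ! u ! j \<in> V" using set_A[OF u] j_less length_A[OF u] by auto
  then have wn: "A ! u ! j < n" by (simp add: V_eq)
  have "A ! u ! j \<in> S \<longleftrightarrow> rvar s ''tau'' * d (A ! u ! j) \<le> rarr s ''p'' (A ! u ! j)"
    using wV by (simp add: S superlevel_def)
  then show ?case
    using j_less t inp' input_off_Suc[OF inp' wn]
    apply (simp add: wp_simps j w take ab not_le[symmetric])
    apply (intro conjI impI exI[of _ "Suc j"])
    by (simp_all add: take input_def diff_less_mono2)
next
  case (3 t s')
  then show ?case using ab length_A[OF u] by auto
qed

definition candidates :: "state \<Rightarrow> nat list" where
  "candidates s = array_list (narr s ''D'') (nvar s ''dn'')"

definition scanned :: "state \<Rightarrow> bool" where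
  "scanned s \<longleftrightarrow> output_set s = superlevel (rarr s ''p'') (rvar s ''tau'') \<and>
    real (nvar s ''vol'') = superlevel_vol (rarr s ''p'') (rvar s ''tau'') \<and>
    real (nvar s ''cut'') = superlevel_cut (rarr s ''p'') (rvar s ''tau'')"

definition scan_state :: "nat set \<Rightarrow> nat list \<Rightarrow> state \<Rightarrow> bool" where
  "scan_state S xs s \<longleftrightarrow>
    array_list (narr s ''T'') (nvar s ''size'') = filter (\<lambda>v. v \<in> S) xs \<and>
    nvar s ''vol'' = sum_list (map (deg G) (filter (\<lambda>v. v \<in> S) xs)) \<and>
    nvar s ''cut'' = sum_list (map (\<lambda>v. length (filter (\<lambda>w. w \<notin> S) (A ! v))) (filter (\<lambda>v. v \<in> S) xs))"

lemma scan_vertex: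
  assumes inp: "input s" and v: "nvar s ''v'' = v" "v < n"
    and S: "S = superlevel (rarr s ''p'') (rvar s ''tau'')" and st: "scan_state S xs s"
  shows "wp scan_vertex (\<lambda>t s'. scan_state S (xs @ [v]) s' \<and> t \<le> 100 * deg G v) s"
proof -
  have mem: "v \<in> S \<longleftrightarrow> rvar s ''tau'' * d v \<le> rarr s ''p'' v"
    using v by (simp add: S superlevel_def V_eq)
  have deg: "0 < deg G v" using v deg_pos by (simp add: V_eq)
  show ?thesis
  proof (cases "v \<in> S")
    case False
    then show ?thesis
      using mem v deg input_off_Suc[OF inp v(2)] st
      by (simp add: scan_vertex_def wp_simps scan_state_def)
  next
    case True
    then show ?thesis
      using mem v deg input_off_Suc[OF inp v(2)] st
      apply (simp add: scan_vertex_def wp_simps)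
      apply (rule wp_frame[OF cut_loop[where u = v and S = S]])
      using inp S
      by (simp_all add: input_def frame_def cut_loop_def scan_state_def)
  qed
qed

text \<open>As the superlevel set lies among the candidates, filtering them yields all of it.
  Degrees are positive, so the constant cost per vertex is absorbed by the volume.\<close>

lemma scan:
  assumes inp: "input s" and D: "distinct (candidates s)" "set (candidates s) \<subseteq> V"
    and sub: "superlevel (rarr s ''p'') (rvar s ''tau'') \<subseteq> set (candidates s)"
  shows "wp scan (\<lambda>t s'. scanned s' \<and> real t \<le> 120 * real (vol G (set (candidates s))) + 20) s"
proof -
  define S where "S = superlevel (rarr s ''p'') (rvar s ''tau'')"
  define Ds where "Ds = candidates s"
  note D = D[folded Ds_def] and sub = sub[folded Ds_def]
  let ?I = "\<lambda>t s'. input s' \<and> rarr s' ''p'' = rarr s ''p'' \<and> rvar s' ''tau'' = rvar s ''tau'' \<and>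
      candidates s' = Ds \<and> nvar s' ''i'' \<le> length Ds \<and> nvar s' ''dn'' = length Ds \<and>
      scan_state S (take (nvar s' ''i'') Ds) s' \<and>
      t \<le> 120 * sum_list (map (deg G) (take (nvar s' ''i'') Ds))"
  have "wp scan_loop
      (\<lambda>t s'. scan_state S Ds s' \<and> t \<le> 120 * sum_list (map (deg G) Ds) + 4 \<and>
        rarr s' ''p'' = rarr s ''p'' \<and> rvar s' ''tau'' = rvar s ''tau'') s0"
    if "?I 0 s0" for s0
    unfolding scan_loop_def
  proof (rule wp_While[where \<mu> = "\<lambda>s. nvar s ''dn'' - nvar s ''i''" and I = ?I], goal_cases)
    case 1
    show ?case by (rule that)
  next
    case (2 t s')
    let ?i = "nvar s' ''i''"
    define v where "v = Ds ! ?i"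
    have i: "?i < length Ds" using 2 by simp
    have D_nth: "narr s' ''D'' ?i = v"
      using 2 i by (metis candidates_def nth_array_list v_def)
    have D_eq: "array_list (narr s' ''D'') (length Ds) = Ds" using 2 by (metis candidates_def)
    have v: "v < n" using i D(2) nth_mem V_eq unfolding v_def by blast
    have take: "take (Suc ?i) Ds = take ?i Ds @ [v]"
      using i by (simp add: take_Suc_conv_app_nth v_def)
    have deg: "0 < deg G v" using v deg_pos by (simp add: V_eq)
    show ?case
      using 2 i
      apply (simp add: wp_simps D_nth)
      apply (rule wp_frame[OF scan_vertex[where v = v and S = S and xs = "take ?i Ds"]])
           apply (simp add: input_def)
          apply simp
         apply (simp add: v)
        apply (simp add: S_def)
       apply (simp add: scan_state_def)
      using deg D_eq
      by (simp add: frame_def scan_vertex_def cut_loop_def input_def candidates_def take diff_less_mono2)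
  next
    case (3 t s')
    then show ?case by auto
  qed
  note loop = this
  have final: "scanned s'" if st: "scan_state S Ds s'"
    and same: "rarr s' ''p'' = rarr s ''p''" "rvar s' ''tau'' = rvar s ''tau''" for s'
  proof -
    let ?F = "filter (\<lambda>v. v \<in> S) Ds"
    have F: "distinct ?F" "set ?F = S" using D(1) sub by (auto simp: S_def)
    have "output_set s' = set (array_list (narr s' ''T'') (nvar s' ''size''))"
      by (simp add: output_set_def array_list_def atLeast0LessThan)
    then have "output_set s' = S" using st F by (simp add: scan_state_def)
    moreover have "nvar s' ''vol'' = vol G S"
      using st F sum_list_distinct_conv_sum_set[OF F(1), of "deg G"] by (simp add: scan_state_def vol_def)
    moreover have "nvar s' ''cut'' = size (boundary G S)"
    proof -
      have "nvar s' ''cut'' = (\<Sum>v\<in>S. length (filter (\<lambda>w. w \<notin> S) (A ! v)))"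
        using st F sum_list_distinct_conv_sum_set[OF F(1)] by (simp add: scan_state_def)
      also have "\<dots> = (\<Sum>v\<in>S. \<Sum>w\<in>V - S. adjacency G v w)"
      proof (rule sum.cong)
        fix v assume "v \<in> S"
        then have "v < n" using superlevel_subset[of "rarr s ''p''" "rvar s ''tau''"] by (auto simp: S_def V_eq)
        then show "length (filter (\<lambda>w. w \<notin> S) (A ! v)) = (\<Sum>w\<in>V - S. adjacency G v w)"
          by (rule length_filter_A)
      qed simp
      also have "\<dots> = size (boundary G S)"
        unfolding S_def by (simp add: size_boundary_eq_sum[OF multigraph_G superlevel_subset])
      finally show ?thesis .
    qed
    ultimately show ?thesis
      by (simp add: scanned_def same superlevel_vol_def superlevel_cut_def S_def)
  qed
  have "sum_list (map (deg G) Ds) = vol G (set Ds)"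
    using sum_list_distinct_conv_sum_set[OF D(1), of "deg G"] by (simp add: vol_def)
  then show ?thesis
    using inp
    apply (simp add: scan_def wp_simps)
    apply (rule wp_mono[OF loop])
     apply (simp add: input_def candidates_def scan_state_def Ds_def)
    using final by (auto simp: Ds_def)
qed


lemma superlevel_cut_le: "superlevel_cut g \<tau> \<le> superlevel_vol g \<tau>"
proof -
  let ?S = "superlevel g \<tau>"
  have "(\<Sum>u\<in>?S. \<Sum>w\<in>V - ?S. adjacency G u w) \<le> (\<Sum>u\<in>?S. deg G u)"
  proof (rule sum_mono)
    fix u assume "u \<in> ?S"
    then have "u \<in> V" using superlevel_subset by auto
    then show "(\<Sum>w\<in>V - ?S. adjacency G u w) \<le> deg G u"
      using finite_V by (simp add: deg_eq_sum[OF multigraph_G] sum_mono2)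
  qed
  then show ?thesis
    unfolding superlevel_cut_def superlevel_vol_def of_nat_le_iff
    by (simp add: size_boundary_eq_sum[OF multigraph_G superlevel_subset] vol_def)
qed

text \<open>A rule for both sweeps: \<open>R\<close> is the invariant supplied by the caller, with
  \<open>j\<close> the number of rounds so far, and \<open>\<delta>\<close> the lowering of the
  threshold. Whoever bounds \<open>j\<close> obtains the running time.\<close>

lemma sweep_loop:
  assumes s: "input s" "scanned s" "rvar s ''phi'' = \<phi>" "rarr s ''p'' = g"
    and D: "distinct (candidates s)" "set (candidates s) \<subseteq> V"
    and R0: "R 0 (rvar s ''tau'')"
    and step: "\<And>j \<tau>. R j \<tau> \<Longrightarrow> superlevel_vol g \<tau> \<le> real m \<Longrightarrow>
      \<phi> * superlevel_vol g \<tau> < superlevel_cut g \<tau> \<Longrightarrow>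
      R (Suc j) (\<tau> - \<delta> \<tau>) \<and> superlevel_vol g \<tau> < superlevel_vol g (\<tau> - \<delta> \<tau>) \<and>
      superlevel g (\<tau> - \<delta> \<tau>) \<subseteq> set (candidates s)"
    and f: "\<And>s'. input s' \<Longrightarrow> scanned s' \<Longrightarrow> rarr s' ''p'' = g \<Longrightarrow>
      6 * \<alpha> / (\<phi> * rval f s') = \<delta> (rvar s' ''tau'')"
  shows "wp (sweep_loop f) (\<lambda>t s'. scanned s' \<and> (\<exists>j. R j (rvar s' ''tau'') \<and>
      real t \<le> real j * (120 * real (vol G (set (candidates s))) + real (rcost f) + 60) + 60) \<and>
      (nvar s' ''vol'' \<le> m \<longrightarrow> real (nvar s' ''cut'') \<le> \<phi> * real (nvar s' ''vol''))) s"
  unfolding sweep_loop_def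
\<comment> \<open>The volume grows strictly in every round and is at most
  \<open>2 * m\<close>.\<close>
proof (rule wp_While[where \<mu> = "\<lambda>s. Suc (2 * m) - nvar s ''vol''" and
    I = "\<lambda>t s'. input s' \<and> scanned s' \<and> rvar s' ''phi'' = \<phi> \<and> rarr s' ''p'' = g \<and>
      candidates s' = candidates s \<and> (\<exists>j. R j (rvar s' ''tau'') \<and>
      real t \<le> real j * (120 * real (vol G (set (candidates s))) + real (rcost f) + 60))"], goal_cases)
  case 1
  show ?case using s R0 by (auto intro: exI[of _ 0])
next
  case (2 t s')
  let ?c = "120 * real (vol G (set (candidates s))) + real (rcost f) + 60"
  let ?\<tau> = "rvar s' ''tau''"
  from 2 obtain j where j: "R j ?\<tau>" "real t \<le> real j * ?c" by auto
  have vol: "real (nvar s' ''vol'') = superlevel_vol g ?\<tau>" "real (nvar s' ''cut'') = superlevel_cut g ?\<tau>"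
    using 2 by (auto simp: scanned_def)
  have next_j: "R (Suc j) (?\<tau> - \<delta> ?\<tau>)" "superlevel_vol g ?\<tau> < superlevel_vol g (?\<tau> - \<delta> ?\<tau>)"
      "superlevel g (?\<tau> - \<delta> ?\<tau>) \<subseteq> set (candidates s)"
    using step[OF j(1)] 2 vol by (auto simp: inputD not_less)
  let ?s = "s'\<lparr>rvar := (rvar s')(''tau'' := ?\<tau> - \<delta> ?\<tau>)\<rparr>"
  have \<delta>: "6 * rvar s' ''alpha'' / (\<phi> * rval f s') = \<delta> ?\<tau>"
    using 2 f[of s'] by (auto simp: inputD)
  have cand: "candidates ?s = candidates s" using 2 by (simp add: candidates_def)
  have "wp scan (\<lambda>u s''. (input s'' \<and> scanned s'' \<and> rvar s'' ''phi'' = \<phi> \<and> rarr s'' ''p'' = g \<and>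
      candidates s'' = candidates s \<and> (\<exists>j. R j (rvar s'' ''tau'') \<and>
      40 + real (rcost f) + real t + real u \<le> real j * ?c)) \<and>
      Suc (2 * m) - nvar s'' ''vol'' < Suc (2 * m) - nvar s' ''vol'') ?s"
  proof (rule wp_frame[OF scan], goal_cases)
    case 1
    then show ?case using 2 by (simp add: input_def)
  next
    case 4
    then show ?case unfolding cand using 2 next_j by simp
  next
    case (5 u s'')
    have fr: "input s''" "rvar s'' ''phi'' = \<phi>" "rarr s'' ''p'' = g" "candidates s'' = candidates s"
      "rvar s'' ''tau'' = ?\<tau> - \<delta> ?\<tau>"
      using 5(2) 2 by (auto simp: frame_def loop_defs input_def candidates_def)
    have "superlevel_vol g (?\<tau> - \<delta> ?\<tau>) \<le> 2 * real m"
      unfolding superlevel_vol_def using vol_mono[OF finite_V superlevel_subset] vol_verts[OF multigraph_G]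
      by (metis of_nat_le_iff of_nat_mult of_nat_numeral)
    then have "nvar s'' ''vol'' \<le> 2 * m" "nvar s' ''vol'' < nvar s'' ''vol''"
      using 5(1) fr vol next_j(2) by (auto simp: scanned_def)
    moreover have "40 + real (rcost f) + real t + real u \<le> real (Suc j) * ?c"
      using j(2) 5(1) unfolding cand by (simp add: algebra_simps)
    ultimately show ?case using fr 5(1) next_j(1) by auto
  qed (simp_all only: cand D)
  then show ?case
    using 2
    apply (simp add: wp_simps \<delta>)
    apply (erule wp_mono)
    by (force intro: order_trans)
next
  case (3 t s')
  then show ?case by (auto simp: inputD not_less)
qed

end

section \<open>The algorithm\<close>

text \<open>Computes \<open>l\<close>, the number of binary digits of \<open>m\<close>, by doubling
  a power of two.\<close>

definition pow_loop :: com where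
  "pow_loop =
    While (BNot (NLess (NVar ''m'') (NVar ''pow'')))
     (incr ''l'' ;; NAssign ''pow'' (NAdd (NVar ''pow'') (NVar ''pow'')))"

text \<open>A square root up to a factor of 2, by halving from 1: unless \<open>\<phi>\<close> stays
  1, it ends between the root of \<open>goal\<close> and twice this root.\<close>

definition phi_loop :: com where
  "phi_loop =
    While (BNot (RLess (RMul (RDiv (RVar ''phi'') (rconst 2)) (RDiv (RVar ''phi'') (rconst 2))) (RVar ''goal'')))
     (RAssign ''phi'' (RDiv (RVar ''phi'') (rconst 2)))"

definition prepare :: com where
  "prepare =
    NAssign ''l'' (NConst 1) ;; NAssign ''pow'' (NConst 2) ;;
    pow_loop ;;
    RAssign ''goal'' (RDiv (RMul (RMul (rconst 576) (RVar ''alpha'')) (RNat (NVar ''l''))) (RVar ''gamma'')) ;;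
    RAssign ''phi'' (rconst 1) ;;
    phi_loop ;;
    NAssign ''K'' (NConst 1)"

text \<open>Pushing continues from the state of the previous scale, because the top sweep leaves
  settled and residual mass alone. The scale with \<open>l * K \<ge> m\<close> is the last, and its
  state is handed to the bottom sweep.\<close>

definition scale_step :: com where
  "scale_step =
    RAssign ''eps'' (RDiv (RVar ''gamma'')
      (RMul (rconst 64) (RMul (RNat (NVar ''l'')) (RNat (NVar ''K''))))) ;;
    push_phase ;;
    top_sweep ;;
    Cond (RLess (RMul (RNat (NVar ''l'')) (RNat (NVar ''K''))) (RNat (NVar ''m'')))
      (NAssign ''K'' (NAdd (NVar ''K'') (NVar ''K'')))
      (NAssign ''last'' (NConst 1))"

definition scale_loop :: com where
  "scale_loop =
    While (BAnd (NLess (NVar ''case'') (NConst 1)) (NLess (NVar ''last'') (NConst 1))) scale_step"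

definition program :: com where
  "program = prepare ;; scale_loop ;; Cond (NLess (NVar ''case'') (NConst 1)) bottom_sweep Skip"

section \<open>Thresholds, invariants and outcomes of the sweeps\<close>

locale sweep_params = pagerank_input +
  fixes l :: nat and \<phi> :: real
  assumes l: "0 < l" "2 ^ (l - 1) \<le> m" "m < 2 ^ l"
    and phi: "0 < \<phi>" "\<phi> \<le> 1" "\<phi> < 1 \<Longrightarrow> 576 * \<alpha> * real l / \<gamma> \<le> \<phi>\<^sup>2"
begin

abbreviation q :: "nat \<Rightarrow> real" where "q \<equiv> PR G \<alpha> p0"
abbreviation avg :: real where "avg \<equiv> 1 / (2 * real m)"

text \<open>The residual threshold of scale \<open>K\<close>. Four of them make up the level
  \<open>\<gamma> / (16 * l * K)\<close> above average that occurs in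
  \<open>dyadic_scales\<close>.\<close>

definition threshold :: "nat \<Rightarrow> real" where
  "threshold K = \<gamma> / (64 * (real l * real K))"

lemma threshold_pos: "0 < K \<Longrightarrow> 0 < threshold K"
  using gamma l by (simp add: threshold_def)

lemma threshold_le_1: "0 < K \<Longrightarrow> threshold K \<le> 1"
proof -
  assume "0 < K"
  then have "1 * 1 \<le> real l * real K" using l by (intro mult_mono) auto
  then show ?thesis using gamma by (simp add: threshold_def divide_le_eq)
qed

lemma phi_bound: "\<phi> < 1 \<Longrightarrow> 576 * \<alpha> * real l \<le> \<gamma> * \<phi>\<^sup>2"
  using phi(3) gamma by (simp add: pos_divide_le_eq mult.commute)

text \<open>From \<open>j * \<phi> \<le> 4 * l\<close> and \<open>\<phi> \<le> l\<close> follows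
  \<open>Suc j * \<phi> \<le> 5 * l\<close>, where \<open>Suc j\<close> includes the round about to
  be made. The lower bound on \<open>\<phi>\<^sup>2\<close> then limits both the rounds and the
  total lowering in the bottom sweep.\<close>

lemma iteration_bound:
  assumes j: "real j * \<phi> / 4 \<le> log 2 x" and x: "0 < x" "x \<le> real m" and phi1: "\<phi> < 1"
  shows "real (Suc j) \<le> 1 / \<alpha>" "real (Suc j) * (6 * \<alpha> / (\<phi> * real m)) \<le> \<gamma> / (16 * real m)"
proof -
  have "log 2 x \<le> log 2 (2 ^ l)"
    using x l(3) by (intro log_mono) (auto simp flip: of_nat_less_iff intro: order_trans less_imp_le)
  then have "real j * \<phi> \<le> 4 * real l" using j by (simp add: log_nat_power)
  moreover have "\<phi> \<le> real l" by (rule order_trans[OF phi(2)]) (use l(1) in simp)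
  ultimately have J: "real (Suc j) * \<phi> \<le> 5 * real l" by (simp add: algebra_simps)
  have key: "576 * \<alpha> * real l \<le> \<gamma> * \<phi>\<^sup>2" by (rule phi_bound[OF phi1])
  have "\<gamma> * \<phi>\<^sup>2 \<le> 1 * (\<phi> * 1)" unfolding power2_eq_square using gamma phi by (intro mult_mono) auto
  moreover have "0 \<le> \<alpha> * real l" using alpha by simp
  ultimately have "\<alpha> * (5 * real l) \<le> \<phi>" using key by simp
  moreover have "\<alpha> * (real (Suc j) * \<phi>) \<le> \<alpha> * (5 * real l)" using J alpha by (intro mult_left_mono) auto
  ultimately have "(\<alpha> * real (Suc j)) * \<phi> \<le> 1 * \<phi>" by (simp add: mult_ac)
  then have "\<alpha> * real (Suc j) \<le> 1" using phi(1) by (rule mult_right_le_imp_le)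
  then show "real (Suc j) \<le> 1 / \<alpha>" using alpha by (simp add: pos_le_divide_eq mult.commute)
  have "real (Suc j) * \<phi> * (6 * \<alpha>) \<le> 5 * real l * (6 * \<alpha>)" using J alpha by (intro mult_right_mono) auto
  also have "\<dots> = 30 * (\<alpha> * real l)" by simp
  also have "\<dots> \<le> \<gamma> * \<phi>\<^sup>2 / 16" using key \<open>0 \<le> \<alpha> * real l\<close> unfolding mult.assoc by linarith
  finally have "(real (Suc j) * (6 * \<alpha>)) * \<phi> \<le> (\<gamma> * \<phi> / 16) * \<phi>" by (simp add: power2_eq_square mult_ac)
  then have "real (Suc j) * (6 * \<alpha>) \<le> \<gamma> * \<phi> / 16" using phi(1) by (rule mult_right_le_imp_le)
  then have "real (Suc j) * (6 * \<alpha>) / (\<phi> * real m) \<le> \<gamma> * \<phi> / 16 / (\<phi> * real m)"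
    using phi m_pos by (intro divide_right_mono) auto
  also have "\<dots> = \<gamma> / (16 * real m)" using phi by simp
  finally show "real (Suc j) * (6 * \<alpha> / (\<phi> * real m)) \<le> \<gamma> / (16 * real m)" by simp
qed

text \<open>Expressed by the limit \<open>q\<close> and not by the settled mass, so that it stays
  valid while later scales push further.\<close>

definition scale_fails :: "nat \<Rightarrow> bool" where
  "scale_fails K \<longleftrightarrow> superlevel_vol q (avg + \<gamma> / (16 * real l * real K)) < real K \<or>
    real m < superlevel_vol q avg"

text \<open>Nonemptiness and the volume bound give both sides positive volume, so the quotient in
  \<open>conductance\<close> is meaningful.\<close>

definition found :: "nat set \<Rightarrow> bool" where
  "found T \<longleftrightarrow> T \<subseteq> V \<and> T \<noteq> {} \<and> vol G T \<le> m \<and> conductance G T \<le> \<phi>"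

definition top_found :: "nat \<Rightarrow> nat set \<Rightarrow> bool" where
  "top_found K T \<longleftrightarrow> found T \<and> K \<le> vol G T \<and> \<gamma> / (64 * real l) \<le> excess G q T"

definition small :: "nat set" where
  "small = {u \<in> V. mass_density G q u \<le> (1 - \<gamma>) / (2 * real m)}"

lemma found_superlevel:
  assumes pos: "0 < superlevel_vol g \<tau>" and le: "superlevel_vol g \<tau> \<le> real m"
    and cut: "superlevel_cut g \<tau> \<le> \<phi> * superlevel_vol g \<tau>"
  shows "found (superlevel g \<tau>)"
proof -
  let ?S = "superlevel g \<tau>"
  have vol: "vol G ?S \<le> m" "0 < vol G ?S" using pos le by (auto simp: superlevel_vol_def)
  have "?S \<union> (V - ?S) = V" using superlevel_subset by auto
  then have "vol G ?S + vol G (V - ?S) = 2 * m"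
    using vol_Un_disjoint[of ?S "V - ?S" G] finite_V vol_verts[OF multigraph_G] by auto
  then have "min (vol G ?S) (vol G (V - ?S)) = vol G ?S" using vol by simp
  then have "conductance G ?S = superlevel_cut g \<tau> / superlevel_vol g \<tau>"
    by (simp add: conductance_def superlevel_cut_def superlevel_vol_def)
  then have "conductance G ?S \<le> \<phi>" using cut pos by (simp add: pos_divide_le_eq)
  then show ?thesis using vol superlevel_subset vol_pos_iff[OF superlevel_subset] by (auto simp: found_def)
qed

text \<open>A cut is never larger than its volume, so rounds only happen if \<open>\<phi> < 1\<close>.\<close>

definition top_inv :: "(nat \<Rightarrow> real) \<Rightarrow> nat \<Rightarrow> nat \<Rightarrow> real \<Rightarrow> bool" where
  "top_inv p K j \<tau> \<longleftrightarrow> real K \<le> superlevel_vol p \<tau> \<and> avg + threshold K \<le> \<tau> \<and> real j \<le> 1 / \<alpha> \<and>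
    (\<phi> < 1 \<longrightarrow> avg + threshold K + 18 * \<alpha> / \<phi>\<^sup>2 * (1 / superlevel_vol p \<tau>) \<le> \<tau> \<and>
      real j * \<phi> / 4 \<le> log 2 (superlevel_vol p \<tau>))"

text \<open>Here the constants meet: at volume at least \<open>K\<close> the potential is at most
  \<open>18 * \<alpha> / (\<phi>\<^sup>2 * K)\<close>, and \<open>18 * 32 = 576\<close> makes this
  at most \<open>\<gamma> / (32 * l * K)\<close>, which is two thresholds.\<close>

lemma top_inv_init:
  assumes K: "0 < K" "real K \<le> superlevel_vol p (avg + 3 * threshold K)"
  shows "top_inv p K 0 (avg + 3 * threshold K)"
proof -
  let ?v = "superlevel_vol p (avg + 3 * threshold K)"
  have "18 * \<alpha> / \<phi>\<^sup>2 * (1 / ?v) \<le> 2 * threshold K" if "\<phi> < 1"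
  proof -
    have "18 * \<alpha> / \<phi>\<^sup>2 * (1 / ?v) \<le> 18 * \<alpha> / \<phi>\<^sup>2 * (1 / real K)"
      using K alpha by (intro mult_left_mono divide_left_mono) auto
    also have "\<dots> \<le> \<gamma> / (32 * real l) * (1 / real K)"
      using phi_bound[OF that] phi l by (intro mult_right_mono) (simp_all add: divide_simps mult_ac)
    also have "\<dots> = 2 * threshold K" by (simp add: threshold_def)
    finally show ?thesis .
  qed
  moreover have "0 \<le> log 2 ?v" using K by simp
  ultimately show ?thesis using K threshold_pos[OF K(1)] alpha by (simp add: top_inv_def)
qed

text \<open>The drop of the potential pays for the lower threshold, and the growth of the logarithm
  of the volume pays for the round.\<close>

lemma top_inv_step:
  assumes p: "consistent p r" "\<forall>v\<in>V. 0 \<le> p v \<and> 0 \<le> r v" and K: "0 < K"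
    and inv: "top_inv p K j \<tau>" and le: "superlevel_vol p \<tau> \<le> real m"
    and cut: "\<phi> * superlevel_vol p \<tau> < superlevel_cut p \<tau>"
  shows "top_inv p K (Suc j) (\<tau> - 6 * \<alpha> / (\<phi> * superlevel_vol p \<tau>))"
    "superlevel_vol p \<tau> < superlevel_vol p (\<tau> - 6 * \<alpha> / (\<phi> * superlevel_vol p \<tau>))"
proof -
  let ?v = "superlevel_vol p \<tau>" and ?\<tau>' = "\<tau> - 6 * \<alpha> / (\<phi> * superlevel_vol p \<tau>)"
  let ?v' = "superlevel_vol p ?\<tau>'"
  have v: "0 < ?v" using inv K by (simp add: top_inv_def)
  have "\<phi> * ?v < 1 * ?v" using cut superlevel_cut_le[of p \<tau>] by simp
  then have phi1: "\<phi> < 1" using v by simp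
  have growth: "(1 + \<phi> / 2) * ?v \<le> ?v'" by (rule top_sweep_step[OF p phi(1) v cut])
  moreover have "0 < \<phi> * ?v" using phi v by simp
  ultimately show less: "?v < ?v'" by (simp add: algebra_simps)
  have "6 * \<alpha> / (\<phi> * ?v) \<le> 18 * \<alpha> / \<phi>\<^sup>2 * (1 / ?v - 1 / ?v')"
    by (rule sweep_potential[OF alpha(1) phi(1,2) v growth])
  then have pot: "avg + threshold K + 18 * \<alpha> / \<phi>\<^sup>2 * (1 / ?v') \<le> ?\<tau>'"
  proof -
    have "avg + threshold K + 18 * \<alpha> / \<phi>\<^sup>2 * (1 / ?v) \<le> \<tau>"
      using inv phi1 unfolding top_inv_def by blast
    then show ?thesis
      using \<open>6 * \<alpha> / (\<phi> * ?v) \<le> _\<close> unfolding right_diff_distrib by linarith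
  qed
  have "0 \<le> 18 * \<alpha> / \<phi>\<^sup>2 * (1 / ?v')" using alpha v less by simp
  moreover have "real (Suc j) * \<phi> / 4 \<le> log 2 ?v'"
    using inv phi1 log2_growth[OF phi(1,2) v growth] by (simp add: top_inv_def algebra_simps)
  moreover have "real (Suc j) \<le> 1 / \<alpha>"
    using inv phi1 by (intro iteration_bound(1)[OF _ v le phi1]) (simp add: top_inv_def)
  ultimately show "top_inv p K (Suc j) ?\<tau>'"
    using inv less pot by (simp add: top_inv_def)
qed

text \<open>Every vertex of the set exceeds the average density by at least
  \<open>threshold K\<close>, and the volume is at least \<open>K\<close>; the product is
  \<open>\<gamma> / (64 * l)\<close>.\<close>

lemma top_found_superlevel:
  assumes inv: "top_inv p K j \<tau>" and K: "0 < K" and p: "\<And>v. v \<in> V \<Longrightarrow> p v \<le> q v"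
    and le: "superlevel_vol p \<tau> \<le> real m" and cut: "superlevel_cut p \<tau> \<le> \<phi> * superlevel_vol p \<tau>"
  shows "top_found K (superlevel p \<tau>)"
proof -
  let ?S = "superlevel p \<tau>"
  have K_le: "real K \<le> superlevel_vol p \<tau>" and \<tau>: "avg + threshold K \<le> \<tau>" using inv by (auto simp: top_inv_def)
  have "\<gamma> / (64 * real l) = threshold K * real K" using K by (simp add: threshold_def)
  also have "\<dots> \<le> threshold K * superlevel_vol p \<tau>"
    using K_le threshold_pos[OF K] by (intro mult_left_mono) auto
  also have "\<dots> = (\<Sum>v\<in>?S. (avg + threshold K) * d v) - avg * superlevel_vol p \<tau>"
    unfolding superlevel_vol_def vol_eq sum_distrib_left[symmetric] by (simp add: algebra_simps)
  also have "(\<Sum>v\<in>?S. (avg + threshold K) * d v) \<le> (\<Sum>v\<in>?S. q v)"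
  proof (rule sum_mono)
    fix v assume "v \<in> ?S"
    then have v: "v \<in> V" "\<tau> * d v \<le> p v" by (auto simp: superlevel_def)
    have "(avg + threshold K) * d v \<le> \<tau> * d v" using \<tau> by (intro mult_right_mono) auto
    then show "(avg + threshold K) * d v \<le> q v" using v p[OF v(1)] by simp
  qed
  finally have "\<gamma> / (64 * real l) \<le> excess G q ?S"
    by (simp add: excess_def mass_def superlevel_vol_def)
  then show ?thesis
    using found_superlevel[OF _ le cut] K K_le by (simp add: top_found_def superlevel_vol_def)
qed

text \<open>If the start is too small, then so is the set of \<open>q\<close> one threshold higher,
  since \<open>q\<close> exceeds \<open>p\<close> by at most that much. If the sweep passed volume
  \<open>m\<close>, then so does the set of \<open>q\<close> at average density, since
  \<open>p \<le> q\<close> and \<open>\<tau>\<close> is above average.\<close>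

lemma top_fails:
  assumes p: "\<And>v. v \<in> V \<Longrightarrow> p v \<le> q v" "\<And>v. v \<in> V \<Longrightarrow> q v \<le> p v + threshold K * d v"
    and K: "0 < K" and fail: "superlevel_vol p (avg + 3 * threshold K) < real K \<or>
      (\<exists>j. top_inv p K j \<tau>) \<and> real m < superlevel_vol p \<tau>"
  shows "scale_fails K"
proof -
  have "avg + \<gamma> / (16 * real l * real K) = avg + 4 * threshold K" by (simp add: threshold_def)
  moreover have "superlevel_vol q (avg + 4 * threshold K) \<le> superlevel_vol p (avg + 3 * threshold K)"
  proof (rule superlevel_vol_mono)
    fix v assume "v \<in> V" "(avg + 4 * threshold K) * d v \<le> q v"
    then show "(avg + 3 * threshold K) * d v \<le> p v" using p(2)[of v] by (simp add: algebra_simps)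
  qed
  moreover have "superlevel_vol p \<tau> \<le> superlevel_vol q avg" if "top_inv p K j \<tau>" for j
  proof (rule superlevel_vol_mono)
    fix v assume v: "v \<in> V" "\<tau> * d v \<le> p v"
    have "avg \<le> \<tau>" using that threshold_pos[OF K] by (simp add: top_inv_def)
    then have "avg * d v \<le> \<tau> * d v" by (intro mult_right_mono) auto
    then show "avg * d v \<le> q v" using v p(1)[of v] by simp
  qed
  ultimately show ?thesis using fail by (force simp: scale_fails_def)
qed

text \<open>The step length is constant, so the level is known exactly from the number of rounds.
  The levels belong to \<open>- p\<close>: lowering them admits larger densities.\<close>

definition bottom_inv :: "(nat \<Rightarrow> real) \<Rightarrow> nat \<Rightarrow> real \<Rightarrow> bool" where
  "bottom_inv g j \<tau> \<longleftrightarrow> 0 < superlevel_vol g \<tau> \<and>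
    \<tau> = (\<gamma> - 1) / (2 * real m) - real j * (6 * \<alpha> / (\<phi> * real m)) \<and> real j \<le> 1 / \<alpha> \<and>
    real j * (6 * \<alpha> / (\<phi> * real m)) \<le> \<gamma> / (16 * real m) \<and>
    (\<phi> < 1 \<longrightarrow> real j * \<phi> / 4 \<le> log 2 (superlevel_vol g \<tau>))"

lemma bottom_inv_init:
  assumes "0 < superlevel_vol g ((\<gamma> - 1) / (2 * real m))"
  shows "bottom_inv g 0 ((\<gamma> - 1) / (2 * real m))"
proof -
  have "1 \<le> superlevel_vol g ((\<gamma> - 1) / (2 * real m))"
    using assms by (simp add: superlevel_vol_def)
  then show ?thesis using alpha gamma by (simp add: bottom_inv_def)
qed

text \<open>The budget of the bottom sweep: to the density \<open>(1 - \<gamma>) / (2 * m)\<close>,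
  the rounds add at most \<open>\<gamma> / (16 * m)\<close> and the residual threshold of the last
  scale at most \<open>\<gamma> / (64 * m)\<close>.\<close>

lemma bottom_inv_level:
  assumes "bottom_inv g j \<tau>" "real m \<le> real l * real K"
  shows "threshold K - \<tau> \<le> (1 - \<gamma> / 2) / (2 * real m)"
proof -
  have "threshold K = \<gamma> / 64 / (real l * real K)" by (simp add: threshold_def)
  also have "\<dots> \<le> \<gamma> / 64 / real m"
    using assms(2) gamma m_pos by (intro divide_left_mono) auto
  finally have "threshold K - \<tau> \<le> \<gamma> / 64 / real m - (\<gamma> - 1) / (2 * real m) + \<gamma> / (16 * real m)"
    using assms(1) by (simp add: bottom_inv_def)
  also have "\<dots> = (1 - \<gamma> * (27 / 32)) / (2 * real m)"
    using m_pos by (simp add: field_simps)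
  also have "\<dots> \<le> (1 - \<gamma> / 2) / (2 * real m)"
    using gamma by (intro divide_right_mono) auto
  finally show ?thesis .
qed

lemma bottom_inv_step:
  assumes p: "consistent p r" "\<forall>v\<in>V. r v \<le> threshold K * d v"
    and g: "g = (\<lambda>v. - p v)" and K: "real m \<le> real l * real K"
    and inv: "bottom_inv g j \<tau>" and le: "superlevel_vol g \<tau> \<le> real m"
    and cut: "\<phi> * superlevel_vol g \<tau> < superlevel_cut g \<tau>"
  shows "bottom_inv g (Suc j) (\<tau> - 6 * \<alpha> / (\<phi> * real m))"
    "superlevel_vol g \<tau> < superlevel_vol g (\<tau> - 6 * \<alpha> / (\<phi> * real m))"
proof -
  let ?v = "superlevel_vol g \<tau>" and ?\<tau>' = "\<tau> - 6 * \<alpha> / (\<phi> * real m)"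
  let ?v' = "superlevel_vol g ?\<tau>'"
  have v: "0 < ?v" using inv unfolding bottom_inv_def by blast
  have "\<phi> * ?v < 1 * ?v" using cut superlevel_cut_le[of g \<tau>] by simp
  then have phi1: "\<phi> < 1" using v by simp
  have "(1 - \<gamma> / 2) / (2 * real m) \<le> 2 / (2 * real m)"
    using gamma by (intro divide_right_mono) auto
  then have "threshold K - \<tau> \<le> 1 / real m" using bottom_inv_level[OF inv K] by simp
  then have growth: "(1 + \<phi> / 2) * ?v \<le> ?v'"
    using bottom_sweep_step[OF p phi(1)] v cut unfolding g by blast
  moreover have "0 < \<phi> * ?v" using phi v by simp
  ultimately show less: "?v < ?v'" by (simp add: algebra_simps)
  have j: "real j * \<phi> / 4 \<le> log 2 ?v" using inv phi1 unfolding bottom_inv_def by blast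
  have "real (Suc j) * \<phi> / 4 \<le> log 2 ?v'"
    using j log2_growth[OF phi(1,2) v growth] by (simp add: algebra_simps)
  moreover have "?\<tau>' = (\<gamma> - 1) / (2 * real m) - real (Suc j) * (6 * \<alpha> / (\<phi> * real m))"
  proof -
    have "\<tau> = (\<gamma> - 1) / (2 * real m) - real j * (6 * \<alpha> / (\<phi> * real m))"
      using inv unfolding bottom_inv_def by blast
    then show ?thesis by (simp add: distrib_right add_divide_distrib)
  qed
  ultimately show "bottom_inv g (Suc j) ?\<tau>'"
    using iteration_bound[OF j v le phi1] v less unfolding bottom_inv_def by auto
qed

text \<open>Vertices of small limit density are present at the starting level, because
  \<open>- p\<close> is at least \<open>- q\<close>, and the level only falls.\<close>

lemma bottom_small:
  assumes inv: "bottom_inv g j \<tau>" and g: "\<And>v. v \<in> V \<Longrightarrow> - q v \<le> g v"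
  shows "small \<subseteq> superlevel g \<tau>"
proof
  fix u assume u: "u \<in> small"
  then have uV: "u \<in> V" by (simp add: small_def)
  have "0 \<le> real j * (6 * \<alpha> / (\<phi> * real m))" using alpha phi by simp
  moreover have "\<tau> = (\<gamma> - 1) / (2 * real m) - real j * (6 * \<alpha> / (\<phi> * real m))"
    using inv unfolding bottom_inv_def by blast
  ultimately have "\<tau> \<le> (\<gamma> - 1) / (2 * real m)" by simp
  then have "\<tau> * d u \<le> (\<gamma> - 1) / (2 * real m) * d u" by (intro mult_right_mono) auto
  also have "\<dots> = - ((1 - \<gamma>) / (2 * real m) * d u)" by (simp add: algebra_simps diff_divide_distrib)
  also have "\<dots> \<le> - q u"
    using u d_pos[OF uV] by (simp add: small_def mass_density_def pos_divide_le_eq)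
  finally show "u \<in> superlevel g \<tau>" using g[OF uV] uV by (simp add: superlevel_def)
qed

text \<open>A larger set would have density at most \<open>(1 - \<gamma> / 2) / (2 * m)\<close> with
  respect to \<open>q\<close> on more than half of the volume, which contradicts the failure of all
  scales by \<open>dyadic_scales\<close>.\<close>

lemma bottom_vol:
  assumes inv: "bottom_inv g j \<tau>" and g: "\<And>v. v \<in> V \<Longrightarrow> q v \<le> - g v + threshold (2 ^ i) * d v"
    and i: "i \<le> l" "real m \<le> real l * 2 ^ i" and fails: "\<And>j. j \<le> i \<Longrightarrow> scale_fails (2 ^ j)"
  shows "superlevel_vol g \<tau> \<le> real m"
proof (rule ccontr)
  assume "\<not> ?thesis"
  then have big: "m < vol G (superlevel g \<tau>)" by (simp add: superlevel_vol_def)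
  have level: "threshold (2 ^ i) - \<tau> \<le> (1 - \<gamma> / 2) / (2 * real m)"
    using bottom_inv_level[OF inv, of "2 ^ i"] i by simp
  show False
  proof (rule dyadic_scales[OF PR_sum superlevel_subset big _ gamma(1) i(1) l(1)])
    fix v assume "v \<in> superlevel g \<tau>"
    then have v: "v \<in> V" "\<tau> * d v \<le> g v" by (auto simp: superlevel_def)
    have "q v \<le> (threshold (2 ^ i) - \<tau>) * d v" using g[OF v(1)] v(2) by (simp add: algebra_simps)
    also have "\<dots> \<le> (1 - \<gamma> / 2) / (2 * real m) * d v" using level by (intro mult_right_mono) auto
    finally show "q v \<le> (1 - \<gamma> / 2) / (2 * real m) * d v" .
  next
    show "real m \<le> 2 ^ i * real l" using i(2) by (simp add: mult.commute)
  next
    fix j assume "j \<le> i"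
    then show "superlevel_vol q (avg + \<gamma> / (16 * real l * 2 ^ j)) < 2 ^ j \<or> real m < superlevel_vol q avg"
      using fails[of j] by (simp add: scale_fails_def)
  qed
qed

section \<open>Verification of the top sweep and the bottom sweep\<close>

lemma select_pushed:
  assumes inp: "input s" and P: "distinct (pushed s)" "set (pushed s) \<subseteq> V"
  shows "wp select_pushed (\<lambda>t s'. distinct (candidates s') \<and>
    set (candidates s') = {v \<in> set (pushed s). (avg + rvar s ''eps'') * d v \<le> rarr s ''p'' v} \<and>
    t \<le> 100 * nvar s ''np'' + 20) s"
proof -
  define Ps where "Ps = pushed s"
  define keep where "keep = (\<lambda>v. (avg + rvar s ''eps'') * d v \<le> rarr s ''p'' v)"
  have len: "length Ps = nvar s ''np''" by (simp add: Ps_def)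
  show ?thesis
    unfolding select_pushed_def wp_Seq wp_NAssign
  proof (rule wp_While[where \<mu> = "\<lambda>s'. nvar s ''np'' - nvar s' ''i''" and
      I = "\<lambda>t s'. input s' \<and> narr s' ''P'' = narr s ''P'' \<and> nvar s' ''np'' = nvar s ''np'' \<and>
        rarr s' ''p'' = rarr s ''p'' \<and> rvar s' ''eps'' = rvar s ''eps'' \<and>
        nvar s' ''i'' \<le> nvar s ''np'' \<and>
        candidates s' = filter keep (take (nvar s' ''i'') Ps) \<and> t \<le> 100 * nvar s' ''i''"], goal_cases)
    case 1
    show ?case using inp by (simp add: input_def candidates_def)
  next
    case (2 t s')
    let ?i = "nvar s' ''i''"
    define v where "v = narr s ''P'' ?i"
    have i: "?i < nvar s ''np''" using 2 by simp
    have v: "Ps ! ?i = v" using i by (simp add: Ps_def v_def)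
    have "v \<in> V" using P(2) i nth_mem[of ?i Ps] len v by (auto simp: Ps_def)
    then have vn: "v < n" by (simp add: V_eq)
    have take: "take (Suc ?i) Ps = take ?i Ps @ [v]"
      using i v by (simp add: take_Suc_conv_app_nth len)
    have cand: "array_list (narr s' ''D'') (nvar s' ''dn'') = filter keep (take ?i Ps)"
      using 2 by (simp add: candidates_def)
    have off: "narr s' ''off'' (Suc v) = narr s' ''off'' v + deg G v"
      using input_off_Suc[OF _ vn] 2 by simp
    have off: "off_array (Suc v) = off_array v + deg G v" using off 2 by (simp add: input_def)
    have Pi: "narr s ''P'' ?i = v" by (simp add: v_def)
    show ?case
    proof (cases "keep v")
      case True
      then have "\<not> rarr s' ''p'' v < (1 / (2 * real (nvar s' ''m'')) + rvar s' ''eps'') * d v"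
        using 2 by (simp add: keep_def inputD)
      then show ?thesis
        using 2 i True by (simp add: wp_simps Pi off candidates_def cand take input_def diff_less_mono2)
    next
      case False
      then have "rarr s' ''p'' v < (1 / (2 * real (nvar s' ''m'')) + rvar s' ''eps'') * d v"
        using 2 by (simp add: keep_def inputD)
      then show ?thesis
        using 2 i False by (simp add: wp_simps Pi off candidates_def cand take input_def diff_less_mono2)
    qed
  next
    case (3 t s')
    then have "candidates s' = filter keep Ps" by (simp add: len)
    then show ?case using P 3 by (auto simp: keep_def Ps_def)
  qed
qed

lemma push_inv_np:
  assumes "push_inv e s"
  shows "nvar s ''np'' \<le> nvar s ''qt''"
proof -
  have "distinct (pushed s)" "set (pushed s) \<subseteq> set (queue s)"
    using assms by (auto simp: push_inv_def)
  then have "card (set (pushed s)) \<le> length (queue s)"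
    by (meson List.finite_set card_length card_mono order_trans)
  then show ?thesis using \<open>distinct (pushed s)\<close> by (simp add: distinct_card)
qed

text \<open>At most \<open>1 / \<alpha>\<close> rounds, each scanning candidates of volume at most
  \<open>1 / threshold K\<close>. Selecting the candidates costs as much as the length of the
  log.\<close>

lemma top_sweep:
  assumes inv: "push_inv (threshold K) s" and res: "\<forall>v\<in>V. residual s v < threshold K * d v"
    and s: "rvar s ''eps'' = threshold K" "nvar s ''K'' = K" "0 < K" "rvar s ''phi'' = \<phi>"
      "nvar s ''case'' = 0"
  shows "wp top_sweep (\<lambda>t s'. real t \<le> 1000 / (\<alpha> * threshold K) \<and>
    (nvar s' ''case'' = 0 \<and> scale_fails K \<or> nvar s' ''case'' = 1 \<and> top_found K (output_set s'))) s"
proof -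
  define e where "e = threshold K"
  define p where "p = rarr s ''p''"
  define Cs where "Cs = {v \<in> set (pushed s). (avg + e) * d v \<le> p v}"
  have e: "0 < e" "e \<le> 1" using threshold_pos threshold_le_1 s(3) by (auto simp: e_def)
  have inp: "input s" and p_nn: "\<forall>v\<in>V. 0 \<le> p v \<and> 0 \<le> residual s v"
    and con: "consistent p (residual s)" and P: "distinct (pushed s)" "set (pushed s) = {v \<in> V. 0 < p v}"
    using inv by (auto simp: push_inv_def p_def)
  have pq: "p v \<le> q v" "q v \<le> p v + threshold K * d v" if "v \<in> V" for v
    using PR_bounds[OF con, of "threshold K" v] p_nn res that by (auto intro: less_imp_le)
  have sub: "superlevel p \<tau> \<subseteq> Cs" if "avg + e \<le> \<tau>" for \<tau>
  proof
    fix v assume "v \<in> superlevel p \<tau>"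
    then have v: "v \<in> V" "\<tau> * d v \<le> p v" by (auto simp: superlevel_def)
    have "(avg + e) * d v \<le> \<tau> * d v" using that by (intro mult_right_mono) auto
    moreover have "0 < (avg + e) * d v" using e d_pos[OF v(1)] by (intro mult_pos_pos add_nonneg_pos) auto
    ultimately show "v \<in> Cs" using v by (simp add: Cs_def P(2))
  qed
  have CsV: "Cs \<subseteq> V" using P by (auto simp: Cs_def)
  \<comment> \<open>Candidates have density at least \<open>e\<close>, and the settled mass is at
    most 1.\<close>
  have vol: "real (vol G Cs) \<le> 1 / e"
  proof -
    have "e * real (vol G Cs) = (\<Sum>v\<in>Cs. e * d v)" by (simp only: vol_eq sum_distrib_left)
    also have "\<dots> \<le> (\<Sum>v\<in>Cs. p v)"
    proof (rule sum_mono)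
      fix v assume "v \<in> Cs"
      moreover have "e * d v \<le> (avg + e) * d v" by (intro mult_right_mono) auto
      ultimately show "e * d v \<le> p v" by (simp add: Cs_def)
    qed
    also have "\<dots> \<le> (\<Sum>v\<in>V. p v)" using p_nn CsV finite_V by (intro sum_mono2) auto
    also have "\<dots> \<le> 1" using push_inv_bounds(3)[OF inv] e by (simp add: p_def e_def)
    finally show ?thesis using e by (simp add: field_simps)
  qed
  have one: "1 \<le> 1 / (\<alpha> * e)" "1 / \<alpha> \<le> 1 / (\<alpha> * e)" "1 / e \<le> 1 / (\<alpha> * e)"
  proof -
    have "\<alpha> * e \<le> 1 * 1" "\<alpha> * e \<le> \<alpha> * 1" "\<alpha> * e \<le> 1 * e" using alpha e by (intro mult_mono; simp)+
    moreover have "0 < \<alpha> * e" using alpha e by simp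
    then have "1 / x \<le> 1 / (\<alpha> * e)" if "\<alpha> * e \<le> x" for x
      using that by (intro divide_left_mono) (auto intro: less_le_trans)
    ultimately show "1 \<le> 1 / (\<alpha> * e)" "1 / \<alpha> \<le> 1 / (\<alpha> * e)" "1 / e \<le> 1 / (\<alpha> * e)"
      by (metis div_by_1 mult_1 mult_1_right)+
  qed
  have np: "real (nvar s ''np'') \<le> 3 * (1 / (\<alpha> * e))"
    using push_inv_np[OF inv] push_inv_bounds(2)[OF inv] e by (simp add: e_def)
  have time: "real t \<le> 1000 / (\<alpha> * threshold K)"
    if t: "real t \<le> 100 * real (nvar s ''np'') + (120 * real (vol G Cs) + (real j * (62 + 120 * real (vol G Cs)) + 200))"
      and j: "real j \<le> 1 / \<alpha>" for t j
  proof -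
    have "real j * (62 + 120 * real (vol G Cs)) \<le> 1 / \<alpha> * (62 + 120 * (1 / e))"
      using j vol alpha by (intro mult_mono) auto
    also have "\<dots> = 120 * (1 / (\<alpha> * e)) + 62 * (1 / \<alpha>)" by (simp add: algebra_simps)
    finally have "real t \<le> 1000 * (1 / (\<alpha> * e))" using t one np vol by linarith
    then show ?thesis by (simp add: e_def)
  qed
  show ?thesis
    unfolding top_sweep_def wp_Seq
  proof (rule wp_frame[OF select_pushed], goal_cases)
    case 1 show ?case by (rule inp)
  next
    case 2 show ?case by (rule P)
  next
    case 3 show ?case using P by auto
  next
    case (4 t1 s1)
    have fr1: "rarr s1 ''p'' = p" "rvar s1 ''eps'' = e" "nvar s1 ''K'' = K" "rvar s1 ''phi'' = \<phi>"
      "nvar s1 ''case'' = 0" "input s1"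
      using 4(2) inp s by (auto simp: frame_def loop_defs input_def p_def e_def)
    have Cs1: "distinct (candidates s1)" "set (candidates s1) = Cs" and t1: "t1 \<le> 100 * nvar s ''np'' + 20"
      using 4(1) s by (auto simp: Cs_def e_def p_def)
    let ?\<tau> = "avg + 3 * e"
    let ?s1 = "s1\<lparr>rvar := (rvar s1)(''tau'' := ?\<tau>)\<rparr>"
    have cand1: "candidates ?s1 = candidates s1" by (simp add: candidates_def)
    have "wp scan (\<lambda>t s2. wp (Cond (NLess (NVar ''vol'') (NVar ''K'')) Skip
        (sweep_loop (RNat (NVar ''vol'')) ;; Cond (NLess (NVar ''m'') (NVar ''vol'')) Skip (NAssign ''case'' (NConst 1))))
      (\<lambda>u s'. real (t1 + (30 + (t + u))) \<le> 1000 / (\<alpha> * threshold K) \<and>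
        (nvar s' ''case'' = 0 \<and> scale_fails K \<or> nvar s' ''case'' = 1 \<and> top_found K (output_set s'))) s2) ?s1"
    proof (rule wp_frame[OF scan], goal_cases)
      case 1 show ?case using fr1 by (simp add: input_def)
    next
      case 2 show ?case using Cs1 cand1 by simp
    next
      case 3 show ?case using Cs1 cand1 CsV by simp
    next
      case 4 show ?case using Cs1 cand1 sub[of ?\<tau>] e fr1 by simp
    next
      case (5 t2 s2)
      have fr2: "rarr s2 ''p'' = p" "nvar s2 ''K'' = K" "rvar s2 ''phi'' = \<phi>" "rvar s2 ''tau'' = ?\<tau>"
        "nvar s2 ''case'' = 0" "input s2" and cand2: "candidates s2 = candidates s1"
        using 5(2) fr1 by (auto simp: frame_def loop_defs input_def candidates_def)
      have sc: "scanned s2" and t2: "real t2 \<le> 120 * real (vol G Cs) + 20"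
        using 5(1) cand1 Cs1 by auto
      have vol2: "real (nvar s2 ''vol'') = superlevel_vol p ?\<tau>" using sc fr2 by (simp add: scanned_def)
      show ?case
      proof (cases "nvar s2 ''vol'' < K")
        case True
        then have "scale_fails K" using top_fails[OF pq s(3)] vol2 by (simp add: e_def)
        moreover have "real (t1 + (30 + (t2 + 5))) \<le> 1000 / (\<alpha> * threshold K)"
          using t1 t2 alpha by (intro time[of _ 0]) auto
        ultimately show ?thesis using True fr2 by (simp add: wp_simps)
      next
        case False
        have init: "top_inv p K 0 ?\<tau>" using top_inv_init[of K p] s(3) vol2 False by (simp add: e_def)
        have "wp (sweep_loop (RNat (NVar ''vol''))) (\<lambda>t s'. wp (Cond (NLess (NVar ''m'') (NVar ''vol'')) Skip (NAssign ''case'' (NConst 1)))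
          (\<lambda>u s'. real (t1 + (30 + (t2 + (4 + (t + u))))) \<le> 1000 / (\<alpha> * threshold K) \<and>
          (nvar s' ''case'' = 0 \<and> scale_fails K \<or> nvar s' ''case'' = 1 \<and> top_found K (output_set s'))) s') s2"
        proof (rule wp_frame[OF sweep_loop[where R = "top_inv p K" and g = p and \<phi> = \<phi> and
            \<delta> = "\<lambda>\<tau>. 6 * \<alpha> / (\<phi> * superlevel_vol p \<tau>)"]], goal_cases)
          case (8 j \<tau>)
          have "avg + e \<le> \<tau> - 6 * \<alpha> / (\<phi> * superlevel_vol p \<tau>)"
            using top_inv_step(1)[OF con p_nn s(3) 8] by (simp add: top_inv_def e_def)
          then show ?case
            using top_inv_step[OF con p_nn s(3) 8] sub Cs1 cand2 by auto
        next
          case (9 s')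
          then show ?case by (simp add: scanned_def)
        next
          case (10 t3 s3)
          have fr3: "rarr s3 ''p'' = p" "nvar s3 ''case'' = 0" "input s3"
            using 10(2) fr2 by (auto simp: frame_def loop_defs input_def)
          from 10(1) obtain j where sc3: "scanned s3" and j: "top_inv p K j (rvar s3 ''tau'')"
            "real t3 \<le> real j * (62 + 120 * real (vol G Cs)) + 60"
            "nvar s3 ''vol'' \<le> m \<longrightarrow> real (nvar s3 ''cut'') \<le> \<phi> * real (nvar s3 ''vol'')"
            using Cs1 cand2 by auto
          have T: "output_set s3 = superlevel p (rvar s3 ''tau'')"
            "real (nvar s3 ''vol'') = superlevel_vol p (rvar s3 ''tau'')"
            "real (nvar s3 ''cut'') = superlevel_cut p (rvar s3 ''tau'')"
            using sc3 fr3 by (auto simp: scanned_def)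
          have tm: "real (t1 + (30 + (t2 + (4 + (t3 + 10))))) \<le> 1000 / (\<alpha> * threshold K)"
            using t1 t2 j by (intro time[of _ j]) (auto simp: top_inv_def)
          show ?case
          proof (cases "m < nvar s3 ''vol''")
            case True
            then have "scale_fails K"
              using top_fails[OF pq s(3), of "rvar s3 ''tau''"] j(1) T(2) by auto
            then show ?thesis using True tm fr3 by (simp add: wp_simps inputD)
          next
            case False
            then have "top_found K (superlevel p (rvar s3 ''tau''))"
              using top_found_superlevel[OF j(1) s(3) pq(1)] j(3) T by simp
            then show ?thesis using False tm fr3 T by (simp add: wp_simps inputD output_set_def)
          qed
        qed (use fr2 sc Cs1 CsV cand2 init in auto)
        then show ?thesis using False fr2 by (simp add: wp_simps)
      qed
    qed
    then show ?case
      apply (simp add: wp_RAssign fr1 inputD)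
      apply (erule wp_mono)
      apply (erule wp_mono)
      by (auto intro: order_trans[rotated])
  qed
qed


lemma n_le: "n \<le> 2 * m"
proof -
  have "(\<Sum>v\<in>V. 1) \<le> (\<Sum>v\<in>V. deg G v)" using deg_pos by (intro sum_mono) (simp add: Suc_le_eq)
  then show ?thesis using vol_verts[OF multigraph_G] by (simp add: V_eq vol_def)
qed

lemma select_all:
  assumes inp: "input s"
  shows "wp select_all (\<lambda>t s'. candidates s' = [0..<n] \<and>
    rarr s' ''p'' = (\<lambda>v. if v < n then - rarr s ''p'' v else rarr s ''p'' v) \<and> t \<le> 40 * n + 20) s"
  unfolding select_all_def wp_Seq wp_NAssign
proof (rule wp_While[where \<mu> = "\<lambda>s. n - nvar s ''i''" and
    I = "\<lambda>t s'. input s' \<and> nvar s' ''i'' \<le> n \<and>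
      array_list (narr s' ''D'') (nvar s' ''i'') = [0..<nvar s' ''i''] \<and>
      rarr s' ''p'' = (\<lambda>v. if v < nvar s' ''i'' then - rarr s ''p'' v else rarr s ''p'' v) \<and>
      t \<le> 40 * nvar s' ''i''"], goal_cases)
  case 1
  show ?case using inp by (simp add: input_def)
next
  case (2 t s')
  then have i: "nvar s' ''i'' < n" by (auto simp: inputD)
  then show ?case using 2(1) by (auto simp: wp_simps input_def fun_eq_iff less_Suc_eq)
next
  case (3 t s')
  then have "nvar s' ''i'' = n" by (auto simp: inputD)
  then show ?case using 3 by (auto simp: candidates_def inputD)
qed

text \<open>Needed because \<open>select_all\<close> negates the array \<open>p\<close> only on the
  vertices, so that negating the whole function again agrees with the old settled mass only
  there.\<close>

lemma consistent_cong:
  assumes "consistent p r" "\<And>v. v \<in> V \<Longrightarrow> p v = p' v"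
  shows "consistent p' r"
proof -
  have "walk p v = walk p' v" if "v \<in> V" for v
    unfolding walk_def using assms(2) that by (auto intro!: sum.cong)
  then show ?thesis using assms by (simp add: consistent_def)
qed

text \<open>At most \<open>1 / \<alpha>\<close> rounds, each scanning the whole graph of volume
  \<open>2 * m\<close>.\<close>

lemma bottom_sweep:
  assumes inv: "push_inv (threshold K) s" and res: "\<forall>v\<in>V. residual s v < threshold K * d v"
    and s: "K = 2 ^ i" "rvar s ''phi'' = \<phi>" and i: "i \<le> l" "real m \<le> real l * real K"
    and fails: "\<And>j. j \<le> i \<Longrightarrow> scale_fails (2 ^ j)"
  shows "wp bottom_sweep (\<lambda>t s'. real t \<le> 1000 * (real m / \<alpha>) \<and>
    (nvar s' ''case'' = 2 \<and> found (output_set s') \<and> small \<subseteq> output_set s' \<or>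
     nvar s' ''case'' = 3 \<and> small = {})) s"
proof -
  define g where "g = (\<lambda>v. if v < n then - rarr s ''p'' v else rarr s ''p'' v)"
  define p where "p = (\<lambda>v. - g v)"
  have g: "g = (\<lambda>v. - p v)" by (simp add: p_def)
  have p_eq: "rarr s ''p'' v = p v" if "v \<in> V" for v using that by (simp add: p_def g_def V_eq)
  have inp: "input s" and con: "consistent p (residual s)" and r_nn: "\<forall>v\<in>V. 0 \<le> residual s v"
    using inv consistent_cong[OF _ p_eq] by (auto simp: push_inv_def)
  have r_le: "\<forall>v\<in>V. residual s v \<le> threshold K * d v" using res by (auto intro: less_imp_le)
  have pq: "- q v \<le> g v" "q v \<le> - g v + threshold K * d v" if "v \<in> V" for v
    using PR_bounds[OF con, of "threshold K" v] r_nn r_le that by (auto simp: g)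
  have one: "1 \<le> real m / \<alpha>" "real m \<le> real m / \<alpha>" "1 / \<alpha> \<le> real m / \<alpha>"
  proof -
    have "real m * \<alpha> \<le> real m * 1" using alpha by (intro mult_left_mono) auto
    moreover have "1 \<le> real m" using m_pos by simp
    ultimately show "1 \<le> real m / \<alpha>" "real m \<le> real m / \<alpha>" "1 / \<alpha> \<le> real m / \<alpha>"
      using alpha by (auto simp: pos_le_divide_eq intro!: divide_right_mono)
  qed
  have time: "real t \<le> 1000 * (real m / \<alpha>)"
    if t: "real t \<le> 40 * real n + (240 * real m + (real j * (62 + 240 * real m) + 150))"
      and j: "real j \<le> 1 / \<alpha>" for t j
  proof -
    have "real j * (62 + 240 * real m) \<le> 1 / \<alpha> * (62 + 240 * real m)"
      using j by (intro mult_right_mono) auto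
    also have "\<dots> = 240 * (real m / \<alpha>) + 62 * (1 / \<alpha>)" by (simp add: algebra_simps add_divide_distrib)
    finally show ?thesis using t one n_le by linarith
  qed
  show ?thesis
    unfolding bottom_sweep_def wp_Seq
  proof (rule wp_frame[OF select_all[OF inp]], goal_cases)
    case (1 t1 s1)
    have fr1: "rarr s1 ''p'' = g" "rvar s1 ''phi'' = \<phi>" "input s1"
      using 1 inp s by (auto simp: frame_def loop_defs input_def g_def)
    have Cs1: "distinct (candidates s1)" "set (candidates s1) = V" and t1: "t1 \<le> 40 * n + 20"
      using 1(1) by (auto simp: V_eq atLeast0LessThan)
    let ?\<tau> = "(\<gamma> - 1) / (2 * real m)"
    let ?s1 = "s1\<lparr>rvar := (rvar s1)(''tau'' := ?\<tau>)\<rparr>"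
    have cand1: "candidates ?s1 = candidates s1" by (simp add: candidates_def)
    have volV: "real (vol G V) = 2 * real m" using vol_verts[OF multigraph_G] by simp
    have "wp scan (\<lambda>t s2. wp (Cond (NLess (NConst 0) (NVar ''vol''))
        (sweep_loop (RNat (NVar ''m'')) ;; Cond (NLess (NVar ''m'') (NVar ''vol'')) Skip (NAssign ''case'' (NConst 2)))
        (NAssign ''case'' (NConst 3)))
      (\<lambda>u s'. real (t1 + (30 + (t + u))) \<le> 1000 * (real m / \<alpha>) \<and>
        (nvar s' ''case'' = 2 \<and> found (output_set s') \<and> small \<subseteq> output_set s' \<or>
         nvar s' ''case'' = 3 \<and> small = {})) s2) ?s1"
    proof (rule wp_frame[OF scan], goal_cases)
      case 1 show ?case using fr1 by (simp add: input_def)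
    next
      case 2 show ?case using Cs1 cand1 by simp
    next
      case 3 show ?case using Cs1 cand1 by simp
    next
      case 4 show ?case using Cs1 cand1 superlevel_subset by simp
    next
      case (5 t2 s2)
      have fr2: "rarr s2 ''p'' = g" "rvar s2 ''phi'' = \<phi>" "rvar s2 ''tau'' = ?\<tau>" "input s2"
        and cand2: "candidates s2 = candidates s1"
        using 5(2) fr1 by (auto simp: frame_def loop_defs input_def candidates_def)
      have sc: "scanned s2" and t2: "real t2 \<le> 240 * real m + 20"
        using 5(1) cand1 Cs1 volV by auto
      have vol2: "real (nvar s2 ''vol'') = superlevel_vol g ?\<tau>" using sc fr2 by (simp add: scanned_def)
      show ?case
      proof (cases "0 < nvar s2 ''vol''")
        case False
        have "small = {}"
        proof (rule ccontr)
          assume "small \<noteq> {}"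
          then obtain u where u: "u \<in> small" by auto
          then have uV: "u \<in> V" by (simp add: small_def)
          have "?\<tau> * d u = - ((1 - \<gamma>) / (2 * real m) * d u)" by (simp add: algebra_simps diff_divide_distrib)
          also have "\<dots> \<le> - q u"
            using u d_pos[OF uV] by (simp add: small_def mass_density_def pos_divide_le_eq)
          also have "\<dots> \<le> g u" by (rule pq(1)[OF uV])
          finally have "u \<in> superlevel g ?\<tau>" using uV by (simp add: superlevel_def)
          then show False using False vol2 vol_pos_iff[OF superlevel_subset, of g ?\<tau>]
            by (auto simp: superlevel_vol_def)
        qed
        moreover have "real (t1 + (30 + (t2 + 6))) \<le> 1000 * (real m / \<alpha>)"
          using t1 t2 alpha by (intro time[of _ 0]) auto
        ultimately show ?thesis using False fr2 by (simp add: wp_simps)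
      next
        case True
        have init: "bottom_inv g 0 ?\<tau>" using bottom_inv_init[of g] vol2 True by simp
        have "wp (sweep_loop (RNat (NVar ''m''))) (\<lambda>t s'. wp (Cond (NLess (NVar ''m'') (NVar ''vol'')) Skip (NAssign ''case'' (NConst 2)))
          (\<lambda>u s'. real (t1 + (30 + (t2 + (4 + (t + u))))) \<le> 1000 * (real m / \<alpha>) \<and>
          (nvar s' ''case'' = 2 \<and> found (output_set s') \<and> small \<subseteq> output_set s' \<or>
           nvar s' ''case'' = 3 \<and> small = {})) s') s2"
        proof (rule wp_frame[OF sweep_loop[where R = "bottom_inv g" and g = g and \<phi> = \<phi> and
            \<delta> = "\<lambda>\<tau>. 6 * \<alpha> / (\<phi> * real m)"]], goal_cases)
          case (8 j \<tau>)
          then show ?case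
            using bottom_inv_step[OF con r_le g i(2) 8] superlevel_subset Cs1 cand2 by auto
        next
          case (9 s')
          then show ?case by (simp add: inputD)
        next
          case (10 t3 s3)
          have fr3: "rarr s3 ''p'' = g" "input s3"
            using 10(2) fr2 by (auto simp: frame_def loop_defs input_def)
          from 10(1) obtain j where sc3: "scanned s3" and j: "bottom_inv g j (rvar s3 ''tau'')"
            "real t3 \<le> real j * (62 + 240 * real m) + 60"
            "nvar s3 ''vol'' \<le> m \<longrightarrow> real (nvar s3 ''cut'') \<le> \<phi> * real (nvar s3 ''vol'')"
            using Cs1 cand2 volV by auto
          have T: "output_set s3 = superlevel g (rvar s3 ''tau'')"
            "real (nvar s3 ''vol'') = superlevel_vol g (rvar s3 ''tau'')"
            "real (nvar s3 ''cut'') = superlevel_cut g (rvar s3 ''tau'')"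
            using sc3 fr3 by (auto simp: scanned_def)
          have jb: "real j \<le> 1 / \<alpha>" "0 < superlevel_vol g (rvar s3 ''tau'')"
            using j(1) unfolding bottom_inv_def by blast+
          have tm: "real (t1 + (30 + (t2 + (4 + (t3 + 10))))) \<le> 1000 * (real m / \<alpha>)"
            using t1 t2 j(2) jb by (intro time[of _ j]) auto
          \<comment> \<open>The loop cannot have ended by passing volume \<open>m\<close>, so the
            cut must be sparse.\<close>
          have le: "superlevel_vol g (rvar s3 ''tau'') \<le> real m"
            using bottom_vol[OF j(1) _ i(1) _ fails] pq(2) i(2) s(1) by simp
          then have "found (superlevel g (rvar s3 ''tau''))"
            using found_superlevel[OF jb(2) le] j(3) T by simp
          moreover have "small \<subseteq> superlevel g (rvar s3 ''tau'')"
            using bottom_small[OF j(1)] pq(1) by blast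
          ultimately show ?case using tm fr3 T le by (simp add: wp_simps inputD output_set_def)
        qed (use fr2 sc Cs1 cand2 init in auto)
        then show ?thesis using True fr2 by (simp add: wp_simps)
      qed
    qed
    then show ?case
      apply (simp add: wp_RAssign fr1 inputD)
      apply (erule wp_mono)
      apply (erule wp_mono)
      by (auto intro: order_trans[rotated])
  qed
qed

end

section \<open>Preparation and the initial state\<close>

context pagerank_input
begin

lemma gamma_alpha: "0 < \<gamma> * \<alpha>" "\<gamma> * \<alpha> \<le> \<alpha>" "\<gamma> * \<alpha> \<le> 1"
proof -
  show "0 < \<gamma> * \<alpha>" using alpha gamma by simp
  show le: "\<gamma> * \<alpha> \<le> \<alpha>" using alpha gamma by simp
  show "\<gamma> * \<alpha> \<le> 1" using le alpha by linarith
qed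

lemma pow_loop:
  assumes inp: "input s" and s: "nvar s ''l'' = 1" "nvar s ''pow'' = 2"
  shows "wp pow_loop (\<lambda>t s'. 0 < nvar s' ''l'' \<and> 2 ^ (nvar s' ''l'' - 1) \<le> m \<and>
    m < 2 ^ nvar s' ''l'' \<and> t \<le> 30 * nvar s' ''l'') s"
  unfolding pow_loop_def
proof (rule wp_While[where \<mu> = "\<lambda>s. Suc m - nvar s ''pow''" and
    I = "\<lambda>t s'. input s' \<and> 0 < nvar s' ''l'' \<and> nvar s' ''pow'' = 2 ^ nvar s' ''l'' \<and>
      2 ^ (nvar s' ''l'' - 1) \<le> m \<and> t \<le> 20 * nvar s' ''l''"], goal_cases)
  case 1
  then show ?case using inp s m_pos by simp
next
  case (2 t s')
  then have "2 ^ nvar s' ''l'' \<le> m" by (auto simp: inputD)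
  moreover have "(0::nat) < 2 ^ nvar s' ''l''" by simp
  ultimately have "Suc m - (2 ^ nvar s' ''l'' + 2 ^ nvar s' ''l'') < Suc m - 2 ^ nvar s' ''l''" by linarith
  then show ?case using 2 by (simp add: wp_simps input_def)
next
  case (3 t s')
  then show ?case by (auto simp: inputD)
qed

text \<open>Each halving raises \<open>1 / \<phi>\<close> by at least 1, and
  \<open>y \<le> (\<phi> / 2)^2 \<le> \<phi> / 2\<close> keeps the new value at most
  \<open>1 / y\<close>. The same growth bounds the time by \<open>30 / \<phi>\<close>.\<close>

lemma phi_loop:
  assumes s: "rvar s ''phi'' = 1" "rvar s ''goal'' = y" and y: "0 < y"
  shows "wp phi_loop (\<lambda>t s'. 0 < rvar s' ''phi'' \<and> rvar s' ''phi'' \<le> 1 \<and>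
    (rvar s' ''phi'' < 1 \<longrightarrow> y \<le> (rvar s' ''phi'')\<^sup>2) \<and> (rvar s' ''phi'')\<^sup>2 \<le> 4 * y \<and>
    real t \<le> 30 / rvar s' ''phi'') s"
  unfolding phi_loop_def
proof (rule wp_While[where \<mu> = "\<lambda>s. nat \<lfloor>1 / y\<rfloor> - nat \<lfloor>1 / rvar s ''phi''\<rfloor>" and
    I = "\<lambda>t s'. rvar s' ''goal'' = y \<and> 0 < rvar s' ''phi'' \<and> rvar s' ''phi'' \<le> 1 \<and>
      (rvar s' ''phi'' < 1 \<longrightarrow> y \<le> (rvar s' ''phi'')\<^sup>2) \<and> real t \<le> 30 * (1 / rvar s' ''phi'' - 1)"], goal_cases)
  case 1
  then show ?case using s by simp
next
  case (2 t s')
  define x where "x = rvar s' ''phi''"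
  have x: "0 < x" "x \<le> 1" "y \<le> (x / 2)\<^sup>2" "real t \<le> 30 * (1 / x - 1)" and g: "rvar s' ''goal'' = y"
    using 2 by (auto simp: x_def power2_eq_square)
  have "1 \<le> 1 / x" using x by simp
  then have grow: "1 / x + 1 \<le> 1 / (x / 2)" by simp
  have "x / 2 * (x / 2) \<le> 1 * (x / 2)" using x(1,2) by (intro mult_right_mono) auto
  with x(3) have "y \<le> x / 2" by (simp only: power2_eq_square)
  then have "1 / (x / 2) \<le> 1 / y" using y x(1) by (intro divide_left_mono) auto
  then have "nat \<lfloor>1 / x\<rfloor> < nat \<lfloor>1 / (x / 2)\<rfloor>" "nat \<lfloor>1 / (x / 2)\<rfloor> \<le> nat \<lfloor>1 / y\<rfloor>"
    using grow x by (auto simp: zless_nat_conj intro!: nat_mono floor_mono) linarith+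
  then have "nat \<lfloor>1 / y\<rfloor> - nat \<lfloor>1 / (x / 2)\<rfloor> < nat \<lfloor>1 / y\<rfloor> - nat \<lfloor>1 / x\<rfloor>" by linarith
  moreover have "z + 30 \<le> 30 * (b - 1)" if "z \<le> 30 * (a - 1)" "a + 1 \<le> b" for a b z :: real
    using that by simp
  from this[OF x(4) grow] have "real t + 30 \<le> 30 * (1 / (x / 2) - 1)" .
  ultimately show ?case using x g by (simp add: wp_simps x_def[symmetric] power2_eq_square)
next
  case (3 t s')
  define x where "x = rvar s' ''phi''"
  have x: "0 < x" "x \<le> 1" "x < 1 \<longrightarrow> y \<le> x\<^sup>2" "(x / 2)\<^sup>2 < y" "real t \<le> 30 * (1 / x - 1)"
    using 3 by (auto simp: x_def power2_eq_square)
  then show ?case by (simp add: x_def[symmetric] power2_eq_square)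
qed

lemma prepare:
  assumes inp: "input s"
  shows "wp prepare (\<lambda>t s'. nvar s' ''K'' = 1 \<and>
    sweep_params G A \<alpha> \<gamma> p0 L (nvar s' ''l'') (rvar s' ''phi'') \<and>
    (rvar s' ''phi'')\<^sup>2 \<le> 4 * (576 * \<alpha> * real (nvar s' ''l'') / \<gamma>) \<and>
    real t \<le> 60 * real (nvar s' ''l'') + 30 / rvar s' ''phi'') s"
proof -
  let ?s = "s\<lparr>nvar := (nvar s)(''l'' := 1, ''pow'' := 2)\<rparr>"
  define Q where "Q = (\<lambda>(t :: nat) (s' :: state). nvar s' ''K'' = 1 \<and>
    sweep_params G A \<alpha> \<gamma> p0 L (nvar s' ''l'') (rvar s' ''phi'') \<and>
    (rvar s' ''phi'')\<^sup>2 \<le> 4 * (576 * \<alpha> * real (nvar s' ''l'') / \<gamma>) \<and>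
    real t \<le> 60 * real (nvar s' ''l'') + 30 / rvar s' ''phi'')"
  have "wp pow_loop (\<lambda>t1 s1. wp phi_loop (\<lambda>t2 s2.
      Q (t1 + t2 + 30) (s2\<lparr>nvar := (nvar s2)(''K'' := 1)\<rparr>))
      (s1\<lparr>rvar := (rvar s1)(''goal'' := 576 * \<alpha> * real (nvar s1 ''l'') / \<gamma>, ''phi'' := 1)\<rparr>)) ?s"
  proof (rule wp_frame[OF pow_loop], goal_cases)
    case 1
    show ?case using inp by (simp add: input_def)
  next
    case (4 t1 s1)
    let ?y = "576 * \<alpha> * real (nvar s1 ''l'') / \<gamma>"
    show ?case
    proof (rule wp_frame[OF phi_loop[where y = ?y]], goal_cases)
      case 3
      show ?case using 4(1) alpha gamma by simp
    next
      case (4 t2 s2)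
      have "nvar s2 ''l'' = nvar s1 ''l''" using 4(2) by (simp add: frame_def phi_loop_def)
      then show ?case
        using 4(1) \<open>0 < nvar s1 ''l'' \<and> _\<close> pagerank_input_axioms
        by (auto simp: Q_def sweep_params_def sweep_params_axioms_def)
    qed simp_all
  qed simp_all
  moreover have "rvar ?s ''alpha'' = \<alpha>" using inp by (simp add: inputD)
  ultimately show ?thesis
    unfolding Q_def[symmetric] prepare_def wp_Seq wp_NAssign
    apply simp
    apply (erule wp_frame)
    using inp apply (simp add: wp_RAssign frame_def pow_loop_def inputD)
    apply (erule wp_mono)
    by (simp add: Q_def)
qed

lemma push_inv_initial:
  "push_inv e (initial_state m A \<alpha> \<gamma> p0 L)" (is "push_inv e ?s")
proof -
  have "input ?s" by (simp add: input_def initial_state_def off_array_def)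
  moreover have "residual ?s = p0" by (simp add: residual_def initial_state_def fun_eq_iff)
  moreover have "rarr ?s ''p'' = (\<lambda>_. 0)" "rarr ?s ''x'' = (\<lambda>_. 0)" "nvar ?s ''qt'' = 0"
    "nvar ?s ''np'' = 0" "nvar ?s ''lp'' = 0"
    by (simp_all add: initial_state_def)
  ultimately show ?thesis using consistent_init p0_nonneg by (simp add: push_inv_def)
qed

text \<open>Allows the next scale to reuse the state with a smaller threshold. The difference
  \<open>qt - lp\<close> is treated for both signs.\<close>

lemma push_inv_antimono:
  assumes inv: "push_inv e s" and e: "0 < e'" "e' \<le> e"
  shows "push_inv e' s"
proof -
  let ?x = "real (nvar s ''qt'') - real (nvar s ''lp'')"
  have "\<alpha> * e' * ?x \<le> 2 * (\<Sum>v\<in>V. rarr s ''p'' v)"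
  proof (cases "0 \<le> ?x")
    case True
    have "\<alpha> * e' * ?x \<le> \<alpha> * e * ?x" using True alpha e by (intro mult_right_mono mult_left_mono) auto
    then show ?thesis using inv by (simp add: push_inv_def)
  next
    case False
    have "\<alpha> * e' * ?x \<le> 0" using False alpha e by (intro mult_nonneg_nonpos) auto
    also have "0 \<le> 2 * (\<Sum>v\<in>V. rarr s ''p'' v)" using inv by (auto simp: push_inv_def intro!: sum_nonneg)
    finally show ?thesis .
  qed
  then show ?thesis using inv e unfolding push_inv_def by (auto intro: order_trans)
qed

text \<open>What the theorem claims about the final state, with \<open>C = 2000000\<close>.\<close>

definition outcome :: "nat \<Rightarrow> state \<Rightarrow> bool" where
  "outcome t s \<longleftrightarrow> real t \<le> 2000000 * (real m / (\<gamma> * \<alpha>)) \<and>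
    (let T = output_set s; small = {u \<in> V. mass_density G (PR G \<alpha> p0) u \<le> (1 - \<gamma>) / (2 * real m)};
         found = (T \<subseteq> V \<and> T \<noteq> {} \<and> vol G T \<le> m \<and>
           (m \<ge> 2 \<longrightarrow> conductance G T \<le> 2000000 * sqrt (\<alpha> * log 2 (real m) / \<gamma>)))
     in (output_case s = 1 \<and> found \<and>
          (m \<ge> 2 \<longrightarrow> real t \<le> 2000000 * (real (vol G T) * log 2 (real m) / (\<gamma> * \<alpha>))) \<and>
          excess G (PR G \<alpha> p0) T \<ge> \<gamma> / (64 * log 2 (8 * real m)))
       \<or> (output_case s = 2 \<and> found \<and> small \<subseteq> T)
       \<or> (output_case s = 3 \<and> small = {}))"

end

section \<open>The loop over the scales and the final bounds\<close>

context sweep_params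
begin

lemma scale_step:
  assumes inv: "push_inv (threshold K) s"
    and s: "nvar s ''K'' = K" "0 < K" "nvar s ''l'' = l" "rvar s ''phi'' = \<phi>" "nvar s ''case'' = 0"
  shows "wp scale_step (\<lambda>t s'. real t \<le> 4000 / (\<alpha> * threshold K) \<and>
    push_inv (threshold K) s' \<and> (\<forall>v\<in>V. residual s' v < threshold K * d v) \<and>
    (if l * K < m then nvar s' ''K'' = K + K \<and> nvar s' ''last'' = nvar s ''last''
     else nvar s' ''K'' = K \<and> nvar s' ''last'' = 1) \<and>
    (nvar s' ''case'' = 0 \<and> scale_fails K \<or> nvar s' ''case'' = 1 \<and> top_found K (output_set s'))) s"
proof -
  define e where "e = threshold K"
  have e: "0 < e" "e \<le> 1" using threshold_pos threshold_le_1 s(2) by (auto simp: e_def)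
  have inp: "input s" using inv by (simp add: push_inv_def)
  have "\<alpha> * e \<le> 1 * 1" using alpha e by (intro mult_mono) auto
  then have one: "1 \<le> 1 / (\<alpha> * e)" using alpha e by (simp add: pos_le_divide_eq)
  define Q where "Q = (\<lambda>(t :: nat) (s' :: state). real t \<le> 4000 / (\<alpha> * threshold K) \<and>
    push_inv (threshold K) s' \<and> (\<forall>v\<in>V. residual s' v < threshold K * d v) \<and>
    (if l * K < m then nvar s' ''K'' = K + K \<and> nvar s' ''last'' = nvar s ''last''
     else nvar s' ''K'' = K \<and> nvar s' ''last'' = 1) \<and>
    (nvar s' ''case'' = 0 \<and> scale_fails K \<or> nvar s' ''case'' = 1 \<and> top_found K (output_set s')))"
  have "wp push_phase (\<lambda>t1 s1. wp top_sweep (\<lambda>t2 s2. wp (Cond (RLess (RMul (RNat (NVar ''l'')) (RNat (NVar ''K''))) (RNat (NVar ''m'')))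
      (NAssign ''K'' (NAdd (NVar ''K'') (NVar ''K'')))
      (NAssign ''last'' (NConst 1))) (\<lambda>u s'. Q (t1 + t2 + u + 20) s') s2) s1)
      (s\<lparr>rvar := (rvar s)(''eps'' := e)\<rparr>)"
  proof (rule wp_frame[OF push_phase[where e = e]], goal_cases)
    case 1
    then show ?case using inv by (simp add: push_inv_def input_def residual_def e_def)
  next
    case (5 t1 s1)
    have fr1: "rvar s1 ''eps'' = e" "nvar s1 ''K'' = K" "nvar s1 ''l'' = l" "rvar s1 ''phi'' = \<phi>"
      "nvar s1 ''case'' = 0" "nvar s1 ''last'' = nvar s ''last''" "input s1"
      using 5(2) inp s by (auto simp: frame_def loop_defs push_phase_def input_def)
    show ?case
    proof (rule wp_frame[OF top_sweep[where K = K]], goal_cases)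
      case (8 t2 s2)
      have fr2: "nvar s2 ''K'' = K" "nvar s2 ''l'' = l" "nvar s2 ''last'' = nvar s ''last''" "input s2"
        "nvar s2 ''m'' = m" "rarr s2 ''x'' = rarr s1 ''x''"
        using 8(2) fr1 by (auto simp: frame_def loop_defs top_sweep_def input_def residual_def)
      have inv2: "push_inv e s2"
        using 8(2) 5(1) fr2 by (simp add: frame_def loop_defs top_sweep_def push_inv_def residual_def)
      have "real (t1 + t2 + 20 + 20) \<le> 4000 * (1 / (\<alpha> * e))"
        using 5(1) 8(1) one unfolding e_def by simp
      then have tm: "real (t1 + t2 + 20 + 20) \<le> 4000 / (\<alpha> * e)" by simp
      show ?case
      proof (cases "l * K < m")
        case True
        then have "real l * real K < real m" by (simp flip: of_nat_mult)
        moreover have "push_inv e (s2\<lparr>nvar := (nvar s2)(''K'' := K + K)\<rparr>)"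
          using inv2 by (simp add: push_inv_def input_def residual_def)
        ultimately show ?thesis
          using True fr2 5(1) 8(1) tm by (simp add: wp_simps Q_def residual_def output_set_def flip: e_def)
      next
        case False
        then have "\<not> real l * real K < real m" by (simp flip: of_nat_mult)
        moreover have "push_inv e (s2\<lparr>nvar := (nvar s2)(''last'' := 1)\<rparr>)"
          using inv2 by (simp add: push_inv_def input_def residual_def)
        ultimately show ?thesis
          using False fr2 5(1) 8(1) tm by (simp add: wp_simps Q_def residual_def output_set_def flip: e_def)
      qed
    qed (use 5(1) fr1 s in \<open>auto simp: e_def\<close>)
  qed (use e in auto)
  then show ?thesis
    unfolding Q_def[symmetric] scale_step_def wp_Seq wp_RAssign
    using inp s
    apply (simp add: inputD threshold_def[symmetric] flip: e_def)
    apply (erule wp_mono)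
    apply (erule wp_mono)
    apply (erule wp_mono)
    by (auto simp: Q_def)
qed


text \<open>The three cases are: about to try scale \<open>2 ^ i\<close>, all scales failed, set
  found at scale \<open>K\<close>. Times form a geometric sum: the constant 300000 before a scale
  becomes 600000 after it, which is 300000 for the doubled scale.\<close>

definition loop_inv :: "nat \<Rightarrow> state \<Rightarrow> bool" where
  "loop_inv t s \<longleftrightarrow> nvar s ''l'' = l \<and> rvar s ''phi'' = \<phi> \<and>
    ((\<exists>i. nvar s ''case'' = 0 \<and> nvar s ''last'' = 0 \<and> nvar s ''K'' = 2 ^ i \<and> l * 2 ^ i \<le> 2 * m \<and>
        push_inv (threshold (2 ^ i)) s \<and> (\<forall>j<i. scale_fails (2 ^ j)) \<and>
        real t \<le> 300000 * (real (l * 2 ^ i) / (\<gamma> * \<alpha>))) \<or>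
     (\<exists>i. nvar s ''case'' = 0 \<and> nvar s ''last'' = 1 \<and> l * 2 ^ i \<le> 2 * m \<and> m \<le> l * 2 ^ i \<and>
        push_inv (threshold (2 ^ i)) s \<and> (\<forall>v\<in>V. residual s v < threshold (2 ^ i) * d v) \<and>
        (\<forall>j\<le>i. scale_fails (2 ^ j)) \<and> real t \<le> 600000 * (real (l * 2 ^ i) / (\<gamma> * \<alpha>))) \<or>
     (\<exists>K. nvar s ''case'' = 1 \<and> 0 < K \<and> l * K \<le> 2 * m \<and> top_found K (output_set s) \<and>
        real t \<le> 600000 * (real (l * K) / (\<gamma> * \<alpha>))))"

text \<open>\<open>K\<close> doubles while \<open>l * K < m\<close>, hence it stays below
  \<open>2 * m\<close>. The 8 time units are the last evaluation of the guard.\<close>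

lemma scale_loop:
  assumes inv: "push_inv (threshold 1) s"
    and s: "nvar s ''K'' = 1" "nvar s ''l'' = l" "rvar s ''phi'' = \<phi>" "nvar s ''case'' = 0" "nvar s ''last'' = 0"
  shows "wp scale_loop (\<lambda>t s'. \<exists>t0. t = t0 + 8 \<and> loop_inv t0 s' \<and>
    \<not> (nvar s' ''case'' = 0 \<and> nvar s' ''last'' = 0)) s"
  unfolding scale_loop_def
proof (rule wp_While[where I = loop_inv and
    \<mu> = "\<lambda>s. if nvar s ''case'' = 0 \<and> nvar s ''last'' = 0 then Suc (2 * m - nvar s ''K'') else 0"], goal_cases)
  case 1
  \<comment> \<open>The first scale already respects \<open>l * K \<le> 2 * m\<close>, because
    \<open>l \<le> 2 ^ (l - 1) \<le> m\<close>.\<close>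
  have "l \<le> 2 ^ (l - 1)" using l(1) less_exp[of "l - 1"] by linarith
  then have "l * 2 ^ 0 \<le> 2 * m" using l(2) by simp
  then show ?case
    using inv s alpha gamma unfolding loop_inv_def by (intro conjI disjI1 exI[of _ 0]) auto
next
  case (2 t s)
  then obtain i where i: "nvar s ''case'' = 0" "nvar s ''last'' = 0" "nvar s ''K'' = 2 ^ i" "l * 2 ^ i \<le> 2 * m"
    "push_inv (threshold (2 ^ i)) s" "\<forall>j<i. scale_fails (2 ^ j)"
    "real t \<le> 300000 * (real (l * 2 ^ i) / (\<gamma> * \<alpha>))" "nvar s ''l'' = l" "rvar s ''phi'' = \<phi>"
    unfolding loop_inv_def by auto
  define w where "w = real (l * 2 ^ i) / (\<gamma> * \<alpha>)"
  have "0 < l * 2 ^ i" using l(1) by simp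
  then have li: "1 \<le> real (l * 2 ^ i)" by linarith
  note ga = gamma_alpha
  then have w: "1 \<le> w" using li by (simp add: w_def pos_le_divide_eq)
  \<comment> \<open>\<open>4000 * 64 = 256000\<close>; the gap to 300000 covers the overhead of one
    round.\<close>
  have thr: "4000 / (\<alpha> * threshold (2 ^ i)) = 256000 * w"
    using gamma alpha by (simp add: threshold_def w_def)
  have t: "real t \<le> 300000 * w" using i(7) by (simp add: w_def)
  have w2: "real (l * 2 ^ Suc i) / (\<gamma> * \<alpha>) = 2 * w" by (simp add: w_def)
  show ?case
  proof (rule wp_frame[OF scale_step[where K = "2 ^ i"]], goal_cases)
    case (7 u s')
    have fr: "nvar s' ''l'' = l" "rvar s' ''phi'' = \<phi>"
      using 7(2) i by (auto simp: frame_def scale_step_def push_phase_def top_sweep_def loop_defs)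
    let ?t = "t + (1 + bcost (BAnd (NLess (NVar ''case'') (NConst 1)) (NLess (NVar ''last'') (NConst 1))) + u)"
    have time: "real ?t \<le> 600000 * w"
      using 7(1) t w unfolding thr by simp
    have inv': "push_inv (threshold (2 ^ i)) s'" "\<forall>v\<in>V. residual s' v < threshold (2 ^ i) * d v"
      and K: "if l * 2 ^ i < m then nvar s' ''K'' = 2 ^ i + 2 ^ i \<and> nvar s' ''last'' = nvar s ''last''
         else nvar s' ''K'' = 2 ^ i \<and> nvar s' ''last'' = 1"
      and res: "nvar s' ''case'' = 0 \<and> scale_fails (2 ^ i) \<or> nvar s' ''case'' = 1 \<and> top_found (2 ^ i) (output_set s')"
      using 7(1) by auto
    from res show ?case
    proof
      assume c: "nvar s' ''case'' = 1 \<and> top_found (2 ^ i) (output_set s')"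
      then have "loop_inv ?t s'"
        unfolding loop_inv_def using fr i(4) time
        by (intro conjI disjI2 exI[of _ "2 ^ i"]) (simp_all add: w_def)
      then show ?thesis using c i by simp
    next
      assume c: "nvar s' ''case'' = 0 \<and> scale_fails (2 ^ i)"
      show ?thesis
      proof (cases "l * 2 ^ i < m")
        case True
        have "threshold (2 ^ Suc i) \<le> threshold (2 ^ i)"
          unfolding threshold_def using gamma l by (intro divide_left_mono) auto
        then have "push_inv (threshold (2 ^ Suc i)) s'"
          using push_inv_antimono[OF inv'(1)] threshold_pos[of "2 ^ Suc i"] by simp
        moreover have "\<forall>j<Suc i. scale_fails (2 ^ j)" using i(6) c by (auto simp: less_Suc_eq)
        moreover have "nvar s' ''K'' = 2 ^ Suc i" "nvar s' ''last'' = 0" using K True i by auto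
        moreover have "l * 2 ^ Suc i \<le> 2 * m" using True by simp
        moreover have "real ?t \<le> 300000 * (real (l * 2 ^ Suc i) / (\<gamma> * \<alpha>))"
          unfolding w2 using time by simp
        ultimately have linv: "loop_inv ?t s'"
          unfolding loop_inv_def using fr conjunct1[OF c]
          by (intro conjI disjI1 exI[of _ "Suc i"])
        have "1 * 2 ^ i \<le> l * 2 ^ i" using l(1) by (intro mult_right_mono) auto
        then have "(2::nat) ^ i < 2 * m" using True by linarith
        moreover have "(0::nat) < 2 ^ i" by simp
        ultimately have "2 * m - (2 ^ i + 2 ^ i) < 2 * m - 2 ^ i" by linarith
        then show ?thesis using linv c i K True by simp
      next
        case False
        have "\<forall>j\<le>i. scale_fails (2 ^ j)" using i(6) c by (auto simp: le_less)
        then have "loop_inv ?t s'"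
          unfolding loop_inv_def using fr time c False K i(4) inv'
          by (intro conjI disjI2 disjI1 exI[of _ i]) (auto simp: w_def)
        then show ?thesis using c i K False by simp
      qed
    qed
  qed (use i in auto)
next
  case (3 t s')
  then show ?case by auto
qed

lemma search:
  assumes inv: "push_inv (threshold 1) s"
    and s: "nvar s ''K'' = 1" "nvar s ''l'' = l" "rvar s ''phi'' = \<phi>" "nvar s ''case'' = 0" "nvar s ''last'' = 0"
  shows "wp (scale_loop ;; Cond (NLess (NVar ''case'') (NConst 1)) bottom_sweep Skip)
    (\<lambda>t s'. real t \<le> 1300000 * (real m / (\<gamma> * \<alpha>)) \<and>
      (nvar s' ''case'' = 1 \<and> (\<exists>K>0. top_found K (output_set s') \<and>
          real t \<le> 700000 * (real (l * K) / (\<gamma> * \<alpha>))) \<or>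
       nvar s' ''case'' = 2 \<and> found (output_set s') \<and> small \<subseteq> output_set s' \<or>
       nvar s' ''case'' = 3 \<and> small = {})) s"
proof -
  note ga = gamma_alpha
  have one: "1 \<le> x / (\<gamma> * \<alpha>)" if "1 \<le> x" for x
    using that ga by (simp add: pos_le_divide_eq)
  show ?thesis
    unfolding wp_Seq
  proof (rule wp_frame[OF scale_loop[OF inv s]], goal_cases)
    case (1 t s')
    then obtain t0 where t0: "t = t0 + 8" "loop_inv t0 s'" "\<not> (nvar s' ''case'' = 0 \<and> nvar s' ''last'' = 0)"
      by auto
    then consider
      (last) i where "nvar s' ''case'' = 0" "l * 2 ^ i \<le> 2 * m" "m \<le> l * 2 ^ i"
        "push_inv (threshold (2 ^ i)) s'" "\<forall>v\<in>V. residual s' v < threshold (2 ^ i) * d v"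
        "\<forall>j\<le>i. scale_fails (2 ^ j)" "real t0 \<le> 600000 * (real (l * 2 ^ i) / (\<gamma> * \<alpha>))" "rvar s' ''phi'' = \<phi>"
      | (top) K where "nvar s' ''case'' = 1" "0 < K" "l * K \<le> 2 * m" "top_found K (output_set s')"
        "real t0 \<le> 600000 * (real (l * K) / (\<gamma> * \<alpha>))"
      unfolding loop_inv_def by auto
    then show ?case
    proof cases
      case top
      have "0 < l * K" using l(1) top(2) by simp
      then have "1 \<le> real (l * K)" by linarith
      from one[OF this] have "real (t + 5) \<le> 700000 * (real (l * K) / (\<gamma> * \<alpha>))"
        using top(5) t0(1) by simp
      moreover have "real (l * K) / (\<gamma> * \<alpha>) \<le> real (2 * m) / (\<gamma> * \<alpha>)"
        using top(3) ga by (intro divide_right_mono) (auto simp flip: of_nat_mult)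
      then have "real (t + 5) \<le> 1300000 * (real m / (\<gamma> * \<alpha>))"
        using one[of "real m"] top(5) t0(1) m_pos by simp
      ultimately show ?thesis using top by (auto simp: wp_simps)
    next
      case last
      \<comment> \<open>The number of scales is at most \<open>l\<close>, as
        \<open>dyadic_scales\<close> requires: \<open>2 ^ i \<le> 2 * m < 2 ^ Suc l\<close>.\<close>
      have "2 ^ i \<le> l * 2 ^ i" using l(1) by simp
      then have "(2::nat) ^ i < 2 ^ Suc l" using last(2) l(3) unfolding power_Suc by linarith
      then have i: "i \<le> l" using power_less_imp_less_exp[of "2::nat" i "Suc l"] by simp
      have "real m \<le> real l * real (2 ^ i)" using last(3) by (simp only: of_nat_mult[symmetric] of_nat_le_iff)
      note bottom = bottom_sweep[OF last(4,5) refl last(8) i this]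
      have "real (l * 2 ^ i) / (\<gamma> * \<alpha>) \<le> real (2 * m) / (\<gamma> * \<alpha>)"
        using last(2) ga by (intro divide_right_mono) (auto simp flip: of_nat_mult)
      then have t: "real (t + 5) \<le> 1200020 * (real m / (\<gamma> * \<alpha>))"
        using one[of "real m"] last(7) t0(1) m_pos by simp
      have "real m / \<alpha> \<le> real m / (\<gamma> * \<alpha>)"
        using alpha gamma by (intro divide_left_mono) auto
      have time: "real (t + (1 + bcost (NLess (NVar ''case'') (NConst 1)) + u)) \<le> 1300000 * (real m / (\<gamma> * \<alpha>))"
        if u: "real u \<le> 1000 * (real m / \<alpha>)" for u
      proof -
        have "4 + (a + b) \<le> 1300000 * y" if "a + 5 \<le> 1200020 * y" "b \<le> 1000 * z" "z \<le> y" "1 \<le> y"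
          for a b y z :: real
          using that by linarith
        from this[OF _ u \<open>real m / \<alpha> \<le> _\<close>, of "real t"] show ?thesis
          using t one[of "real m"] m_pos by simp
      qed
      have "wp bottom_sweep (\<lambda>u s'. real (t + (1 + bcost (NLess (NVar ''case'') (NConst 1)) + u)) \<le> 1300000 * (real m / (\<gamma> * \<alpha>)) \<and>
        (nvar s' ''case'' = 2 \<and> found (output_set s') \<and> small \<subseteq> output_set s' \<or>
         nvar s' ''case'' = 3 \<and> small = {})) s'"
        by (rule wp_mono[OF bottom]) (use last(6) time in auto)
      then show ?thesis
        using last(1) by (simp add: wp_Cond) (erule wp_mono, auto)
    qed
  qed
qed

text \<open>Both follow from \<open>l - 1 \<le> log 2 m\<close>. For \<open>m = 1\<close> the
  logarithm is 0, so a bound by a multiple of it needs \<open>m \<ge> 2\<close>.\<close>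

lemma log_bounds: "real l \<le> log 2 (8 * real m)" "2 \<le> m \<Longrightarrow> real l \<le> 2 * log 2 (real m)"
proof -
  have "log 2 (2 ^ (l - 1)) \<le> log 2 (real m)"
    using l(2) by (intro log_mono) (auto simp flip: of_nat_le_iff)
  then have le: "real l - 1 \<le> log 2 (real m)" using l(1) by (simp add: log_nat_power of_nat_diff)
  have "log 2 (8 * real m) = 3 + log 2 (real m)"
    using m_pos log_nat_power[of "2::real" 2 3] by (simp add: log_mult)
  then show "real l \<le> log 2 (8 * real m)" using le by simp
  assume "2 \<le> m"
  then have "log 2 2 \<le> log 2 (real m)" by (intro log_mono) auto
  then show "real l \<le> 2 * log 2 (real m)" using le by simp
qed

text \<open>The preparation time \<open>t0\<close> is at most
  \<open>90 * l / (\<gamma> * \<alpha>)\<close>, which is dominated by the global bound because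
  \<open>l \<le> m\<close>, and by the local bound because \<open>K \<ge> 1\<close>.\<close>

lemma outcomeI:
  assumes \<phi>_sq: "\<phi>\<^sup>2 \<le> 4 * (576 * \<alpha> * real l / \<gamma>)" and t0: "real t0 \<le> 60 * real l + 30 / \<phi>"
    and t: "real t \<le> 1300000 * (real m / (\<gamma> * \<alpha>))"
    and res: "nvar s ''case'' = 1 \<and> (\<exists>K>0. top_found K (output_set s) \<and>
          real t \<le> 700000 * (real (l * K) / (\<gamma> * \<alpha>))) \<or>
       nvar s ''case'' = 2 \<and> found (output_set s) \<and> small \<subseteq> output_set s \<or>
       nvar s ''case'' = 3 \<and> small = {}"
  shows "outcome (t0 + t) s"
proof -
  note ga = gamma_alpha
  have l1: "1 \<le> real l" using l(1) by simp
  \<comment> \<open>Makes the time \<open>30 / \<phi>\<close> of \<open>phi_loop\<close>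
    harmless.\<close>
  have "\<alpha> \<le> \<phi>"
  proof (cases "\<phi> < 1")
    case True
    have "\<alpha> * 1 \<le> \<alpha> * (576 * real l)" using l1 alpha by (intro mult_left_mono) auto
    also have "\<dots> \<le> \<gamma> * \<phi>\<^sup>2" using phi_bound[OF True] by (simp add: mult_ac)
    also have "\<dots> \<le> 1 * (\<phi> * 1)" unfolding power2_eq_square using gamma phi by (intro mult_mono) auto
    finally show ?thesis by simp
  qed (use alpha in simp)
  then have "1 / \<phi> \<le> 1 / \<alpha>" using alpha by (intro divide_left_mono) auto
  also have "\<dots> \<le> real l / (\<gamma> * \<alpha>)" using ga l1 alpha by (intro frac_le) auto
  finally have phi_inv: "1 / \<phi> \<le> real l / (\<gamma> * \<alpha>)" .
  have "real l / 1 \<le> real l / (\<gamma> * \<alpha>)" using ga by (intro divide_left_mono) auto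
  moreover have "30 / \<phi> = 30 * (1 / \<phi>)" by simp
  ultimately have t0': "real t0 \<le> 90 * (real l / (\<gamma> * \<alpha>))" using phi_inv t0 by linarith
  have "l \<le> m" using l(1,2) less_exp[of "l - 1"] by linarith
  then have "real l / (\<gamma> * \<alpha>) \<le> real m / (\<gamma> * \<alpha>)" using ga by (intro divide_right_mono) auto
  moreover have "0 \<le> real m / (\<gamma> * \<alpha>)" using ga by simp
  ultimately have time: "real (t0 + t) \<le> 2000000 * (real m / (\<gamma> * \<alpha>))"
  proof -
    have "a + b \<le> 2000000 * y" if "a \<le> 90 * x" "b \<le> 1300000 * y" "x \<le> y" "0 \<le> y" for a b x y :: real
      using that by linarith
    from this[OF t0' t] show ?thesis
      using \<open>real l / (\<gamma> * \<alpha>) \<le> _\<close> \<open>0 \<le> real m / (\<gamma> * \<alpha>)\<close> by simp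
  qed
  have cond: "\<phi> \<le> 2000000 * sqrt (\<alpha> * log 2 (real m) / \<gamma>)" if m2: "2 \<le> m"
  proof -
    have "\<phi>\<^sup>2 \<le> 2304 * (\<alpha> / \<gamma>) * real l" using \<phi>_sq by simp
    also have "\<dots> \<le> 2304 * (\<alpha> / \<gamma>) * (2 * log 2 (real m))"
      using log_bounds(2)[OF m2] alpha gamma by (intro mult_left_mono) auto
    also have "\<dots> = 4608 * (\<alpha> * log 2 (real m) / \<gamma>)" by simp
    also have "\<dots> \<le> 2000000\<^sup>2 * (\<alpha> * log 2 (real m) / \<gamma>)"
      using alpha gamma m2 by (intro mult_right_mono) auto
    also have "\<dots> = (2000000 * sqrt (\<alpha> * log 2 (real m) / \<gamma>))\<^sup>2"
      unfolding power_mult_distrib using alpha gamma m2 by simp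
    finally show ?thesis by (rule power2_le_imp_le) (use alpha gamma m2 in simp)
  qed
  have found': "T \<subseteq> V \<and> T \<noteq> {} \<and> vol G T \<le> m \<and>
      (m \<ge> 2 \<longrightarrow> conductance G T \<le> 2000000 * sqrt (\<alpha> * log 2 (real m) / \<gamma>))" if "found T" for T
    using that cond unfolding found_def by (auto intro: order_trans)
  from res consider
    (top) K where "nvar s ''case'' = 1" "0 < K" "top_found K (output_set s)"
      "real t \<le> 700000 * (real (l * K) / (\<gamma> * \<alpha>))"
    | (bottom) "nvar s ''case'' = 2" "found (output_set s)" "small \<subseteq> output_set s"
    | (none) "nvar s ''case'' = 3" "small = {}"
    by auto
  then show ?thesis
  proof cases
    case top
    let ?T = "output_set s"
    have T: "found ?T" "K \<le> vol G ?T" "\<gamma> / (64 * real l) \<le> excess G q ?T"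
      using top(3) by (auto simp: top_found_def)
    have "\<gamma> / (64 * log 2 (8 * real m)) \<le> \<gamma> / (64 * real l)"
      using log_bounds(1) l1 gamma by (intro divide_left_mono mult_pos_pos) auto
    then have excess: "\<gamma> / (64 * log 2 (8 * real m)) \<le> excess G q ?T" using T(3) by simp
    have local_time: "real (t0 + t) \<le> 2000000 * (real (vol G ?T) * log 2 (real m) / (\<gamma> * \<alpha>))" if m2: "2 \<le> m"
    proof -
      have "real l * 1 \<le> real l * real K" using top(2) by (intro mult_left_mono) auto
      then have "real l / (\<gamma> * \<alpha>) \<le> real (l * K) / (\<gamma> * \<alpha>)" using ga by (intro divide_right_mono) auto
      moreover have "0 \<le> real (l * K) / (\<gamma> * \<alpha>)" using ga by simp
      moreover have "a + b \<le> 1000000 * y" if "a \<le> 90 * x" "b \<le> 700000 * y" "x \<le> y" "0 \<le> y" for a b x y :: real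
        using that by linarith
      ultimately have "real (t0 + t) \<le> 1000000 * (real (l * K) / (\<gamma> * \<alpha>))"
        unfolding of_nat_add using t0' top(4) by blast
      \<comment> \<open>The found set has volume at least \<open>K\<close>, which turns the time of
        the scale into a time local to the set.\<close>
      also have "real (l * K) \<le> 2 * log 2 (real m) * real (vol G ?T)"
        unfolding of_nat_mult using log_bounds(2)[OF m2] T(2) m2 by (intro mult_mono) auto
      then have "1000000 * (real (l * K) / (\<gamma> * \<alpha>)) \<le>
          1000000 * (2 * log 2 (real m) * real (vol G ?T) / (\<gamma> * \<alpha>))"
        using ga by (intro mult_left_mono divide_right_mono) auto
      finally show ?thesis by (simp add: mult_ac)
    qed
    show ?thesis
      using time top(1) found'[OF T(1)] excess local_time
      by (simp add: outcome_def Let_def output_case_def)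
  next
    case bottom
    then show ?thesis
      using time found'[OF bottom(2)] by (simp add: outcome_def Let_def output_case_def small_def)
  next
    case none
    then show ?thesis using time by (simp add: outcome_def Let_def output_case_def small_def)
  qed
qed

end

context pagerank_input
begin

lemma program: "wp program outcome (initial_state m A \<alpha> \<gamma> p0 L)"
proof -
  let ?s = "initial_state m A \<alpha> \<gamma> p0 L"
  have inp: "input ?s" using push_inv_initial[of 1] by (simp add: push_inv_def)
  have "wp prepare (\<lambda>t s. wp (scale_loop ;; Cond (NLess (NVar ''case'') (NConst 1)) bottom_sweep Skip)
    (\<lambda>u. outcome (t + u)) s) ?s"
  proof (rule wp_frame[OF prepare[OF inp]], goal_cases)
    case (1 t s)
    then have params: "sweep_params G A \<alpha> \<gamma> p0 L (nvar s ''l'') (rvar s ''phi'')"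
      and \<phi>_sq: "(rvar s ''phi'')\<^sup>2 \<le> 4 * (576 * \<alpha> * real (nvar s ''l'') / \<gamma>)"
      and t: "real t \<le> 60 * real (nvar s ''l'') + 30 / rvar s ''phi''" and K: "nvar s ''K'' = 1"
      by auto
    have zero: "nvar s ''case'' = 0" "nvar s ''last'' = 0"
      using 1(2) by (auto simp: frame_def prepare_def pow_loop_def phi_loop_def initial_state_def)
    have inv: "push_inv e s" for e
      using push_inv_initial[of e] 1(2)
      by (simp add: frame_def prepare_def pow_loop_def phi_loop_def push_inv_def input_def residual_def)
    show ?case
      by (rule wp_mono[OF sweep_params.search[OF params inv K refl refl zero]])
        (rule sweep_params.outcomeI[OF params \<phi>_sq t], auto)
  qed
  then show ?thesis unfolding program_def wp_Seq .
qed

end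

theorem theorem9:
  shows "\<exists>(prog :: com) (C :: real). C > 0 \<and>
    (\<forall>(G :: nat mgraph) (A :: nat list list) (\<alpha> :: real) (\<gamma> :: real) (p0 :: nat \<Rightarrow> real) (L :: nat list).
      multigraph G \<and> (\<forall>v\<in>verts G. deg G v > 0) \<and> adjacency_lists G A \<and>
      0 < \<alpha> \<and> \<alpha> \<le> 1 / 3 \<and> 0 < \<gamma> \<and> \<gamma> < 1 \<and>
      mass_distribution G p0 \<and> mass p0 (verts G) = 1 \<and> density_listing G p0 L
      \<longrightarrow>
      (let m = num_edges G;
           ps = PR G \<alpha> p0;
           small = {u \<in> verts G. mass_density G ps u \<le> (1 - \<gamma>) / (2 * real m)}
       in \<exists>time s.
            exec prog (initial_state m A \<alpha> \<gamma> p0 L) time s \<and>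
            real time \<le> C * (real m / (\<gamma> * \<alpha>)) \<and>
            (let T = output_set s;
                 found = (T \<subseteq> verts G \<and> T \<noteq> {} \<and> vol G T \<le> m \<and>
                   (m \<ge> 2 \<longrightarrow> conductance G T \<le> C * sqrt (\<alpha> * log 2 (real m) / \<gamma>)))
             in
               (output_case s = 1 \<and> found \<and>
                 (m \<ge> 2 \<longrightarrow> real time \<le> C * (real (vol G T) * log 2 (real m) / (\<gamma> * \<alpha>))) \<and>
                 excess G ps T \<ge> \<gamma> / (64 * log 2 (8 * real m)))
             \<or> (output_case s = 2 \<and> found \<and> small \<subseteq> T)
             \<or> (output_case s = 3 \<and> small = {}))))"
proof (intro exI[of _ program] exI[of _ 2000000] conjI allI impI)
  fix G :: "nat mgraph" and A :: "nat list list" and \<alpha> \<gamma> :: real and p0 :: "nat \<Rightarrow> real" and L :: "nat list"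
  assume "multigraph G \<and> (\<forall>v\<in>verts G. deg G v > 0) \<and> adjacency_lists G A \<and>
      0 < \<alpha> \<and> \<alpha> \<le> 1 / 3 \<and> 0 < \<gamma> \<and> \<gamma> < 1 \<and>
      mass_distribution G p0 \<and> mass p0 (verts G) = 1 \<and> density_listing G p0 L"
  then interpret pagerank_input G A \<alpha> \<gamma> p0 L by unfold_locales auto
  show "let m = num_edges G; ps = PR G \<alpha> p0;
      small = {u \<in> verts G. mass_density G ps u \<le> (1 - \<gamma>) / (2 * real m)}
    in \<exists>time s. exec program (initial_state m A \<alpha> \<gamma> p0 L) time s \<and>
      real time \<le> 2000000 * (real m / (\<gamma> * \<alpha>)) \<and>
      (let T = output_set s;
           found = (T \<subseteq> verts G \<and> T \<noteq> {} \<and> vol G T \<le> m \<and>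
             (m \<ge> 2 \<longrightarrow> conductance G T \<le> 2000000 * sqrt (\<alpha> * log 2 (real m) / \<gamma>)))
       in (output_case s = 1 \<and> found \<and>
            (m \<ge> 2 \<longrightarrow> real time \<le> 2000000 * (real (vol G T) * log 2 (real m) / (\<gamma> * \<alpha>))) \<and>
            excess G ps T \<ge> \<gamma> / (64 * log 2 (8 * real m)))
        \<or> (output_case s = 2 \<and> found \<and> small \<subseteq> T)
        \<or> (output_case s = 3 \<and> small = {}))"
    using program unfolding wp_def outcome_def Let_def .
qed simp

end
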